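(* Assume the Riemann Hypothesis. Let $\rho''=\beta''+i\gamma''$ be a complex (non-real) zero of $\zeta''(s)$ with $\beta''>1/2$ and $\gamma''>0$. For $s=\sigma+it$, $t>0$, in a vertical strip $a\le\sigma\le b$, \[ \frac{\zeta''}{\zeta'}(s)=\frac{\log(\gamma''/t)}{2}+\sum_{\lambda'}\frac{\rho''-s}{(s-\lambda')(\rho''-\lambda')}+O\!\left(\frac1t\right)+O\!\left(\frac1{\gamma''}\right), \] where the sum is over all non-real zeros $\lambda'$ of $\zeta'(s)$. The sum is uniformly convergent on compact sets.
   Context: $\zeta$ is the Riemann zeta function. The sum over $\lambda'$ runs over all non-real zeros of $\zeta'$ in both half planes, counted with multiplicity. It is understood that $s$ is not a zero of $\zeta'$ and that $\zeta'(\rho'')\ne0$, so that all terms are defined; uniform convergence on compact sets is meant in the usual sense for partial fraction expansions (away from the poles $\lambda'$). The implied constants depend at most on $a,b$. *)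

theory Defs
  imports "HOL-Complex_Analysis.Complex_Analysis"
begin

(* The analytic continuation of the Dirichlet series to the plane without s = 1, unique by the
   identity theorem. The value at the pole is irrelevant; it is fixed to 0 only so that the
   function is determined on the whole type. *)
definition zeta :: "complex \<Rightarrow> complex" where
  "zeta = (THE f. f holomorphic_on (- {1}) \<and> f 1 = 0 \<and>
      (\<forall>s. Re s > 1 \<longrightarrow> (\<lambda>n::nat. 1 / of_nat (Suc n) powr s) sums f s))"

(* The point 1 is excluded because zeta 1 = 0 is an artefact of totality. *)
definition Riemann_Hypothesis :: bool where
  "Riemann_Hypothesis \<longleftrightarrow>
     (\<forall>s. zeta s = 0 \<and> s \<noteq> 1 \<and> (\<forall>n::nat. n \<ge> 1 \<longrightarrow> s \<noteq> - of_nat (2 * n)) \<longrightarrow> Re s = 1/2)"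

definition zeta'_zeros :: "complex set" where
  "zeta'_zeros = {l. deriv zeta l = 0 \<and> Im l \<noteq> 0}"

(* Zeros are counted with multiplicity: zorder weights each distinct zero. *)
definition zero_term :: "complex \<Rightarrow> complex \<Rightarrow> complex \<Rightarrow> complex" where
  "zero_term \<rho> s l =
     of_int (zorder (deriv zeta) l) * ((\<rho> - s) / ((s - l) * (\<rho> - l)))"

end

theory Submission
  imports Defs "HOL-Real_Asymp.Real_Asymp"
begin

text \<open>
  The function \<open>F(s) = (s - 1)\<^sup>2 \<zeta>'(s)\<close> is entire of order \<open>1\<close>, so the difference of
  \<open>F'/F\<close> at \<open>s\<close> and at \<open>\<rho>''\<close> is the absolutely convergent sum of
  \<open>1/(s - \<lambda>) - 1/(\<rho>'' - \<lambda>)\<close> over all zeros \<open>\<lambda>\<close> of \<open>F\<close>. At \<open>\<rho>''\<close> only the pole term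
  survives, so everything reduces to the contribution of the real zeros. By the functional
  equation all but finitely many of these are simple and there is exactly one in each interval
  \<open>(-2n - 2, -2n)\<close>, hence their contribution is a Riemann sum for
  \<open>1/2 \<integral> (1/(s + x) - 1/(\<rho>'' + x)) dx\<close>, which produces the logarithm.

  The functional equation is obtained by expanding \<open>1/(e\<^sup>x - 1) + 1/2 - 1/x\<close> once into
  trapezoidal errors of \<open>y \<mapsto> e\<^bsup>-xy\<^esup>\<close> and once into partial fractions, and integrating both
  expansions against \<open>x\<^bsup>s-1\<^esup>\<close> for real \<open>s\<close> between \<open>-1\<close> and \<open>0\<close>; all terms are nonnegative.
\<close>

section \<open>Logarithmic derivatives of entire functions of order less than two\<close>

text \<open>No Hadamard product is formed. Only the finitely many zeros in a disc of radius
  \<open>R\<close> are divided out. The logarithm of what remains has second derivative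
  O(\<open>R\<close> powr (3/2 - 2)) near the centre, so its logarithmic derivatives at two fixed
  points differ by a quantity that tends to 0 as \<open>R\<close> grows. Comparing two points also
  removes the linear exponential factor that a product formula would carry. The error constant may
  depend on \<open>a\<close> and \<open>b\<close> only, yet the real part of \<rho>'' is not
  confined to that strip. The upper bound for it comes from the nonvanishing of zeta'' far to the
  right, where the term 2 powr (-s) dominates; the lower bound 1/2 is given. The interval -1 < s < 0
  in the functional equation is forced: 1/(e^x - 1) + 1/2 - 1/x behaves like x/12 at 0 and tends to
  1/2 at infinity, so its integral against x powr (s - 1) converges exactly there. The equation then
  spreads to complex \<open>s\<close> by the identity theorem.\<close>

lemma borel_caratheodory_half:
  fixes L :: "complex \<Rightarrow> complex"
  assumes hol: "L holomorphic_on ball c R" and R: "R > 0" and L0: "L c = 0"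
    and Re: "\<And>z. z \<in> ball c R \<Longrightarrow> Re (L z) < K" and z: "norm (z - c) \<le> R / 2"
  shows "norm (L z) \<le> 2 * K"
proof -
  have K: "K > 0" using Re[of c] R L0 by simp
  \<comment> \<open>The map \<open>u / (2 * K - u)\<close> sends the half plane Re u < K into the
    unit disc and fixes 0; \<open>w\<close> rescales the disc to radius one. Schwarz gives norm (f
    w) \<le> 1/2 at half the radius, and solving for \<open>L z\<close> yields the bound.\<close>
  define f where "f = (\<lambda>w. L (c + of_real R * w) / (2 * of_real K - L (c + of_real R * w)))"
  have inb: "c + of_real R * w \<in> ball c R" if "norm w < 1" for w
    using that R by (simp add: dist_norm norm_mult)
  have ne: "2 * of_real K - L (c + of_real R * w) \<noteq> 0" if "norm w < 1" for w
  proof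
    assume "2 * of_real K - L (c + of_real R * w) = 0"
    then have "L (c + of_real R * w) = of_real (2 * K)" by simp
    then have "Re (L (c + of_real R * w)) = 2 * K" by simp
    then show False using Re[OF inb[OF that]] K by simp
  qed
  have holf: "f holomorphic_on ball 0 1"
  proof -
    have "(\<lambda>w. L (c + of_real R * w)) holomorphic_on ball 0 1"
      by (rule holomorphic_on_compose_gen[OF _ hol, unfolded o_def])
         (use inb in \<open>auto intro!: holomorphic_intros simp del: mem_ball simp: mem_ball_0\<close>)
    then show ?thesis unfolding f_def using ne by (intro holomorphic_intros) auto
  qed
  have lt: "norm (f w) < 1" if w: "norm w < 1" for w
  proof -
    define u where "u = L (c + of_real R * w)"
    have "Re u < K" unfolding u_def using Re[OF inb[OF w]] .
    then have "0 < 4 * K * (K - Re u)" using K by simp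
    also have "\<dots> = (2 * K - Re u)\<^sup>2 - (Re u)\<^sup>2"
      by (simp add: power2_eq_square algebra_simps)
    finally have "(Re u)\<^sup>2 < (2 * K - Re u)\<^sup>2" by simp
    then have "(norm u)\<^sup>2 < (norm (2 * of_real K - u))\<^sup>2"
      by (simp add: cmod_power2)
    then have "norm u < norm (2 * of_real K - u)" by (rule power2_less_imp_less) simp
    moreover have "f w = u / (2 * of_real K - u)" by (simp add: f_def u_def)
    ultimately show ?thesis
      by (metis norm_divide divide_less_eq_1_pos norm_ge_zero order_le_less_trans)
  qed
  have f0: "f 0 = 0" by (simp add: f_def L0)
  define w where "w = (z - c) / of_real R"
  have nw: "norm w \<le> 1/2" using z R by (simp add: w_def norm_divide field_simps)
  have zw: "c + of_real R * w = z" using R by (simp add: w_def)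
  have S: "norm (f w) \<le> norm w"
    using Schwarz_Lemma(1)[OF holf f0 lt, of w] nw by auto
  have fw: "norm (f w) \<le> 1/2" using S nw by linarith
  have "L z = f w * (2 * of_real K - L z)"
    using ne[of w] nw unfolding f_def zw by auto
  then have "norm (L z) = norm (f w) * norm (2 * of_real K - L z)" by (metis norm_mult)
  also have "\<dots> \<le> 1/2 * (2 * K + norm (L z))"
    using fw norm_triangle_ineq4[of "2 * of_real K" "L z"] K
    by (intro mult_mono) (auto simp: norm_mult)
  finally show ?thesis by simp
qed

section \<open>Dividing out the zeros in a disc\<close>

lemma zorder_linear_power:
  "zorder (\<lambda>z. (z - l) ^ m) w = (if w = l then int m else 0)"
proof (cases "w = l")
  case True
  then show ?thesis
    by (simp, intro zorder_eqI[where S = UNIV and g = "\<lambda>_. 1"]) (auto)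
next
  case False
  then show ?thesis
    by (simp, intro zorder_eq_0I) (auto intro!: analytic_intros)
qed

lemma entire_frequently_nonzero:
  assumes hol: "F holomorphic_on UNIV" and c: "F c \<noteq> 0"
  shows "F analytic_on {z}" "\<exists>\<^sub>F w in at z. F w \<noteq> 0"
proof -
  show "F analytic_on {z}"
    using hol by (simp add: analytic_on_open analytic_on_subset[OF _ subset_UNIV])
  show "\<exists>\<^sub>F w in at z. F w \<noteq> 0"
    using non_zero_neighbour_alt[OF hol, of z c] c
    by (intro eventually_frequently) (auto simp: eventually_conj_iff)
qed

lemma holomorphic_factor_zeros_ball:
  fixes F :: "complex \<Rightarrow> complex" and r :: real
  assumes hol: "F holomorphic_on UNIV" and c: "F c \<noteq> 0"
  defines "Z \<equiv> {l \<in> ball c r. F l = 0}"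
  obtains h where "h holomorphic_on ball c r" "\<And>z. z \<in> ball c r \<Longrightarrow> h z \<noteq> 0"
    "\<And>z. z \<in> ball c r \<Longrightarrow> F z = h z * (\<Prod>l\<in>Z. (z - l) ^ nat (zorder F l))" "finite Z"
proof (cases "r > 0")
  case False
  then have "ball c r = {}" by simp
  then show ?thesis by (intro that[of "\<lambda>_. 1"]) (simp_all add: Z_def del: mem_ball ball_eq_empty)
next
  case r: True
  have "finite {l \<in> cball c r. F l = 0}"
  proof (cases "F constant_on UNIV")
    case True
    then have "{l \<in> cball c r. F l = 0} = {}" using c unfolding constant_on_def by force
    then show ?thesis by (metis finite.emptyI)
  next
    case False
    then show ?thesis
      by (intro holomorphic_compact_finite_zeros[of F UNIV "cball c r"]) (use hol in auto)
  qed
  then have fin: "finite Z" unfolding Z_def by (rule rev_finite_subset) auto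
  note an = entire_frequently_nonzero[OF hol c]
  have pos: "zorder F z > 0 \<longleftrightarrow> F z = 0" for z
    by (rule zorder_pos_iff'[OF an])
  have eq0: "zorder F z = 0 \<longleftrightarrow> F z \<noteq> 0" for z
    by (rule zorder_eq_0_iff[OF an])
  define P where "P = (\<lambda>z. \<Prod>l\<in>Z. (z - l) ^ nat (zorder F l))"
  have P0: "P z = 0 \<longleftrightarrow> z \<in> Z" for z
  proof -
    have "P z = 0 \<longleftrightarrow> (\<exists>l\<in>Z. z = l \<and> nat (zorder F l) > 0)"
      unfolding P_def using fin by auto
    then show ?thesis using pos unfolding Z_def by auto
  qed
  have evn: "\<forall>\<^sub>F z in at w. P z \<noteq> 0" for w
    unfolding P0 using islimpt_finite[OF fin, of w]
    by (simp add: islimpt_iff_eventually)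
  have zP: "zorder P w = (if w \<in> Z then zorder F w else 0)" for w
  proof -
    have "zorder P w = (\<Sum>l\<in>Z. zorder (\<lambda>z. (z - l) ^ nat (zorder F l)) w)"
      unfolding P_def
      by (rule zorder_prod_analytic) (use evn[of w] in \<open>auto intro!: analytic_intros simp: P_def\<close>)
    also have "\<dots> = (\<Sum>l\<in>Z. if w = l then int (nat (zorder F l)) else 0)"
      by (simp add: zorder_linear_power)
    also have "\<dots> = (if w \<in> Z then int (nat (zorder F w)) else 0)"
      using fin by (simp add: sum.delta)
    also have "\<dots> = (if w \<in> Z then zorder F w else 0)"
      using pos[of w] unfolding Z_def by auto
    finally show ?thesis .
  qed
  obtain h where "h holomorphic_on ball c r" "\<And>z. z \<in> ball c r \<Longrightarrow> h z \<noteq> 0"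
    "\<And>z. z \<in> ball c r \<Longrightarrow> F z = h z * P z"
  proof (rule holomorphic_zorder_factorization[of F "ball c r" P])
    show "F holomorphic_on ball c r" using hol holomorphic_on_subset by blast
    show "P holomorphic_on ball c r" unfolding P_def by (intro holomorphic_intros)
    show "P z = 0 \<longleftrightarrow> F z = 0" if "z \<in> ball c r" for z
      using that unfolding P0 Z_def by auto
    show "zorder P z = zorder F z" if "z \<in> ball c r" for z
      using that eq0[of z] unfolding zP Z_def by auto
  qed auto
  then show ?thesis using that fin unfolding P_def by blast
qed

lemma has_field_derivative_prod_linear_powers:
  fixes z :: complex
  assumes "finite Z" "z \<notin> Z"
  shows "((\<lambda>z. \<Prod>l\<in>Z. (z - l) ^ m l) has_field_derivative
           ((\<Prod>l\<in>Z. (z - l) ^ m l) * (\<Sum>l\<in>Z. of_nat (m l) / (z - l)))) (at z)"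
  using assms
proof (induction Z rule: finite_induct)
  case (insert a Z)
  have d: "((\<lambda>z. (z - a) ^ m a) has_field_derivative (z - a) ^ m a * (of_nat (m a) / (z - a))) (at z)"
  proof (cases "m a")
    case (Suc k)
    have "of_nat (Suc k) * (z - a) ^ k = (z - a) ^ m a * (of_nat (m a) / (z - a))"
      using insert.prems Suc by simp
    with DERIV_power[OF DERIV_diff[OF DERIV_ident DERIV_const[of a]], where n = "Suc k" and x = z and s = UNIV]
    show ?thesis unfolding Suc by simp
  qed auto
  have "((\<lambda>z. (z - a) ^ m a * (\<Prod>l\<in>Z. (z - l) ^ m l)) has_field_derivative
      (z - a) ^ m a * (of_nat (m a) / (z - a)) * (\<Prod>l\<in>Z. (z - l) ^ m l) +
      (\<Prod>l\<in>Z. (z - l) ^ m l) * (\<Sum>l\<in>Z. of_nat (m l) / (z - l)) * (z - a) ^ m a) (at z)"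
    using DERIV_mult[OF d insert.IH] insert.prems by simp
  then show ?case using insert.hyps
    by (simp add: algebra_simps)
qed auto


text \<open>On the circle of radius 4R every zero in the disc of radius R is at distance at least
  3R, so at least three times as far as from the centre. Hence the polynomial grows by the factor
  \<open>3 ^ n\<close> from the centre to the circle, and by the maximum principle \<open>g\<close>
  gains exactly that factor. The radius 5R only gives open room around the closed disc of radius 4R;
  zeros outside radius R stay in \<open>g\<close>.\<close>

lemma factor_zeros_disc:
  fixes F :: "complex \<Rightarrow> complex" and R M :: real
  assumes hol: "F holomorphic_on UNIV" and c: "F c \<noteq> 0" and R: "R > 0"
    and bnd: "\<And>z. z \<in> cball c (4 * R) \<Longrightarrow> norm (F z) \<le> M * norm (F c)"
  defines "Z \<equiv> {l \<in> cball c R. F l = 0}"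
  obtains g where "g holomorphic_on ball c (5 * R)" "\<And>z. z \<in> cball c R \<Longrightarrow> g z \<noteq> 0"
    "\<And>z. z \<in> ball c (5 * R) \<Longrightarrow> F z = g z * (\<Prod>l\<in>Z. (z - l) ^ nat (zorder F l))"
    "\<And>z. z \<in> cball c R \<Longrightarrow> norm (g z) \<le> M * norm (g c)"
    "finite Z" "3 ^ (\<Sum>l\<in>Z. nat (zorder F l)) \<le> M"
proof -
  define Z5 where "Z5 = {l \<in> ball c (5 * R). F l = 0}"
  obtain h where h: "h holomorphic_on ball c (5 * R)" "\<And>z. z \<in> ball c (5 * R) \<Longrightarrow> h z \<noteq> 0"
    "\<And>z. z \<in> ball c (5 * R) \<Longrightarrow> F z = h z * (\<Prod>l\<in>Z5. (z - l) ^ nat (zorder F l))" "finite Z5"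
    by (rule holomorphic_factor_zeros_ball[OF hol c, of "5 * R", folded Z5_def]) (rule that)
  have sub: "Z \<subseteq> Z5" unfolding Z_def Z5_def using R by auto
  then have fin: "finite Z" using h(4) finite_subset by blast
  define g where "g = (\<lambda>z. h z * (\<Prod>l\<in>Z5 - Z. (z - l) ^ nat (zorder F l)))"
  define P where "P = (\<lambda>z. \<Prod>l\<in>Z. (z - l) ^ nat (zorder F l))"
  define n where "n = (\<Sum>l\<in>Z. nat (zorder F l))"
  have FgP: "F z = g z * P z" if "z \<in> ball c (5 * R)" for z
    using h(3)[OF that] prod.subset_diff[OF sub h(4), of "\<lambda>l. (z - l) ^ nat (zorder F l)"]
    unfolding g_def P_def by (simp add: mult.assoc)
  have holg: "g holomorphic_on ball c (5 * R)"
    unfolding g_def by (intro holomorphic_intros h)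
  have g0: "g z \<noteq> 0" if "z \<in> cball c R" for z
  proof -
    have "z \<in> ball c (5 * R)" using that R by auto
    then have "h z \<noteq> 0" using h(2) by blast
    moreover have "z \<notin> Z5 - Z" using that unfolding Z5_def Z_def by auto
    ultimately show ?thesis unfolding g_def using h(4) by auto
  qed
  have cin: "c \<in> ball c (5 * R)" using R by simp
  have Pc: "P c \<noteq> 0" using FgP[OF cin] c by auto
  have gc: "g c \<noteq> 0" using FgP[OF cin] c by auto
  have Pge: "3 ^ n * norm (P c) \<le> norm (P z)" if z: "norm (z - c) = 4 * R" for z
  proof -
    have "3 ^ n * norm (P c) = (\<Prod>l\<in>Z. (3 * norm (c - l)) ^ nat (zorder F l))"
      unfolding n_def P_def
      by (simp add: power_sum prod_norm[symmetric] norm_power power_mult_distrib prod.distrib)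
    also have "\<dots> \<le> (\<Prod>l\<in>Z. norm (z - l) ^ nat (zorder F l))"
    proof (intro prod_mono conjI power_mono)
      fix l assume "l \<in> Z"
      then have l: "norm (c - l) \<le> R" unfolding Z_def by (simp add: dist_norm)
      have "norm (z - c) \<le> norm (z - l) + norm (c - l)"
        using norm_triangle_ineq4[of "z - l" "c - l"] by simp
      then show "3 * norm (c - l) \<le> norm (z - l)" using l z by simp
    qed auto
    also have "\<dots> = norm (P z)" unfolding P_def by (simp add: prod_norm[symmetric] norm_power)
    finally show ?thesis .
  qed
  define B where "B = M * norm (g c) / 3 ^ n"
  have sph: "norm (g z) \<le> B" if z: "norm (z - c) = 4 * R" for z
  proof -
    have zin: "z \<in> ball c (5 * R)" "z \<in> cball c (4 * R)"
      using z R by (auto simp: dist_norm norm_minus_commute)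
    have "norm (g z) * (3 ^ n * norm (P c)) \<le> norm (g z) * norm (P z)"
      by (intro mult_left_mono Pge z) auto
    also have "\<dots> = norm (F z)" using FgP[OF zin(1)] by (simp add: norm_mult)
    also have "\<dots> \<le> M * (norm (g c) * norm (P c))"
      using bnd[OF zin(2)] FgP[OF cin] by (simp add: norm_mult)
    finally have "(norm (g z) * 3 ^ n) * norm (P c) \<le> (M * norm (g c)) * norm (P c)"
      by (simp add: mult_ac)
    then have "norm (g z) * 3 ^ n \<le> M * norm (g c)" using Pc by simp
    then show ?thesis unfolding B_def by (simp add: pos_le_divide_eq)
  qed
  have mx: "norm (g z) \<le> B" if "z \<in> cball c (4 * R)" for z
  proof (rule maximum_modulus_frontier[of g "cball c (4 * R)"])
    show "g holomorphic_on interior (cball c (4 * R))"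
      using holg R by (auto intro: holomorphic_on_subset)
    show "continuous_on (closure (cball c (4 * R))) g"
      using holg R by (auto intro!: continuous_on_subset[OF holomorphic_on_imp_continuous_on[OF holg]])
    show "norm (g z) \<le> B" if "z \<in> frontier (cball c (4 * R))" for z
      using that R by (intro sph) (auto simp: dist_norm norm_minus_commute)
  qed (use that in auto)
  have "norm (g c) \<le> B" using mx[of c] R by simp
  \<comment> \<open>Reading the bound at the centre itself gives the Jensen-type count
    \<open>3 ^ n \<le> M\<close>.\<close>
  then have "1 * norm (g c) \<le> (M / 3 ^ n) * norm (g c)" unfolding B_def by simp
  then have "1 \<le> M / 3 ^ n" using gc by (simp only: mult_le_cancel_right) simp
  then have M3: "3 ^ n \<le> M" by (simp add: pos_le_divide_eq)
  have Mnn: "0 \<le> M" using M3 by (smt (verit) zero_le_power)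
  have "B \<le> M * norm (g c) / 1"
    unfolding B_def using Mnn by (intro divide_left_mono) (auto)
  then have le: "norm (g z) \<le> M * norm (g c)" if "z \<in> cball c R" for z
    using mx[of z] that R by (auto intro: order_trans)
  show ?thesis
    by (rule that[OF holg g0 FgP[unfolded P_def] le fin M3[unfolded n_def]])
qed

text \<open>\<open>D\<close> is the logarithmic derivative of the zero-free factor \<open>g\<close>,
  that is, the derivative of L = log (g / g c). The bound on \<open>g\<close> bounds Re L;
  Borel-Caratheodory bounds L on the half disc, Cauchy's estimate bounds its second derivative on
  the quarter disc, and the mean value inequality finishes.\<close>

lemma log_deriv_minus_zeros_lipschitz:
  fixes F :: "complex \<Rightarrow> complex" and R M :: real
  assumes hol: "F holomorphic_on UNIV" and c: "F c \<noteq> 0" and R: "R > 0"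
    and bnd: "\<And>z. z \<in> cball c (4 * R) \<Longrightarrow> norm (F z) \<le> M * norm (F c)"
  defines "D \<equiv> \<lambda>z. deriv F z / F z - (\<Sum>l\<in>{l \<in> cball c R. F l = 0}. of_nat (nat (zorder F l)) / (z - l))"
  assumes s: "s \<in> cball c (R / 4)" "F s \<noteq> 0" and p: "p \<in> cball c (R / 4)" "F p \<noteq> 0"
  shows "norm (D s - D p) \<le> 96 * (ln M + 1) / R\<^sup>2 * norm (s - p)"
proof -
  define Z where "Z = {l \<in> cball c R. F l = 0}"
  obtain g where holg: "g holomorphic_on ball c (5 * R)" and g0: "\<And>z. z \<in> cball c R \<Longrightarrow> g z \<noteq> 0"
    and FgP: "\<And>z. z \<in> ball c (5 * R) \<Longrightarrow> F z = g z * (\<Prod>l\<in>Z. (z - l) ^ nat (zorder F l))"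
    and gle: "\<And>z. z \<in> cball c R \<Longrightarrow> norm (g z) \<le> M * norm (g c)"
    and fin: "finite Z" and M3: "3 ^ (\<Sum>l\<in>Z. nat (zorder F l)) \<le> M"
    by (rule factor_zeros_disc[OF hol c R bnd, folded Z_def], assumption, rule that)
  have M1: "1 \<le> M" using M3 by (smt (verit) one_le_power)
  \<comment> \<open>The added 1 makes the bound on Re L strict and keeps \<open>K\<close> positive
    when M = 1.\<close>
  define K where "K = ln M + 1"
  have K: "K > 0" unfolding K_def using M1 by (simp add: add_nonneg_pos)
  have gc: "g c \<noteq> 0" using g0[of c] R by simp
  obtain H where holH: "H holomorphic_on ball c R" and expH: "\<And>z. z \<in> ball c R \<Longrightarrow> exp (H z) = g z / g c"
  proof (rule holomorphic_logarithm_exists[of "ball c R" "\<lambda>z. g z / g c" c])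
    show "(\<lambda>z. g z / g c) holomorphic_on ball c R"
      using gc R by (intro holomorphic_intros holomorphic_on_subset[OF holg]) auto
    show "g z / g c \<noteq> 0" if "z \<in> ball c R" for z
      using g0[of z] gc that by auto
  qed (use R in auto)
  define L where "L = (\<lambda>z. H z - H c)"
  have holL: "L holomorphic_on ball c R" unfolding L_def by (intro holomorphic_intros holH)
  have expL: "exp (L z) = g z / g c" if "z \<in> ball c R" for z
    unfolding L_def using expH[OF that] expH[of c] gc R by (simp add: exp_diff)
  have ReL: "Re (L z) < K" if z: "z \<in> ball c R" for z
  proof -
    have "exp (Re (L z)) = norm (g z) / norm (g c)"
      using arg_cong[OF expL[OF z], of norm] by (simp add: norm_divide)
    also have "\<dots> \<le> M" using gle[of z] z gc by (simp add: pos_divide_le_eq)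
    also have "\<dots> < exp K" unfolding K_def exp_add using M1 by simp
    finally show ?thesis by simp
  qed
  have Lb: "norm (L z) \<le> 2 * K" if "norm (z - c) \<le> R / 2" for z
    by (rule borel_caratheodory_half[OF holL R _ ReL that]) (simp add: L_def)
  have L2: "norm (deriv (deriv L) w) \<le> 96 * K / R\<^sup>2" if w: "w \<in> cball c (R / 4)" for w
  proof -
    have nw: "norm (w - c) \<le> R / 4" using w by (simp add: dist_norm norm_minus_commute)
    have in2: "norm (x - c) \<le> R / 2" if "x \<in> cball w (R / 4)" for x
    proof -
      have "norm (x - w) \<le> R / 4" using that by (simp add: dist_norm norm_minus_commute)
      then show ?thesis using nw norm_triangle_ineq[of "x - w" "w - c"] by simp
    qed
    have sub: "cball w (R / 4) \<subseteq> ball c R"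
    proof
      fix x assume "x \<in> cball w (R / 4)"
      from in2[OF this] show "x \<in> ball c R" using R by (simp add: dist_norm norm_minus_commute)
    qed
    \<comment> \<open>\<open>3 * K\<close> instead of the available \<open>2 * K\<close> because the
      values must lie in an open ball. The result 2 * 3K / (R/4)^2 is the 96 of the
      statement.\<close>
    have "norm ((deriv ^^ 2) L w) \<le> fact 2 * (3 * K) / (R / 4) ^ 2"
    proof (rule Cauchy_higher_deriv_bound)
      show "L holomorphic_on ball w (R / 4)"
        using holL sub ball_subset_cball by (meson holomorphic_on_subset)
      show "continuous_on (cball w (R / 4)) L"
        using holomorphic_on_imp_continuous_on[OF holL] sub continuous_on_subset by blast
      show "L x \<in> ball 0 (3 * K)" if "x \<in> ball w (R / 4)" for x
      proof -
        have "x \<in> cball w (R / 4)" using that by simp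
        from Lb[OF in2[OF this]] show ?thesis using K by simp
      qed
    qed (use R in auto)
    then show ?thesis by (simp add: numeral_2_eq_2 power_divide field_simps)
  qed
  have lip: "norm (deriv L s - deriv L p) \<le> 96 * K / R\<^sup>2 * norm (s - p)"
  proof (rule field_differentiable_bound[of "cball c (R / 4)" "deriv L" "deriv (deriv L)"])
    fix z assume "z \<in> cball c (R / 4)"
    then have "z \<in> ball c R" using R by auto
    then have "(deriv L has_field_derivative deriv (deriv L) z) (at z)"
      using holomorphic_derivI[OF holomorphic_deriv[OF holL open_ball] open_ball] by blast
    then show "(deriv L has_field_derivative deriv (deriv L) z) (at z within cball c (R / 4))"
      by (rule DERIV_subset) auto
  qed (use L2 s p in auto)
  have DL: "D z = deriv L z" if z: "z \<in> cball c (R / 4)" "F z \<noteq> 0" for z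
  proof -
    have zb: "z \<in> ball c R" "z \<in> ball c (5 * R)" "z \<in> cball c R" using z R by auto
    define P where "P = (\<lambda>z. \<Prod>l\<in>Z. (z - l) ^ nat (zorder F l))"
    define S where "S = (\<Sum>l\<in>Z. of_nat (nat (zorder F l)) / (z - l))"
    have zZ: "z \<notin> Z" using z unfolding Z_def by auto
    have dg: "(g has_field_derivative deriv g z) (at z)"
      using holomorphic_derivI[OF holg open_ball zb(2)] .
    have dL: "(L has_field_derivative deriv L z) (at z)"
      using holomorphic_derivI[OF holL open_ball zb(1)] .
    have dP: "(P has_field_derivative P z * S) (at z)"
      unfolding P_def S_def by (rule has_field_derivative_prod_linear_powers[OF fin zZ])
    have "((\<lambda>z. g z * P z) has_field_derivative (deriv g z * P z + P z * S * g z)) (at z)"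
      using DERIV_mult[OF dg dP] .
    then have "(F has_field_derivative (deriv g z * P z + P z * S * g z)) (at z)"
      by (rule has_field_derivative_transform_within_open[OF _ open_ball zb(2)])
         (simp add: FgP P_def)
    then have dF: "deriv F z = deriv g z * P z + P z * S * g z" by (rule DERIV_imp_deriv)
    have "((\<lambda>z. exp (L z)) has_field_derivative exp (L z) * deriv L z) (at z)"
      by (rule derivative_eq_intros dL refl)+
    then have "((\<lambda>z. g z / g c) has_field_derivative exp (L z) * deriv L z) (at z)"
      by (rule has_field_derivative_transform_within_open[OF _ open_ball zb(1)])
         (simp add: expL)
    moreover have "((\<lambda>z. g z / g c) has_field_derivative deriv g z / g c) (at z)"
      by (rule DERIV_cdivide[OF dg])
    ultimately have "deriv g z / g c = g z / g c * deriv L z"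
      using DERIV_unique expL[OF zb(1)] by metis
    then have gL: "deriv g z = g z * deriv L z" using gc by simp
    have Fz: "F z = g z * P z" using FgP[OF zb(2)] unfolding P_def .
    then have "P z \<noteq> 0" "g z \<noteq> 0" using z by auto
    then have "deriv F z / F z = deriv L z + S"
      unfolding dF Fz gL by (simp add: field_simps)
    then show ?thesis unfolding D_def Z_def[symmetric] S_def by simp
  qed
  show ?thesis using lip unfolding DL[OF s] DL[OF p] K_def by simp
qed

section \<open>Zeros and partial fractions of functions of bounded order\<close>

text \<open>Any exponent strictly between \<open>1\<close> and \<open>2\<close> would serve.\<close>
definition order_three_halves :: "(complex \<Rightarrow> complex) \<Rightarrow> bool" where
  "order_three_halves F \<longleftrightarrow> (\<exists>A. \<forall>z. norm (F z) \<le> exp (A * (1 + norm z) powr (3/2)))"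

text \<open>Brings the growth condition into the shape of the disc lemmas, relative to
  \<open>norm (F c)\<close>. Since \<open>R \<ge> 1\<close>, the shift of the centre and the
  logarithm of \<open>norm (F c)\<close> are absorbed into \<open>B\<close>.\<close>

lemma order_three_halves_disc:
  assumes "order_three_halves F" and c: "F c \<noteq> 0"
  obtains B where "B > 0"
    "\<And>R z. R \<ge> 1 \<Longrightarrow> z \<in> cball c (4 * R) \<Longrightarrow> norm (F z) \<le> exp (B * R powr (3/2)) * norm (F c)"
proof -
  obtain A where A: "\<And>z. norm (F z) \<le> exp (A * (1 + norm z) powr (3/2))"
    using assms unfolding order_three_halves_def by auto
  define B where "B = \<bar>A\<bar> * (5 + norm c) powr (3/2) + \<bar>ln (norm (F c))\<bar> + 1"
  have "norm (F z) \<le> exp (B * R powr (3/2)) * norm (F c)" if R: "R \<ge> 1" and z: "z \<in> cball c (4 * R)" for R z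
  proof -
    have "norm (z - c) \<le> 4 * R" using z by (simp add: dist_norm norm_minus_commute)
    moreover have "norm z \<le> norm (z - c) + norm c" using norm_triangle_ineq[of "z - c" c] by simp
    moreover have "1 + norm c \<le> (1 + norm c) * R" using mult_left_mono[of 1 R "1 + norm c"] R by simp
    ultimately have "1 + norm z \<le> (5 + norm c) * R" using R by (simp add: algebra_simps)
    then have "(1 + norm z) powr (3/2) \<le> ((5 + norm c) * R) powr (3/2)" by (intro powr_mono2) auto
    also have "\<dots> = (5 + norm c) powr (3/2) * R powr (3/2)" using R by (simp add: powr_mult)
    finally have "A * (1 + norm z) powr (3/2) \<le> \<bar>A\<bar> * ((5 + norm c) powr (3/2) * R powr (3/2))"
      by (intro mult_mono) auto
    moreover have "1 \<le> R powr (3/2)" using R by (intro ge_one_powr_ge_zero) auto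
    then have "\<bar>ln (norm (F c))\<bar> * 1 \<le> \<bar>ln (norm (F c))\<bar> * R powr (3/2)" by (intro mult_left_mono) auto
    ultimately have "A * (1 + norm z) powr (3/2) \<le> B * R powr (3/2) + ln (norm (F c))"
      unfolding B_def using \<open>1 \<le> R powr (3/2)\<close> by (simp add: algebra_simps abs_le_iff)
    then have "exp (A * (1 + norm z) powr (3/2)) \<le> exp (B * R powr (3/2) + ln (norm (F c)))"
      by simp
    also have "\<dots> = exp (B * R powr (3/2)) * norm (F c)" using c by (simp add: exp_add)
    finally show ?thesis using A[of z] by linarith
  qed
  moreover have "B > 0" unfolding B_def by (simp add: add_nonneg_pos)
  ultimately show ?thesis by (intro that[of B])
qed

lemma entire_zorder_nonneg:
  assumes "F holomorphic_on UNIV" "F c \<noteq> 0"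
  shows "zorder F l \<ge> 0"
  by (rule zorder_ge_0[OF entire_frequently_nonzero[OF assms]])

text \<open>Logarithm of the count \<open>3 ^ n \<le> M\<close>; since e < 3, the constant
  \<open>B\<close> survives unchanged.\<close>

lemma zero_count_order_three_halves:
  assumes hol: "F holomorphic_on UNIV" and ord: "order_three_halves F" and c: "F c \<noteq> 0"
  obtains B where "B > 0"
    "\<And>R. R \<ge> 1 \<Longrightarrow> (\<Sum>l\<in>{l \<in> cball c R. F l = 0}. real (nat (zorder F l))) \<le> B * R powr (3/2)"
proof -
  obtain B where B: "B > 0"
    "\<And>R z. R \<ge> 1 \<Longrightarrow> z \<in> cball c (4 * R) \<Longrightarrow> norm (F z) \<le> exp (B * R powr (3/2)) * norm (F c)"
    using order_three_halves_disc[OF ord c] by metis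
  show ?thesis
  proof (rule that[OF B(1)])
    fix R :: real assume R: "R \<ge> 1"
    then have R0: "R > 0" by simp
    define n where "n = (\<Sum>l\<in>{l \<in> cball c R. F l = 0}. nat (zorder F l))"
    have "3 ^ n \<le> exp (B * R powr (3/2))"
      unfolding n_def
      by (rule factor_zeros_disc[OF hol c R0, of "exp (B * R powr (3/2))"]) (use B(2)[OF R] in auto)
    moreover have "exp (real n) \<le> 3 ^ n"
      using power_mono[OF exp_le, of n] by (simp add: exp_of_nat_mult[symmetric])
    ultimately have "exp (real n) \<le> exp (B * R powr (3/2))" by linarith
    then show "(\<Sum>l\<in>{l \<in> cball c R. F l = 0}. real (nat (zorder F l))) \<le> B * R powr (3/2)"
      unfolding n_def by simp
  qed
qed

lemma zeros_inverse_square_summable: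
  assumes hol: "F holomorphic_on UNIV" and ord: "order_three_halves F" and c: "F c \<noteq> 0"
  shows "(\<lambda>l. real (nat (zorder F l)) / (1 + norm (l - c))\<^sup>2) summable_on {l. F l = 0}"
proof -
  obtain B where B: "B > 0"
    "\<And>R. R \<ge> 1 \<Longrightarrow> (\<Sum>l\<in>{l \<in> cball c R. F l = 0}. real (nat (zorder F l))) \<le> B * R powr (3/2)"
    using zero_count_order_three_halves[OF hol ord c] by metis
  \<comment> \<open>Zeros are grouped into dyadic shells. Shell i has at most B * 2 powr (3i/2) of
    them, with multiplicity, each weighted by at most 4 / 4^i; the ratio 2 powr (3/2) / 4 is
    \<open>q\<close>.\<close>
  define q where "q = (2::real) powr (-1/2)"
  have q: "0 < q" "q < 1" unfolding q_def by (auto simp: powr_less_one)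
  define m where "m = (\<lambda>l. real (nat (zorder F l)))"
  \<comment> \<open>The shell index: \<open>2 ^ k l\<close> agrees with 1 + norm (l - c) up to a
    factor of two.\<close>
  define k where "k = (\<lambda>l. nat \<lceil>log 2 (1 + norm (l - c))\<rceil>)"
  have k1: "1 + norm (l - c) \<le> 2 ^ k l" for l
  proof -
    have "log 2 (1 + norm (l - c)) \<le> real (k l)" unfolding k_def by linarith
    then have "2 powr log 2 (1 + norm (l - c)) \<le> 2 powr real (k l)" by (intro powr_mono) auto
    then show ?thesis by (simp add: powr_realpow add_pos_nonneg)
  qed
  have k2: "2 ^ k l \<le> 2 * (1 + norm (l - c))" for l
  proof -
    have "0 \<le> log 2 (1 + norm (l - c))" by (simp add: add_pos_nonneg)
    then have "real (k l) \<le> 1 + log 2 (1 + norm (l - c))" unfolding k_def by linarith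
    then have "2 powr real (k l) \<le> 2 powr (1 + log 2 (1 + norm (l - c)))" by (intro powr_mono) auto
    then show ?thesis by (simp add: powr_realpow powr_add add_pos_nonneg)
  qed
  have sumle: "(\<Sum>l\<in>X. m l / (1 + norm (l - c))\<^sup>2) \<le> 4 * B * (1 / (1 - q))"
    if X: "finite X" "X \<subseteq> {l. F l = 0}" for X
  proof -
    have "(\<Sum>l\<in>X. m l / (1 + norm (l - c))\<^sup>2) \<le> (\<Sum>l\<in>X. 4 * m l / 4 ^ k l)"
    proof (rule sum_mono)
      fix l
      have "(2 ^ k l)\<^sup>2 \<le> (2 * (1 + norm (l - c)))\<^sup>2" by (intro power_mono k2) auto
      also have "(2 ^ k l)\<^sup>2 = (4::real) ^ k l"
        by (simp add: power_mult[symmetric] mult.commute[of _ 2]) (simp add: power_mult)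
      finally have *: "4 ^ k l \<le> 4 * (1 + norm (l - c))\<^sup>2" unfolding power_mult_distrib by simp
      have pos: "0 < (1 + norm (l - c))\<^sup>2" by (intro zero_less_power add_pos_nonneg) auto
      have "m l / (1 + norm (l - c))\<^sup>2 = 4 * m l / (4 * (1 + norm (l - c))\<^sup>2)" by simp
      also have "\<dots> \<le> 4 * m l / 4 ^ k l"
        using * pos by (intro divide_left_mono) (auto simp: m_def)
      finally show "m l / (1 + norm (l - c))\<^sup>2 \<le> 4 * m l / 4 ^ k l" .
    qed
    also have "\<dots> = (\<Sum>i\<in>k ` X. \<Sum>l\<in>{l \<in> X. k l = i}. 4 * m l / 4 ^ k l)"
      by (rule sum.image_gen[OF X(1)])
    also have "\<dots> \<le> (\<Sum>i\<in>k ` X. 4 * B * q ^ i)"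
    proof (rule sum_mono)
      fix i
      have fin: "finite {l \<in> cball c (2 ^ i). F l = 0}"
      proof (rule holomorphic_factor_zeros_ball[OF hol c, of "2 ^ i + 1"])
        assume "finite {l \<in> ball c (2 ^ i + 1). F l = 0}"
        then show ?thesis by (rule rev_finite_subset) auto
      qed
      have "(\<Sum>l\<in>{l \<in> X. k l = i}. m l) \<le> (\<Sum>l\<in>{l \<in> cball c (2 ^ i). F l = 0}. m l)"
      proof (rule sum_mono2[OF fin])
        show "{l \<in> X. k l = i} \<subseteq> {l \<in> cball c (2 ^ i). F l = 0}"
        proof
          fix l assume "l \<in> {l \<in> X. k l = i}"
          then have l: "k l = i" "F l = 0" using X by auto
          then show "l \<in> {l \<in> cball c (2 ^ i). F l = 0}"
            using k1[of l] by (simp add: dist_norm norm_minus_commute)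
        qed
      qed (auto simp: m_def)
      also have "\<dots> \<le> B * (2 ^ i) powr (3/2)" unfolding m_def by (rule B(2)) simp
      finally have le: "(\<Sum>l\<in>{l \<in> X. k l = i}. m l) \<le> B * (2 ^ i) powr (3/2)" .
      have "(2 ^ i) powr (3/2) = (2::real) powr (real i * (3/2))"
        by (simp add: powr_realpow[symmetric] powr_powr)
      also have "\<dots> = (2 powr (-1/2)) powr real i * 2 powr (2 * real i)"
        by (simp add: powr_powr flip: powr_add) (simp add: mult.commute)
      also have "2 powr (2 * real i) = ((2::real) powr 2) powr real i" by (simp only: powr_powr)
      also have "(2 powr (-1/2)) powr real i * (2 powr 2) powr real i = q ^ i * 4 ^ i"
        unfolding q_def[symmetric] using q by (simp add: powr_realpow)
      finally have e: "(2 ^ i) powr (3/2) = q ^ i * (4::real) ^ i" .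
      have "(\<Sum>l\<in>{l \<in> X. k l = i}. 4 * m l / 4 ^ k l) = 4 / 4 ^ i * (\<Sum>l\<in>{l \<in> X. k l = i}. m l)"
        by (simp add: sum_distrib_left)
      also have "\<dots> \<le> 4 / 4 ^ i * (B * (2 ^ i) powr (3/2))" by (intro mult_left_mono le) auto
      also have "\<dots> = 4 * B * q ^ i" unfolding e by simp
      finally show "(\<Sum>l\<in>{l \<in> X. k l = i}. 4 * m l / 4 ^ k l) \<le> 4 * B * q ^ i" .
    qed
    also have "\<dots> = 4 * B * (\<Sum>i\<in>k ` X. q ^ i)" by (simp add: sum_distrib_left)
    also have "\<dots> \<le> 4 * B * (1 / (1 - q))"
    proof (intro mult_left_mono)
      have "(\<Sum>i\<in>k ` X. q ^ i) \<le> (\<Sum>i. q ^ i)"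
        using q X by (intro sum_le_suminf summable_geometric) auto
      then show "(\<Sum>i\<in>k ` X. q ^ i) \<le> 1 / (1 - q)" using q by (simp add: suminf_geometric)
    qed (use B in auto)
    finally show ?thesis .
  qed
  have "(\<lambda>l. m l / (1 + norm (l - c))\<^sup>2) summable_on {l. F l = 0}"
  proof (rule nonneg_bdd_above_summable_on)
    show "bdd_above (sum (\<lambda>l. m l / (1 + norm (l - c))\<^sup>2) ` {X. X \<subseteq> {l. F l = 0} \<and> finite X})"
      by (rule bdd_aboveI[where M = "4 * B * (1 / (1 - q))"]) (use sumle in auto)
  qed (simp add: m_def)
  then show ?thesis unfolding m_def .
qed

text \<open>Zeros near the compact set are controlled by the positive distance, remote ones by the
  triangle inequality. The result converts the summability of inverse squares around
  \<open>c\<close> into a majorant that is uniform on \<open>K\<close>.\<close>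

lemma compact_closed_separation:
  fixes K Z :: "complex set"
  assumes "compact K" "closed Z" "K \<inter> Z = {}"
  obtains C where "C > 0" "\<And>s l. s \<in> K \<Longrightarrow> l \<in> Z \<Longrightarrow> 1 + norm (l - c) \<le> C * norm (s - l)"
proof -
  obtain d where d: "d > 0" "\<And>s l. s \<in> K \<Longrightarrow> l \<in> Z \<Longrightarrow> d \<le> dist s l"
    using separate_compact_closed[OF assms] by metis
  have "bounded K" using assms compact_imp_bounded by blast
  then obtain b where b: "b > 0" "\<And>s. s \<in> K \<Longrightarrow> norm s \<le> b" unfolding bounded_pos by blast
  define e where "e = 1 + b + norm c"
  have e: "e > 0" unfolding e_def using b(1) by (simp add: add_pos_nonneg)
  have "1 + norm (l - c) \<le> (1 + e / d) * norm (s - l)" if s: "s \<in> K" and l: "l \<in> Z" for s l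
  proof -
    have "norm (l - c) \<le> norm (s - l) + norm s + norm c"
      using norm_triangle_ineq4[of "s - c" "s - l"] norm_triangle_ineq4[of s c]
      by (simp add: algebra_simps)
    then have "1 + norm (l - c) \<le> norm (s - l) + e" using b(2)[OF s] unfolding e_def by simp
    moreover have "e * 1 \<le> e * (norm (s - l) / d)"
      using d(1) d(2)[OF s l] e by (intro mult_left_mono) (auto simp: dist_norm)
    ultimately show ?thesis by (simp add: algebra_simps)
  qed
  moreover have "1 + e / d > 0" using e d by (simp add: add_pos_pos)
  ultimately show ?thesis by (intro that[of "1 + e / d"])
qed

lemma norm_partial_fraction_le:
  fixes s p l c :: complex
  assumes "1 + norm (l - c) \<le> C * norm (s - l)" "1 + norm (l - c) \<le> C * norm (p - l)"
  shows "norm ((p - s) / ((s - l) * (p - l))) \<le> norm (p - s) * C\<^sup>2 / (1 + norm (l - c))\<^sup>2"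
proof -
  have n: "0 < 1 + norm (l - c)" by (simp add: add_pos_nonneg)
  have ne: "norm (s - l) > 0" "norm (p - l) > 0"
    using n assms by (metis less_le_trans mult_zero_right norm_ge_zero order_le_less not_less)+
  have "(1 + norm (l - c))\<^sup>2 \<le> (C * norm (s - l)) * (C * norm (p - l))"
    unfolding power2_eq_square using assms n by (intro mult_mono) auto
  moreover have "1 / (x * y) \<le> C\<^sup>2 / k" if "k \<le> (C * x) * (C * y)" "k > 0" "x > 0" "y > 0" for k x y
    using that by (simp add: field_simps power2_eq_square)
  ultimately have "1 / (norm (s - l) * norm (p - l)) \<le> C\<^sup>2 / (1 + norm (l - c))\<^sup>2"
    using n ne by (metis zero_less_power)
  then have "norm (p - s) * (1 / (norm (s - l) * norm (p - l))) \<le> norm (p - s) * (C\<^sup>2 / (1 + norm (l - c))\<^sup>2)"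
    by (intro mult_left_mono) auto
  then show ?thesis by (simp add: norm_mult norm_divide)
qed

text \<open>The sum converges absolutely, so its value may be computed along any exhaustion. Along
  discs around \<open>s\<close> the partial sums differ from the claimed value by
  \<open>D n s - D n p\<close>, which tends to 0 by the Lipschitz estimate.\<close>

theorem log_deriv_partial_fractions:
  assumes hol: "F holomorphic_on UNIV" and ord: "order_three_halves F" and s: "F s \<noteq> 0" and p: "F p \<noteq> 0"
  shows "((\<lambda>l. of_int (zorder F l) * ((p - s) / ((s - l) * (p - l)))) has_sum
           (deriv F s / F s - deriv F p / F p)) {l. F l = 0}"
proof -
  define Z where "Z = {l. F l = 0}"
  define m where "m = (\<lambda>l. nat (zorder F l))"
  have m: "of_int (zorder F l) = (of_nat (m l) :: complex)" for l
    unfolding m_def using entire_zorder_nonneg[OF hol s, of l] by (metis of_int_of_nat_eq nat_0_le)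
  define t where "t = (\<lambda>l. of_int (zorder F l) * ((p - s) / ((s - l) * (p - l))))"
  have clZ: "closed Z" unfolding Z_def
    using continuous_closed_preimage_constant[OF holomorphic_on_imp_continuous_on[OF hol] closed_UNIV, of 0]
    by simp
  obtain C where C: "C > 0" "\<And>u l. u \<in> {s, p} \<Longrightarrow> l \<in> Z \<Longrightarrow> 1 + norm (l - s) \<le> C * norm (u - l)"
    using compact_closed_separation[of "{s, p}" Z s] clZ s p unfolding Z_def by auto
  have tb: "norm (t l) \<le> norm (p - s) * C\<^sup>2 * (real (m l) / (1 + norm (l - s))\<^sup>2)" if l: "l \<in> Z" for l
  proof -
    have "real (m l) * norm ((p - s) / ((s - l) * (p - l))) \<le> real (m l) * (norm (p - s) * C\<^sup>2 / (1 + norm (l - s))\<^sup>2)"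
      using C l by (intro mult_left_mono norm_partial_fraction_le) auto
    then show ?thesis unfolding t_def m norm_mult[of "of_nat (m l)"] norm_of_nat by (simp add: mult_ac)
  qed
  have "(\<lambda>l. norm (p - s) * C\<^sup>2 * (real (m l) / (1 + norm (l - s))\<^sup>2)) summable_on Z"
    using zeros_inverse_square_summable[OF hol ord s] unfolding m_def Z_def
    by (intro summable_on_cmult_right)
  from this have "(\<lambda>l. norm (t l)) summable_on Z"
    by (rule summable_on_comparison_test) (use tb in auto)
  then have "t summable_on Z"
    by (metis abs_summable_summable)
  then obtain T where T: "(t has_sum T) Z" by (auto simp: summable_on_def)
  define W where "W = (\<lambda>n::nat. {l \<in> cball s (real n). F l = 0})"
  have finW: "finite (W n)" for n
  proof (rule holomorphic_factor_zeros_ball[OF hol s, of "real n + 1"])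
    assume "finite {l \<in> ball s (real n + 1). F l = 0}"
    then show ?thesis unfolding W_def by (rule rev_finite_subset) auto
  qed
  \<comment> \<open>Every finite set of zeros lies in some disc, so the discs are cofinal among the
    finite subsets.\<close>
  have "filterlim W (finite_subsets_at_top Z) sequentially"
    unfolding filterlim_finite_subsets_at_top
  proof (intro allI impI)
    fix X assume X: "finite X \<and> X \<subseteq> Z"
    define N where "N = nat \<lceil>Max (insert 0 ((\<lambda>l. dist s l) ` X))\<rceil>"
    have N: "dist s l \<le> real N" if "l \<in> X" for l
    proof -
      have "dist s l \<le> Max (insert 0 ((\<lambda>l. dist s l) ` X))" using that X by (intro Max_ge) auto
      then show ?thesis unfolding N_def by linarith
    qed
    show "\<forall>\<^sub>F n in sequentially. finite (W n) \<and> X \<subseteq> W n \<and> W n \<subseteq> Z"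
      using eventually_ge_at_top[of N]
    proof eventually_elim
      case (elim n)
      then show ?case using finW X N unfolding W_def Z_def by (fastforce intro: order_trans)
    qed
  qed
  then have lim1: "(\<lambda>n. sum t (W n)) \<longlonglongrightarrow> T"
    using T unfolding has_sum_def by (metis filterlim_compose)
  define D where "D = (\<lambda>n z. deriv F z / F z - (\<Sum>l\<in>W n. of_nat (m l) / (z - l)))"
  obtain B where B: "B > 0"
    "\<And>R z. R \<ge> 1 \<Longrightarrow> z \<in> cball s (4 * R) \<Longrightarrow> norm (F z) \<le> exp (B * R powr (3/2)) * norm (F s)"
    using order_three_halves_disc[OF ord s] by metis
  have "(\<lambda>n. D n s - D n p) \<longlonglongrightarrow> 0"
  proof (rule Lim_null_comparison)
    \<comment> \<open>The Lipschitz bound with R = n and M = exp (B * n powr (3/2)). It vanishes in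
      the limit because 3/2 < 2.\<close>
    show "\<forall>\<^sub>F n in sequentially. norm (D n s - D n p) \<le> 96 * (B * real n powr (3/2) + 1) / (real n)\<^sup>2 * norm (s - p)"
      \<comment> \<open>Four times the distance places \<open>p\<close> in the inner quarter of the
        disc; the added 1 ensures a radius of at least one.\<close>
      using eventually_ge_at_top[of "nat \<lceil>4 * norm (s - p)\<rceil> + 1"]
    proof eventually_elim
      case (elim n)
      then have n: "real n \<ge> 1" "norm (s - p) \<le> real n / 4" by linarith+
      show ?case unfolding D_def W_def m_def
        using log_deriv_minus_zeros_lipschitz[OF hol s, of "real n" "exp (B * real n powr (3/2))" s p]
          B(2)[OF n(1)] n s p by (simp add: dist_norm)
    qed
    show "(\<lambda>n. 96 * (B * real n powr (3/2) + 1) / (real n)\<^sup>2 * norm (s - p)) \<longlonglongrightarrow> 0"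
      by real_asymp
  qed
  moreover have "D n s - D n p = (deriv F s / F s - deriv F p / F p) - sum t (W n)" for n
  proof -
    have "t l = of_nat (m l) / (s - l) - of_nat (m l) / (p - l)" if "l \<in> W n" for l
    proof -
      have "s \<noteq> l" "p \<noteq> l" using that s p unfolding W_def by auto
      then show ?thesis unfolding t_def m by (simp add: divide_simps) (simp add: algebra_simps)
    qed
    then have "sum t (W n) = (\<Sum>l\<in>W n. of_nat (m l) / (s - l)) - (\<Sum>l\<in>W n. of_nat (m l) / (p - l))"
      by (simp add: sum_subtractf)
    then show ?thesis unfolding D_def by simp
  qed
  ultimately have "(\<lambda>n. (deriv F s / F s - deriv F p / F p) - sum t (W n)) \<longlonglongrightarrow> 0" by simp
  then have "(\<lambda>n. (deriv F s / F s - deriv F p / F p) - ((deriv F s / F s - deriv F p / F p) - sum t (W n)))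
      \<longlonglongrightarrow> (deriv F s / F s - deriv F p / F p) - 0"
    by (intro tendsto_intros)
  then have "(\<lambda>n. sum t (W n)) \<longlonglongrightarrow> deriv F s / F s - deriv F p / F p" by simp
  then have "T = deriv F s / F s - deriv F p / F p" using lim1 LIMSEQ_unique by blast
  then show ?thesis using T unfolding t_def Z_def by simp
qed

section \<open>Zeros on the negative real axis and the logarithm\<close>

lemma Ln_lipschitz:
  assumes "convex S" "x \<in> S" "y \<in> S" "d > 0" and "\<And>w. w \<in> S \<Longrightarrow> w \<notin> \<real>\<^sub>\<le>\<^sub>0 \<and> d \<le> norm w"
  shows "norm (Ln x - Ln y) \<le> norm (x - y) / d"
proof -
  have "norm (Ln x - Ln y) \<le> 1 / d * norm (x - y)"
  proof (rule field_differentiable_bound[of S Ln inverse])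
    fix w assume w: "w \<in> S"
    show "(Ln has_field_derivative inverse w) (at w within S)"
      using has_field_derivative_Ln[of w] assms(5)[OF w] DERIV_subset by blast
    show "norm (inverse w) \<le> 1 / d"
      using assms(4) assms(5)[OF w] by (simp add: norm_inverse norm_divide inverse_eq_divide frac_le)
  qed (use assms in auto)
  then show ?thesis by simp
qed

text \<open>Mean value inequality for f(w) = Ln (s + w) - w / (s + \<alpha>): its derivative
  compares 1/(s + w) with 1/(s + \<alpha>) on a real interval of length two that contains \<alpha>.
  The bound is stated as a difference so that it telescopes over n.\<close>

lemma inverse_shift_minus_log_increment:
  fixes s :: complex and \<alpha> :: real and n :: nat
  assumes \<alpha>: "2 * real n \<le> \<alpha>" "\<alpha> \<le> 2 * real n + 2" and n: "n \<ge> 1"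
    and s: "- real n \<le> Re s" "Im s > 0"
  shows "norm (1 / (s + of_real \<alpha>) - (Ln (s + of_nat (2 * Suc n)) - Ln (s + of_nat (2 * n))) / 2)
    \<le> 8 * (1 / (real n - 1 + Im s) - 1 / (real n + Im s))"
proof -
  define t where "t = Im s"
  have t: "t > 0" using s t_def by simp
  define S where "S = {w. Im w = 0 \<and> 2 * real n \<le> Re w \<and> Re w \<le> 2 * real n + 2}"
  have S: "S = {w. Im w \<le> 0} \<inter> {w. Im w \<ge> 0} \<inter> {w. Re w \<ge> 2 * real n} \<inter> {w. Re w \<le> 2 * real n + 2}"
    unfolding S_def by auto
  have cS: "convex S" unfolding S
    by (intro convex_Int convex_halfspace_Im_le convex_halfspace_Im_ge convex_halfspace_Re_le convex_halfspace_Re_ge)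
  \<comment> \<open>The real part of s + w is at least -n + 2n = n and its imaginary part is t; the
    norm exceeds both, hence their mean.\<close>
  have big: "(real n + t) / 2 \<le> norm (s + w)" if "w \<in> S" for w
  proof -
    have "real n \<le> Re (s + w)" "Im (s + w) = t" using that s unfolding S_def t_def by auto
    then have "real n \<le> norm (s + w)" "t \<le> norm (s + w)"
      using complex_Re_le_cmod[of "s + w"] abs_Im_le_cmod[of "s + w"] by linarith+
    then show ?thesis by simp
  qed
  have \<alpha>S: "of_real \<alpha> \<in> S" using \<alpha> unfolding S_def by simp
  have nt: "0 < real n + t" using t by (simp add: add_nonneg_pos)
  define f where "f = (\<lambda>w. Ln (s + w) - w / (s + of_real \<alpha>))"
  have "norm (f (of_nat (2 * Suc n)) - f (of_nat (2 * n)))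
      \<le> 8 / (real n + t)\<^sup>2 * norm (of_nat (2 * Suc n) - of_nat (2 * n) :: complex)"
  proof (rule field_differentiable_bound[OF cS, where f' = "\<lambda>w. 1 / (s + w) - 1 / (s + of_real \<alpha>)"])
    fix w assume w: "w \<in> S"
    have "Im (s + w) > 0" using w s unfolding S_def by auto
    then have nr: "s + w \<notin> \<real>\<^sub>\<le>\<^sub>0" by (auto simp: complex_nonpos_Reals_iff)
    show "(f has_field_derivative (1 / (s + w) - 1 / (s + of_real \<alpha>))) (at w within S)"
      unfolding f_def using nr
      by (auto intro!: derivative_eq_intros simp: divide_inverse)
    have ne: "norm (s + w) > 0" "norm (s + of_real \<alpha>) > 0"
      using big[OF w] big[OF \<alpha>S] nt by auto
    have "1 / (s + w) - 1 / (s + of_real \<alpha>) = (of_real \<alpha> - w) / ((s + w) * (s + of_real \<alpha>))"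
      using ne by (auto simp: field_simps)
    then have "norm (1 / (s + w) - 1 / (s + of_real \<alpha>)) = norm (of_real \<alpha> - w) / (norm (s + w) * norm (s + of_real \<alpha>))"
      by (simp add: norm_divide norm_mult)
    also have "\<dots> \<le> 2 / ((real n + t) / 2 * ((real n + t) / 2))"
    proof (rule frac_le)
      have "w = of_real (Re w)" using w unfolding S_def by (simp add: complex_eq_iff)
      then have "norm (of_real \<alpha> - w) = \<bar>\<alpha> - Re w\<bar>" by (metis norm_of_real of_real_diff)
      also have "\<dots> \<le> 2" using w \<alpha> unfolding S_def by auto
      finally show "norm (of_real \<alpha> - w) \<le> 2" .
      show "(real n + t) / 2 * ((real n + t) / 2) \<le> norm (s + w) * norm (s + of_real \<alpha>)"
        using nt by (intro mult_mono big w \<alpha>S) auto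
    qed (use nt in auto)
    also have "\<dots> = 8 / (real n + t)\<^sup>2" by (simp add: power2_eq_square)
    finally show "norm (1 / (s + w) - 1 / (s + of_real \<alpha>)) \<le> 8 / (real n + t)\<^sup>2" .
  qed (auto simp: S_def)
  also have "norm (of_nat (2 * Suc n) - of_nat (2 * n) :: complex) = 2" by simp
  finally have le: "norm (f (of_nat (2 * Suc n)) - f (of_nat (2 * n))) \<le> 8 / (real n + t)\<^sup>2 * 2" .
  have "1 / (s + of_real \<alpha>) - (Ln (s + of_nat (2 * Suc n)) - Ln (s + of_nat (2 * n))) / 2
      = - (f (of_nat (2 * Suc n)) - f (of_nat (2 * n))) / 2"
  proof -
    define A where "A = 1 / (s + of_real \<alpha>)"
    have f: "f = (\<lambda>w. Ln (s + w) - w * A)" unfolding f_def A_def by simp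
    have 2: "(of_nat (2 * Suc n) :: complex) = of_nat (2 * n) + 2" by simp
    show ?thesis unfolding A_def[symmetric] f 2 by (simp add: field_simps)
  qed
  then have "norm (1 / (s + of_real \<alpha>) - (Ln (s + of_nat (2 * Suc n)) - Ln (s + of_nat (2 * n))) / 2)
      = norm (f (of_nat (2 * Suc n)) - f (of_nat (2 * n))) / 2"
    by (simp only: norm_divide norm_minus_cancel) simp
  also have "\<dots> \<le> 8 / (real n + t)\<^sup>2" using le by simp
  \<comment> \<open>One factor is lowered by 1 to turn the inverse square into a telescoping
    difference.\<close>
  also have "\<dots> \<le> 8 / ((real n - 1 + t) * (real n + t))"
    using n t unfolding power2_eq_square by (intro divide_left_mono mult_mono mult_pos_pos) auto
  also have "\<dots> = 8 * (1 / (real n - 1 + t) - 1 / (real n + t))"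
    using n t by (simp add: field_simps)
  finally show ?thesis unfolding t_def .
qed

text \<open>Neither half of the sum converges alone. Each partial sum is a telescoped logarithm plus
  a bounded error; at the upper end the two logarithms cancel in the limit, and at the lower end
  each is compared with the logarithm of a point on the imaginary axis.\<close>

lemma inverse_shift_sum_log:
  fixes \<alpha> :: "nat \<Rightarrow> real" and s p :: complex and N :: nat and b :: real
  assumes \<alpha>: "\<And>n. n \<ge> N \<Longrightarrow> 2 * real n \<le> \<alpha> n \<and> \<alpha> n \<le> 2 * real n + 2" and N: "N \<ge> 1"
    and s: "- real N \<le> Re s" "Re s \<le> b" "Im s > 0"
    and p: "- real N \<le> Re p" "Re p \<le> b" "Im p > 0"
    and S: "((\<lambda>n. 1 / (s + of_real (\<alpha> n)) - 1 / (p + of_real (\<alpha> n))) has_sum S) {N..}"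
  shows "norm (S - of_real (ln (Im p / Im s) / 2)) \<le> (8 + (b + 2 * real N) / 2) * (1 / Im s + 1 / Im p)"
proof -
  define err where "err = (\<lambda>u n. 1 / (u + of_real (\<alpha> n)) - (Ln (u + of_nat (2 * Suc n)) - Ln (u + of_nat (2 * n))) / 2)"
  have E: "norm (\<Sum>n=N..<M. err u n) \<le> 8 / Im u"
    if u: "- real N \<le> Re u" "Im u > 0" for u M
  proof -
    have "norm (\<Sum>n=N..<M. err u n) \<le> (\<Sum>n=N..<M. 8 * (1 / (real n - 1 + Im u) - 1 / (real n + Im u)))"
    proof (rule sum_norm_le)
      fix n assume "n \<in> {N..<M}"
      then show "norm (err u n) \<le> 8 * (1 / (real n - 1 + Im u) - 1 / (real n + Im u))"
        unfolding err_def using \<alpha>[of n] N u by (intro inverse_shift_minus_log_increment) auto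
    qed
    also have "\<dots> \<le> 8 / Im u"
    proof (cases "N \<le> M")
      case True
      have "(\<Sum>n=N..<M. (1 / (real n - 1 + Im u) - 1 / (real n + Im u)))
        = (\<Sum>n=N..<M. (- 1 / (real (Suc n) - 1 + Im u)) - (- 1 / (real n - 1 + Im u)))"
        by (intro sum.cong) auto
      also have "\<dots> = 1 / (real N - 1 + Im u) - 1 / (real M - 1 + Im u)"
        using sum_Suc_diff'[OF True, of "\<lambda>n. - 1 / (real n - 1 + Im u)"] by simp
      also have "\<dots> \<le> 1 / Im u - 0"
        using N u True by (intro diff_mono divide_left_mono) auto
      finally show ?thesis unfolding sum_distrib_left[symmetric] by simp
    qed (use u in auto)
    finally show ?thesis .
  qed
  have tele: "(\<Sum>n=N..<M. 1 / (u + of_real (\<alpha> n))) = (\<Sum>n=N..<M. err u n) + (Ln (u + of_nat (2 * M)) - Ln (u + of_nat (2 * N))) / 2"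
    if "N \<le> M" for u M
    using sum_Suc_diff'[OF that, of "\<lambda>n. Ln (u + of_nat (2 * n))"]
    unfolding err_def by (simp add: sum_subtractf flip: sum_divide_distrib)
  \<comment> \<open>The contribution of the lower ends only, hence \<open>p\<close> before
    \<open>s\<close>.\<close>
  define L where "L = (Ln (p + of_nat (2 * N)) - Ln (s + of_nat (2 * N))) / 2"
  have lim0: "(\<lambda>M. Ln (s + of_nat (2 * M)) - Ln (p + of_nat (2 * M))) \<longlonglongrightarrow> 0"
  proof (rule Lim_null_comparison)
    show "\<forall>\<^sub>F M in sequentially. norm (Ln (s + of_nat (2 * M)) - Ln (p + of_nat (2 * M))) \<le> norm (s - p) / real M"
      using eventually_ge_at_top[of N]
    proof eventually_elim
      case (elim M)
      \<comment> \<open>Both points have real part at least -N + 2M \<ge> M, so the segment between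
        them stays at distance M from the branch cut's end.\<close>
      have "norm (Ln (s + of_nat (2 * M)) - Ln (p + of_nat (2 * M)))
          \<le> norm ((s + of_nat (2 * M)) - (p + of_nat (2 * M))) / real M"
      proof (rule Ln_lipschitz[of "{w. Re w \<ge> real M}"])
        fix w assume "w \<in> {w. Re w \<ge> real M}"
        then show "w \<notin> \<real>\<^sub>\<le>\<^sub>0 \<and> real M \<le> norm w"
          using complex_Re_le_cmod[of w] elim N by (auto simp: complex_nonpos_Reals_iff)
      qed (use elim N s p in \<open>auto simp: convex_halfspace_Re_ge\<close>)
      then show ?case by simp
    qed
    show "(\<lambda>M. norm (s - p) / real M) \<longlonglongrightarrow> 0"
      by (intro tendsto_divide_0[OF tendsto_const] filterlim_at_top_imp_at_infinity filterlim_real_sequentially)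
  qed
  have part: "(\<lambda>M. (\<Sum>n=N..<M. 1 / (s + of_real (\<alpha> n)) - 1 / (p + of_real (\<alpha> n)))) \<longlonglongrightarrow> S"
  proof -
    have "filterlim (\<lambda>M. {N..<M}) (finite_subsets_at_top {N..}) sequentially"
      unfolding filterlim_finite_subsets_at_top
    proof (intro allI impI)
      fix X assume X: "finite X \<and> X \<subseteq> {N..}"
      show "\<forall>\<^sub>F M in sequentially. finite {N..<M} \<and> X \<subseteq> {N..<M} \<and> {N..<M} \<subseteq> {N..}"
        using eventually_gt_at_top[of "Max (insert 0 X)"]
      proof eventually_elim
        case (elim M)
        have "n < M" if "n \<in> X" for n
          using elim X that by (meson Max_ge finite_insert insertCI le_less_trans)
        then show ?case using X by auto
      qed
    qed
    then show ?thesis using S unfolding has_sum_def by (rule filterlim_compose[rotated])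
  qed
  have "norm (S - L) \<le> 8 / Im s + 8 / Im p"
  proof (rule Lim_norm_ubound[of sequentially])
    show "(\<lambda>M. (\<Sum>n=N..<M. 1 / (s + of_real (\<alpha> n)) - 1 / (p + of_real (\<alpha> n)))
         - (Ln (s + of_nat (2 * M)) - Ln (p + of_nat (2 * M))) / 2 - L) \<longlonglongrightarrow> S - L"
      using tendsto_diff[OF tendsto_diff[OF part tendsto_divide[OF lim0 tendsto_const[of 2]]] tendsto_const[of L]]
      by simp
    show "\<forall>\<^sub>F M in sequentially. norm ((\<Sum>n=N..<M. 1 / (s + of_real (\<alpha> n)) - 1 / (p + of_real (\<alpha> n)))
         - (Ln (s + of_nat (2 * M)) - Ln (p + of_nat (2 * M))) / 2 - L) \<le> 8 / Im s + 8 / Im p"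
      using eventually_ge_at_top[of N]
    proof eventually_elim
      case (elim M)
      have "(\<Sum>n=N..<M. 1 / (s + of_real (\<alpha> n)) - 1 / (p + of_real (\<alpha> n)))
         - (Ln (s + of_nat (2 * M)) - Ln (p + of_nat (2 * M))) / 2 - L = (\<Sum>n=N..<M. err s n) - (\<Sum>n=N..<M. err p n)"
        unfolding sum_subtractf tele[OF elim] L_def by (simp add: diff_divide_distrib)
      also have "norm \<dots> \<le> 8 / Im s + 8 / Im p"
        using norm_triangle_ineq4[of "\<Sum>n=N..<M. err s n" "\<Sum>n=N..<M. err p n"]
          E[OF s(1,3), of M] E[OF p(1,3), of M] by linarith
      finally show ?case .
    qed
  qed simp
  \<comment> \<open>Horizontal comparison with the point i * Im u of the same height, inside the
    half plane Im w \<ge> Im u. The common \<open>Ln \<i>\<close> cancels between \<open>s\<close>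
    and \<open>p\<close>, and ln (Im p / Im s) remains.\<close>
  moreover have Lni: "norm (Ln (u + of_nat (2 * N)) - (Ln \<i> + of_real (ln (Im u)))) \<le> (b + 2 * real N) / Im u"
    if u: "- real N \<le> Re u" "Re u \<le> b" "Im u > 0" for u
  proof -
    define v where "v = of_real (Im u) * \<i>"
    have "Ln v = Ln \<i> + of_real (ln (Im u))"
      unfolding v_def using u by (subst Ln_times_of_real) (auto simp: Ln_of_real)
    moreover have "norm (Ln (u + of_nat (2 * N)) - Ln v) \<le> norm (u + of_nat (2 * N) - v) / Im u"
    proof (rule Ln_lipschitz[of "{w. Im w \<ge> Im u}"])
      fix w assume "w \<in> {w. Im w \<ge> Im u}"
      then show "w \<notin> \<real>\<^sub>\<le>\<^sub>0 \<and> Im u \<le> norm w"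
        using abs_Im_le_cmod[of w] u by (auto simp: complex_nonpos_Reals_iff)
    qed (use u in \<open>auto simp: convex_halfspace_Im_ge v_def\<close>)
    moreover have "norm (u + of_nat (2 * N) - v) \<le> b + 2 * real N"
    proof -
      have "u + of_nat (2 * N) - v = of_real (Re u + 2 * real N)"
        by (simp add: complex_eq_iff v_def)
      then show ?thesis using u by (simp only: norm_of_real)
    qed
    then have "norm (u + of_nat (2 * N) - v) / Im u \<le> (b + 2 * real N) / Im u"
      using u by (intro divide_right_mono) auto
    ultimately show ?thesis by simp
  qed
  have "norm (L - of_real (ln (Im p / Im s) / 2)) \<le> (b + 2 * real N) / 2 * (1 / Im s + 1 / Im p)"
  proof -
    define x where "x = Ln (p + of_nat (2 * N)) - (Ln \<i> + of_real (ln (Im p)))"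
    define y where "y = Ln (s + of_nat (2 * N)) - (Ln \<i> + of_real (ln (Im s)))"
    have eq: "L - of_real (ln (Im p / Im s) / 2) = (x - y) / 2"
      unfolding L_def x_def y_def using s p by (simp add: ln_div field_simps)
    have "norm (L - of_real (ln (Im p / Im s) / 2)) = norm (x - y) / 2"
      unfolding eq by (simp add: norm_divide)
    also have "\<dots> \<le> (norm x + norm y) / 2" using norm_triangle_ineq4[of x y] by simp
    also have "\<dots> \<le> ((b + 2 * real N) / Im p + (b + 2 * real N) / Im s) / 2"
      using Lni[OF p, folded x_def] Lni[OF s, folded y_def] by (intro divide_right_mono add_mono) auto
    finally show ?thesis by (simp add: algebra_simps add_divide_distrib)
  qed
  ultimately have "norm ((S - L) + (L - of_real (ln (Im p / Im s) / 2)))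
      \<le> (8 / Im s + 8 / Im p) + (b + 2 * real N) / 2 * (1 / Im s + 1 / Im p)"
    by (intro norm_triangle_le add_mono)
  then show ?thesis by (simp add: algebra_simps)
qed

section \<open>Continuation of zeta by the trapezoidal rule\<close>

text \<open>
  \<open>trapezoid_term n s\<close> is \<open>s - 1\<close> times the error of the trapezoidal rule for \<open>x\<^bsup>-s\<^esup>\<close> on
  \<open>[n, n + 1]\<close>; the factor removes the singularity of the antiderivative at \<open>s = 1\<close>.
\<close>
definition trapezoid_term :: "nat \<Rightarrow> complex \<Rightarrow> complex" where
  "trapezoid_term n s = (s - 1) * (of_nat n powr (-s) + of_nat (Suc n) powr (-s)) / 2
     + (of_nat (Suc n) powr (1 - s) - of_nat n powr (1 - s))"

text \<open>Let the length h of the interval vary from 0 to 1. The error and its first h-derivative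
  both vanish at h = 0, so a bound on the second derivative passes through two mean value
  inequalities. The exponent -Re s - 2 is what makes the series converge up to Re s > -1.\<close>

lemma norm_trapezoid_term_le:
  assumes n: "n \<ge> 1" and s: "Re s \<ge> -2"
  shows "norm (trapezoid_term n s) \<le> norm (s - 1) * norm s * norm (s + 1) / 2 * real n powr (- Re s - 2)"
proof -
  define \<phi> where "\<phi> = (\<lambda>h. (of_nat n + h) powr (-s))"
  define \<phi>1 where "\<phi>1 = (\<lambda>h. (- s) * (of_nat n + h) powr (-s - 1))"
  define \<phi>2 where "\<phi>2 = (\<lambda>h. s * (s + 1) * (of_nat n + h) powr (-s - 2))"
  \<comment> \<open>The error on the interval from n to n + h, times s - 1; \<open>G1\<close> is its
    derivative in h.\<close>
  define G where "G = (\<lambda>h. h * ((s - 1) * (\<phi> 0 + \<phi> h) / 2) + (of_nat n + h) powr (1 - s) - of_nat n powr (1 - s))"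
  define G1 where "G1 = (\<lambda>h. (s - 1) * ((\<phi> 0 - \<phi> h) / 2 + h * \<phi>1 h / 2))"
  define S where "S = closed_segment (0::complex) 1"
  have Sd: "Im w = 0" "0 \<le> Re w" "Re w \<le> 1" "norm w \<le> 1" "w = of_real (Re w)" if "w \<in> S" for w
  proof -
    obtain u where u: "w = of_real u" "0 \<le> u" "u \<le> 1"
      using \<open>w \<in> S\<close> unfolding S_def closed_segment_def by (auto simp: scaleR_conv_of_real)
    then show "Im w = 0" "0 \<le> Re w" "Re w \<le> 1" "norm w \<le> 1" "w = of_real (Re w)" by auto
  qed
  have nr: "of_nat n + w \<notin> \<real>\<^sub>\<le>\<^sub>0" if "w \<in> S" for w
    using Sd[OF that] n by (auto simp: complex_nonpos_Reals_iff)
  define B where "B = norm (s - 1) * norm s * norm (s + 1) / 2 * real n powr (- Re s - 2)"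
  have B: "B \<ge> 0" unfolding B_def by auto
  have d\<phi>: "(\<phi> has_field_derivative \<phi>1 w) (at w within S)" if "w \<in> S" for w
    unfolding \<phi>_def \<phi>1_def using nr[OF that] by (auto intro!: derivative_eq_intros)
  have d\<phi>1: "(\<phi>1 has_field_derivative \<phi>2 w) (at w within S)" if "w \<in> S" for w
    unfolding \<phi>1_def \<phi>2_def using nr[OF that]
    by (auto intro!: derivative_eq_intros simp: algebra_simps)
  have dG: "(G has_field_derivative G1 w) (at w within S)" if "w \<in> S" for w
  proof -
    have "((\<lambda>h. (of_nat n + h) powr (1 - s)) has_field_derivative (1 - s) * \<phi> w) (at w within S)"
      unfolding \<phi>_def using nr[OF that] by (auto intro!: derivative_eq_intros)
    moreover have "((\<lambda>h. h * ((s - 1) * (\<phi> 0 + \<phi> h) / 2)) has_field_derivative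
        (s - 1) * (\<phi> 0 + \<phi> w) / 2 + w * ((s - 1) * \<phi>1 w / 2)) (at w within S)"
      by (auto intro!: derivative_eq_intros d\<phi> that)
    ultimately have "(G has_field_derivative ((s - 1) * (\<phi> 0 + \<phi> w) / 2 + w * ((s - 1) * \<phi>1 w / 2)
        + (1 - s) * \<phi> w - 0)) (at w within S)"
      unfolding G_def by (intro DERIV_diff DERIV_add DERIV_const)
    then show ?thesis unfolding G1_def by (rule DERIV_cong) (simp add: field_simps)
  qed
  have dG1: "(G1 has_field_derivative (s - 1) * (w * \<phi>2 w / 2)) (at w within S)" if "w \<in> S" for w
    unfolding G1_def
    by (auto intro!: derivative_eq_intros d\<phi> d\<phi>1 that simp: field_simps)
  have n2: "norm ((s - 1) * (w * \<phi>2 w / 2)) \<le> B" if w: "w \<in> S" for w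
  proof -
    have "norm ((of_nat n + w) powr (-s - 2)) = (real n + Re w) powr (- Re s - 2)"
    proof -
      have "of_nat n + w = of_real (real n + Re w)" using Sd(5)[OF w] by (metis of_real_add of_real_of_nat_eq)
      then show ?thesis using n Sd[OF w] by (simp add: norm_powr_real_powr del: of_real_add)
    qed
    also have "\<dots> \<le> real n powr (- Re s - 2)"
      using n s Sd[OF w] by (intro powr_mono2') auto
    finally have p: "norm ((of_nat n + w) powr (-s - 2)) \<le> real n powr (- Re s - 2)" .
    have "norm ((s - 1) * (w * \<phi>2 w / 2)) = norm (s - 1) * norm s * norm (s + 1) / 2 * (norm w * norm ((of_nat n + w) powr (-s - 2)))"
      unfolding \<phi>2_def by (simp add: norm_mult norm_divide)
    also have "\<dots> \<le> norm (s - 1) * norm s * norm (s + 1) / 2 * (1 * real n powr (- Re s - 2))"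
      using Sd(4)[OF w] p by (intro mult_left_mono mult_mono) auto
    finally show ?thesis unfolding B_def by simp
  qed
  have cS: "convex S" "0 \<in> S" "1 \<in> S" unfolding S_def by auto
  have G1b: "norm (G1 w) \<le> B" if w: "w \<in> S" for w
  proof -
    have "norm (G1 w - G1 0) \<le> B * norm (w - 0)"
      by (rule field_differentiable_bound[OF cS(1) dG1 n2]) (use w cS in auto)
    also have "\<dots> \<le> B * 1" using Sd(4)[OF w] B by (intro mult_left_mono) auto
    finally show ?thesis unfolding G1_def by simp
  qed
  have "norm (G 1 - G 0) \<le> B * norm (1 - 0 :: complex)"
    by (rule field_differentiable_bound[OF cS(1) dG G1b]) (use cS in auto)
  moreover have "G 1 - G 0 = trapezoid_term n s"
    unfolding G_def trapezoid_term_def \<phi>_def by (simp add: add.commute)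
  ultimately show ?thesis unfolding B_def by simp
qed

text \<open>This is (s - 1) zeta(s) for Re s > -1. Summing the trapezoidal means over all intervals
  gives zeta(s) - 1/2 and the antiderivatives telescope to -1; the correction is (s - 1)/2 + 1 = (s
  + 1)/2.\<close>

definition zeta_half :: "complex \<Rightarrow> complex" where
  "zeta_half s = (s + 1) / 2 + (\<Sum>n. trapezoid_term (Suc n) s)"

lemma summable_Suc_powr: "x < -1 \<Longrightarrow> summable (\<lambda>n. real (Suc n) powr x)"
  using summable_real_powr_iff[of x] summable_Suc_iff[of "\<lambda>n. real n powr x"] by simp

lemma summable_trapezoid_term:
  assumes "Re s > -1"
  shows "summable (\<lambda>n. norm (trapezoid_term (Suc n) s))"
proof (rule summable_comparison_test)
  show "summable (\<lambda>n. norm (s - 1) * norm s * norm (s + 1) / 2 * real (Suc n) powr (- Re s - 2))"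
    using assms by (intro summable_mult summable_Suc_powr) auto
  show "\<exists>N. \<forall>n\<ge>N. norm (norm (trapezoid_term (Suc n) s)) \<le> norm (s - 1) * norm s * norm (s + 1) / 2 * real (Suc n) powr (- Re s - 2)"
    using norm_trapezoid_term_le[of "Suc _" s] assms by auto
qed

lemma zeta_half_sums:
  "Re s > -1 \<Longrightarrow> (\<lambda>n. trapezoid_term (Suc n) s) sums (zeta_half s - (s + 1) / 2)"
  unfolding zeta_half_def using summable_norm_cancel[OF summable_trapezoid_term] by (simp add: summable_sums)

lemma holomorphic_trapezoid_term: "n \<ge> 1 \<Longrightarrow> trapezoid_term n holomorphic_on A"
  unfolding trapezoid_term_def by (intro holomorphic_intros) auto

lemma holomorphic_zeta_half: "zeta_half holomorphic_on {s. Re s > -1}"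
proof -
  have "(\<lambda>s. \<Sum>n. trapezoid_term (Suc n) s) holomorphic_on {s. Re s > -1}"
  proof (rule holomorphic_uniform_sequence[where f = "\<lambda>N s. \<Sum>n<N. trapezoid_term (Suc n) s"])
    show "open {s. Re s > -1}" by (rule open_halfspace_Re_gt)
    show "(\<lambda>s. \<Sum>n<N. trapezoid_term (Suc n) s) holomorphic_on {s. - 1 < Re s}" for N
      by (intro holomorphic_intros holomorphic_trapezoid_term) auto
    fix x assume "x \<in> {s. Re s > -1}"
    then have x: "Re x > -1" by simp
    define d where "d = (Re x + 1) / 2"
    have d: "d > 0" "Re x - d > -1" using x unfolding d_def by (auto simp: field_simps)
    have R: "Re x - d \<le> Re s" "norm s \<le> norm x + d" if "s \<in> cball x d" for s
    proof -
      have "norm (x - s) \<le> d" using that by (simp add: dist_norm)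
      then show "Re x - d \<le> Re s" "norm s \<le> norm x + d"
        using complex_Re_le_cmod[of "x - s"] norm_triangle_ineq3[of x s] by auto
    qed
    define M where "M = norm x + d + 1"
    have "uniform_limit (cball x d) (\<lambda>N s. \<Sum>n<N. trapezoid_term (Suc n) s) (\<lambda>s. \<Sum>n. trapezoid_term (Suc n) s) sequentially"
    proof (rule Weierstrass_m_test)
      show "summable (\<lambda>n. M * M * M / 2 * real (Suc n) powr (- (Re x - d) - 2))"
        using d by (intro summable_mult summable_Suc_powr) auto
      fix n s assume s: "s \<in> cball x d"
      have "norm (trapezoid_term (Suc n) s) \<le> norm (s - 1) * norm s * norm (s + 1) / 2 * real (Suc n) powr (- Re s - 2)"
        using R[OF s] d by (intro norm_trapezoid_term_le) auto
      also have "\<dots> \<le> M * M * M / 2 * real (Suc n) powr (- (Re x - d) - 2)"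
        using R[OF s] norm_triangle_ineq4[of s 1] norm_triangle_ineq[of s 1] d
        by (intro mult_mono divide_right_mono powr_mono) (auto simp: M_def)
      finally show "norm (trapezoid_term (Suc n) s) \<le> M * M * M / 2 * real (Suc n) powr (- (Re x - d) - 2)" .
    qed
    then show "\<exists>d>0. cball x d \<subseteq> {s. - 1 < Re s} \<and>
        uniform_limit (cball x d) (\<lambda>N s. \<Sum>n<N. trapezoid_term (Suc n) s) (\<lambda>s. \<Sum>n. trapezoid_term (Suc n) s) sequentially"
      using d R by (intro exI[of _ d]) force
  qed
  then show ?thesis unfolding zeta_half_def by (intro holomorphic_intros) auto
qed

lemma zeta_half_1: "zeta_half 1 = 1"
proof -
  have "trapezoid_term (Suc n) 1 = 0" for n
    by (simp add: trapezoid_term_def del: of_nat_Suc)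
  then show ?thesis by (simp add: zeta_half_def)
qed

lemma dirichlet_sums_zeta_half:
  assumes s: "Re s > 1"
  shows "(\<lambda>n. of_nat (Suc n) powr (-s)) sums (zeta_half s / (s - 1))"
proof -
  have "summable (\<lambda>n. norm (of_nat (Suc n) powr (-s) :: complex))"
  proof -
    have "norm (of_nat (Suc n) powr (-s) :: complex) = real (Suc n) powr (- Re s)" for n
      using norm_powr_real_powr[of "of_nat (Suc n)" "-s"] by simp
    then show ?thesis using s summable_Suc_powr[of "- Re s"] by simp
  qed
  then have "summable (\<lambda>n. of_nat (Suc n) powr (-s) :: complex)" by (rule summable_norm_cancel)
  then obtain Z where Z: "(\<lambda>n. of_nat (Suc n) powr (-s) :: complex) sums Z" by (auto simp: summable_def)
  have Z2: "(\<lambda>n. of_nat (Suc (Suc n)) powr (-s) :: complex) sums (Z - 1)"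
    using sums_Suc_iff[of "\<lambda>n. of_nat (Suc n) powr (-s) :: complex" "Z - 1"] Z by simp
  have "(\<lambda>n. of_nat (Suc n) powr (1 - s) :: complex) \<longlonglongrightarrow> 0"
  proof (rule Lim_null_comparison)
    show "\<forall>\<^sub>F n in sequentially. norm (of_nat (Suc n) powr (1 - s) :: complex) \<le> real (Suc n) powr (1 - Re s)"
      using norm_powr_real_powr[of "of_nat (Suc _)" "1 - s"] by simp
    have "((\<lambda>n. real n powr (1 - Re s)) \<longlonglongrightarrow> 0)"
      using s by (intro tendsto_neg_powr filterlim_real_sequentially) auto
    then show "(\<lambda>n. real (Suc n) powr (1 - Re s)) \<longlonglongrightarrow> 0" by (rule LIMSEQ_Suc)
  qed
  from telescope_sums[OF this]
  have tel: "(\<lambda>n. of_nat (Suc (Suc n)) powr (1 - s) - of_nat (Suc n) powr (1 - s) :: complex) sums (0 - 1)"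
    by simp
  have "(\<lambda>n. (s - 1) / 2 * (of_nat (Suc n) powr (-s) + of_nat (Suc (Suc n)) powr (-s))
      + (of_nat (Suc (Suc n)) powr (1 - s) - of_nat (Suc n) powr (1 - s)))
      sums ((s - 1) / 2 * (Z + (Z - 1)) + (0 - 1))"
    by (intro sums_add sums_mult Z Z2 tel)
  moreover have "(s - 1) / 2 * (of_nat (Suc n) powr (-s) + of_nat (Suc (Suc n)) powr (-s))
      + (of_nat (Suc (Suc n)) powr (1 - s) - of_nat (Suc n) powr (1 - s)) = trapezoid_term (Suc n) s" for n
    unfolding trapezoid_term_def by simp
  ultimately have "(\<lambda>n. trapezoid_term (Suc n) s) sums ((s - 1) / 2 * (Z + (Z - 1)) + (0 - 1))" by simp
  then have "zeta_half s - (s + 1) / 2 = (s - 1) / 2 * (Z + (Z - 1)) + (0 - 1)"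
    using zeta_half_sums[of s] s sums_unique2 by auto
  then have "zeta_half s = (s + 1) / 2 + ((s - 1) / 2 * (Z + (Z - 1)) + (0 - 1))"
    by (metis add.commute diff_add_cancel)
  also have "\<dots> = (s - 1) * Z" by (simp add: field_simps)
  finally have "zeta_half s = (s - 1) * Z" .
  moreover have "s \<noteq> 1" using s by auto
  ultimately show ?thesis using Z by simp
qed

section \<open>Partial fractions of the hyperbolic cotangent\<close>

text \<open>The value on the right is 1/(e^x - 1) + 1/2 - 1/x. The logarithmic derivative of the
  reflection formula for \<open>rGamma\<close> writes pi * cot (pi z) as a difference of Digamma
  values, whose series are the partial fractions; the point is z = i x / (2 pi).\<close>

lemma coth_partial_fractions:
  assumes x: "x > (0::real)"
  shows "(\<lambda>k. 2 * x / (4 * pi\<^sup>2 * (real (Suc k))\<^sup>2 + x\<^sup>2)) sums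
    ((1 + exp (-x)) / (1 - exp (-x)) / 2 - 1 / x)"
proof -
  define z where "z = \<i> * of_real (x / (2 * pi))"
  have z0: "z \<noteq> 0" using x unfolding z_def by simp
  have Imz: "Im z \<noteq> 0" using x unfolding z_def by simp
  have Im0: "w \<noteq> 0" if "Im w \<noteq> 0" for w using that by auto
  have ni: "w \<notin> \<int>\<^sub>\<le>\<^sub>0" if "Im w \<noteq> 0" for w using that by (auto elim!: nonpos_Ints_cases)
  have nz: "z + 1 \<noteq> 0" "1 - z \<noteq> 0" using Imz by (auto intro!: Im0)
  have "((\<lambda>w. rGamma w * rGamma (1 - w)) has_field_derivative
      (rGamma z * rGamma (1 - z)) * (Digamma (1 - z) - Digamma z)) (at z)"
    using ni[of z] ni[of "1 - z"] Imz
    by (auto intro!: derivative_eq_intros has_field_derivative_rGamma_no_nonpos_int simp: algebra_simps)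
  moreover have "(\<lambda>w::complex. rGamma w * rGamma (1 - w)) = (\<lambda>w. sin (of_real pi * w) / of_real pi)"
    by (simp add: rGamma_reflection_complex fun_eq_iff)
  moreover have "((\<lambda>w. sin (of_real pi * w) / of_real pi) has_field_derivative cos (of_real pi * z)) (at z)"
    by (auto intro!: derivative_eq_intros)
  ultimately have cot: "sin (of_real pi * z) / of_real pi * (Digamma (1 - z) - Digamma z) = cos (of_real pi * z)"
    using DERIV_unique rGamma_reflection_complex[of z] by metis
  \<comment> \<open>Shifting to z + 1 splits off 1/z, the source of the term -1/x, and makes the two
    Digamma series symmetric in z.\<close>
  have dig: "Digamma z = Digamma (z + 1) - 1 / z" using Digamma_plus1[OF z0] by simp
  have S1: "(\<lambda>k. inverse (of_nat (Suc k)) - inverse (w + of_nat k)) sums (Digamma w + euler_mascheroni)" if "w \<noteq> 0" for w :: complex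
    using summable_sums[OF summable_Digamma[OF that]] by (simp add: Digamma_def)
  have "(\<lambda>k. (inverse (of_nat (Suc k)) - inverse (1 - z + of_nat k)) - (inverse (of_nat (Suc k)) - inverse (z + 1 + of_nat k)))
     sums ((Digamma (1 - z) + euler_mascheroni) - (Digamma (z + 1) + euler_mascheroni))"
    by (intro sums_diff S1 nz)
  moreover have "(inverse (of_nat (Suc k)) - inverse (1 - z + of_nat k)) - (inverse (of_nat (Suc k)) - inverse (z + 1 + of_nat k))
      = - (2 * of_real pi * \<i>) * of_real (2 * x / (4 * pi\<^sup>2 * (real (Suc k))\<^sup>2 + x\<^sup>2))" for k
  proof -
    define c where "c = real (Suc k)"
    have ne: "of_real c - z \<noteq> 0" "of_real c + z \<noteq> 0" using Imz by (auto intro!: Im0)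
    have pos: "4 * pi\<^sup>2 * c\<^sup>2 + x\<^sup>2 > 0" using x by (simp add: add_nonneg_pos)
    have "(inverse (of_nat (Suc k)) - inverse (1 - z + of_nat k)) - (inverse (of_nat (Suc k)) - inverse (z + 1 + of_nat k))
        = inverse (of_real c + z) - inverse (of_real c - z)"
      unfolding c_def by (simp add: algebra_simps)
    also have "\<dots> = - 2 * z / ((of_real c - z) * (of_real c + z))"
      using ne by (simp add: divide_simps)
    also have "(of_real c - z) * (of_real c + z) = of_real c * of_real c - z * z"
      by (simp add: algebra_simps)
    also have "z * z = - of_real (x\<^sup>2 / (4 * pi\<^sup>2))"
      unfolding z_def by (simp add: power2_eq_square complex_eq_iff)
    also have "- 2 * z / (of_real c * of_real c - - of_real (x\<^sup>2 / (4 * pi\<^sup>2)))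
        = - 2 * z / of_real ((4 * pi\<^sup>2 * c\<^sup>2 + x\<^sup>2) / (4 * pi\<^sup>2))"
      by (simp add: field_simps power2_eq_square)
    also have "\<dots> = - (2 * of_real pi * \<i>) * of_real (2 * x / (4 * pi\<^sup>2 * c\<^sup>2 + x\<^sup>2))"
    proof -
      have "x / pi / ((4 * pi\<^sup>2 * c\<^sup>2 + x\<^sup>2) / (4 * pi\<^sup>2)) = 2 * pi * (2 * x / (4 * pi\<^sup>2 * c\<^sup>2 + x\<^sup>2))"
        using pos by (simp add: field_simps power2_eq_square)
      then have e: "complex_of_real (x / pi / ((4 * pi\<^sup>2 * c\<^sup>2 + x\<^sup>2) / (4 * pi\<^sup>2))) = of_real (2 * pi * (2 * x / (4 * pi\<^sup>2 * c\<^sup>2 + x\<^sup>2)))"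
        by simp
      have "- 2 * z = - \<i> * of_real (x / pi)" unfolding z_def by simp
      then have "- 2 * z / of_real ((4 * pi\<^sup>2 * c\<^sup>2 + x\<^sup>2) / (4 * pi\<^sup>2)) = - \<i> * of_real (x / pi / ((4 * pi\<^sup>2 * c\<^sup>2 + x\<^sup>2) / (4 * pi\<^sup>2)))"
        by (metis of_real_divide times_divide_eq_right)
      then show ?thesis unfolding e by simp
    qed
    finally show ?thesis unfolding c_def .
  qed
  ultimately have "(\<lambda>k. - (2 * of_real pi * \<i>) * of_real (2 * x / (4 * pi\<^sup>2 * (real (Suc k))\<^sup>2 + x\<^sup>2)))
      sums (Digamma (1 - z) - Digamma (z + 1))" by simp
  moreover define w where "w = - (2 * of_real pi * \<i>)"
  moreover define a where "a = (\<lambda>k. 2 * x / (4 * pi\<^sup>2 * (real (Suc k))\<^sup>2 + x\<^sup>2))"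
  ultimately have "(\<lambda>k. w * of_real (a k)) sums (Digamma (1 - z) - Digamma (z + 1))" by simp
  then have "(\<lambda>k. w * of_real (a k) / w) sums ((Digamma (1 - z) - Digamma (z + 1)) / w)"
    by (rule sums_divide)
  moreover have "w \<noteq> 0" unfolding w_def by simp
  ultimately have sm: "(\<lambda>k. complex_of_real (a k)) sums ((Digamma (1 - z) - Digamma (z + 1)) / w)" by simp
  define q where "q = exp (-x)"
  have q: "q < 1" "q > 0" unfolding q_def using x by auto
  have piz: "of_real pi * z = \<i> * of_real (x / 2)" unfolding z_def by simp
  define h where "h = exp (x / 2)"
  have h: "h > 0" "q = 1 / (h * h)" unfolding h_def q_def by (auto simp: exp_minus field_simps exp_add[symmetric])
  have sinz: "sin (of_real pi * z) = of_real ((1/h - h) / 2) / \<i>"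
    unfolding piz sin_exp_eq h_def by (simp add: exp_minus exp_of_real[symmetric] field_simps)
  have cosz: "cos (of_real pi * z) = of_real ((1/h + h) / 2)"
    unfolding piz cos_exp_eq h_def by (simp add: exp_minus exp_of_real[symmetric] field_simps)
  have "h > 1" unfolding h_def using x by simp
  then have h1: "1/h - h \<noteq> 0" by (simp add: field_simps) (metis mult_less_cancel_left_pos mult.right_neutral less_trans not_less_iff_gr_or_eq zero_less_one)
  have "Digamma (1 - z) - Digamma z = \<i> * of_real pi * of_real ((1/h + h) / (1/h - h))"
  proof -
    define D where "D = Digamma (1 - z) - Digamma z"
    define r where "r = complex_of_real ((1/h - h) / 2)"
    define u where "u = complex_of_real ((1/h + h) / 2)"
    have r0: "r \<noteq> 0" using h1 unfolding r_def by (simp del: of_real_divide of_real_diff)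
    have "r / \<i> / of_real pi * D = u" using cot unfolding sinz cosz D_def r_def u_def .
    then have "- (\<i> * (D * r)) = u * of_real pi" by (simp add: field_simps)
    then have "\<i> * - (\<i> * (D * r)) = \<i> * (u * of_real pi)" by (rule arg_cong)
    then have "D * r = \<i> * (u * of_real pi)" by (simp add: mult.assoc[symmetric])
    then have "D = \<i> * of_real pi * (u / r)" using r0 by (simp add: field_simps)
    moreover have "a / 2 / (b / 2) = a / b" for a b :: real by simp
    then have "u / r = of_real ((1/h + h) / (1/h - h))"
      unfolding u_def r_def by (simp only: of_real_divide[symmetric])
    ultimately show ?thesis unfolding D_def by simp
  qed
  then have "Digamma (1 - z) - Digamma (z + 1) = \<i> * of_real pi * of_real ((1/h + h) / (1/h - h)) - 1 / z"
    using dig by (simp add: algebra_simps)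
  also have "1 / z = - \<i> * of_real (2 * pi / x)" unfolding z_def using x by (simp add: field_simps)
  also have "(1/h + h) / (1/h - h) = - ((1 + q) / (1 - q))"
  proof -
    have e: "1/h + h = h * (1 + q)" "1/h - h = - (h * (1 - q))" using h by (simp_all add: field_simps)
    show ?thesis unfolding e using h q by simp
  qed
  finally have dd: "Digamma (1 - z) - Digamma (z + 1) = \<i> * of_real pi * of_real (- ((1 + q) / (1 - q))) - - \<i> * of_real (2 * pi / x)" .
  have "(\<i> * of_real pi * of_real (- Q) - - \<i> * of_real (2 * pi / x)) / w = of_real (Q / 2 - 1 / x)" for Q
    using x unfolding w_def by (simp add: field_simps)
  then have "(Digamma (1 - z) - Digamma (z + 1)) / w = of_real ((1 + q) / (1 - q) / 2 - 1 / x)"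
    unfolding dd .
  with sm have "(\<lambda>k. complex_of_real (a k)) sums of_real ((1 + q) / (1 - q) / 2 - 1 / x)"
    by simp
  then show ?thesis unfolding sums_of_real_iff q_def a_def .
qed

section \<open>The functional equation\<close>

lemma nn_integral_Gamma_scaled:
  assumes p: "p > (0::real)" and y: "y > 0"
  shows "(\<integral>\<^sup>+x. ennreal (indicator {0<..} x * (x powr (p - 1) * exp (- (y * x)))) \<partial>lborel)
    = ennreal (Gamma p * y powr (-p))"
proof -
  define I where "I = (\<integral>\<^sup>+x. ennreal (indicator {0<..} x * (x powr (p - 1) * exp (- (y * x)))) \<partial>lborel)"
  have "ennreal (Gamma p) = (\<integral>\<^sup>+t. ennreal (indicator {0..} t * t powr (p - 1) / exp t) \<partial>lborel)"
    using Gamma_conv_nn_integral_real[OF p] .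
  also have "\<dots> = ennreal \<bar>y\<bar> * (\<integral>\<^sup>+x. ennreal (indicator {0..} (0 + y * x) * (0 + y * x) powr (p - 1) / exp (0 + y * x)) \<partial>lborel)"
    by (rule nn_integral_real_affine) (use y in auto)
  also have "(\<integral>\<^sup>+x. ennreal (indicator {0..} (0 + y * x) * (0 + y * x) powr (p - 1) / exp (0 + y * x)) \<partial>lborel)
      = (\<integral>\<^sup>+x. ennreal (y powr (p - 1)) * ennreal (indicator {0<..} x * (x powr (p - 1) * exp (- (y * x)))) \<partial>lborel)"
    using y by (intro nn_integral_cong)
      (auto simp: indicator_def powr_mult exp_minus divide_inverse ennreal_mult[symmetric] zero_le_mult_iff mult_ac)
  also have "\<dots> = ennreal (y powr (p - 1)) * I"
    unfolding I_def by (rule nn_integral_cmult) auto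
  finally have "ennreal (Gamma p) = ennreal \<bar>y\<bar> * (ennreal (y powr (p - 1)) * I)" .
  also have "\<dots> = ennreal (y powr p) * I"
  proof -
    have "\<bar>y\<bar> * y powr (p - 1) = y powr p" using y by (simp add: powr_diff)
    then show ?thesis by (simp add: mult.assoc[symmetric] ennreal_mult[symmetric])
  qed
  finally have "ennreal (y powr (-p)) * ennreal (Gamma p) = ennreal (y powr (-p)) * (ennreal (y powr p) * I)" by simp
  also have "\<dots> = I" using y by (simp add: mult.assoc[symmetric] ennreal_mult[symmetric] flip: powr_add)
  finally show ?thesis unfolding I_def[symmetric] using p
    by (simp add: ennreal_mult[symmetric] Gamma_real_pos less_imp_le mult.commute)
qed

text \<open>The scaled Gamma integral after the substitution v = x^2, whose Jacobian 2x raises the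
  exponent s - 1 to s.\<close>

lemma nn_integral_Gauss_moment:
  assumes s: "-1 < s" "s < (1::real)" and t: "t > 0"
  shows "(\<integral>\<^sup>+x. ennreal (indicator {0<..} x * (2 * x powr s * exp (- (t * x\<^sup>2)))) \<partial>lborel)
    = ennreal (Gamma ((s + 1) / 2) * t powr (- ((s + 1) / 2)))"
proof -
  define p where "p = (s + 1) / 2"
  have p: "p > 0" unfolding p_def using s by simp
  define f where "f = (\<lambda>v. v powr (p - 1) * exp (- (t * v)))"
  define r where "r = Gamma p * t powr (- p)"
  have r: "r \<ge> 0" unfolding r_def using p by (simp add: Gamma_real_pos less_imp_le)
  have "((\<lambda>v. indicator {0<..} v * f v) has_integral r) UNIV"
    unfolding f_def r_def
    by (rule nn_integral_has_integral) (use nn_integral_Gamma_scaled[OF p t] r p in \<open>auto simp: r_def Gamma_real_pos less_imp_le\<close>)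
  then have "((\<lambda>v. if v \<in> {0<..} then f v else 0) has_integral r) UNIV"
    by (rule has_integral_eq[rotated]) auto
  then have fi: "(f has_integral r) {0<..}" using has_integral_restrict_UNIV by blast
  then have "f absolutely_integrable_on {0<..}"
    by (intro nonnegative_absolutely_integrable_1) (auto simp: f_def integrable_on_def)
  moreover have img: "(\<lambda>x::real. x\<^sup>2) ` {0<..} = {0<..}"
  proof
    show "{0<..} \<subseteq> (\<lambda>x::real. x\<^sup>2) ` {0<..}"
    proof
      fix y :: real assume "y \<in> {0<..}"
      then show "y \<in> (\<lambda>x. x\<^sup>2) ` {0<..}" by (intro image_eqI[of _ _ "sqrt y"]) auto
    qed
  qed auto
  ultimately have "f absolutely_integrable_on ((\<lambda>x. x\<^sup>2) ` {0<..}) \<and> integral ((\<lambda>x. x\<^sup>2) ` {0<..}) f = r"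
    using fi by (simp add: integral_unique)
  then have "(\<lambda>x. \<bar>2 * x\<bar> * f (x\<^sup>2)) absolutely_integrable_on {0<..} \<and> integral {0<..} (\<lambda>x. \<bar>2 * x\<bar> * f (x\<^sup>2)) = r"
    by (subst has_absolute_integral_change_of_variables_1')
       (auto intro!: derivative_eq_intros simp: inj_on_def)
  then have "((\<lambda>x. \<bar>2 * x\<bar> * f (x\<^sup>2)) has_integral r) {0<..}"
    by (metis absolutely_integrable_on_def integrable_integral)
  then have "((\<lambda>x. 2 * x powr s * exp (- (t * x\<^sup>2))) has_integral r) {0<..}"
  proof (rule has_integral_eq[rotated])
    fix x :: real assume "x \<in> {0<..}"
    then have x: "x > 0" by simp
    have "(x\<^sup>2) powr (p - 1) = x powr (2 * (p - 1))"
      using x by (simp only: powr_powr flip: powr_numeral)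
    also have "2 * (p - 1) = s - 1" by (simp add: p_def field_simps)
    finally have "(x\<^sup>2) powr (p - 1) = x powr (s - 1)" .
    then show "\<bar>2 * x\<bar> * f (x\<^sup>2) = 2 * x powr s * exp (- (t * x\<^sup>2))"
      unfolding f_def using x by (simp add: powr_diff)
  qed
  from nn_integral_has_integral_lebesgue[OF _ this] show ?thesis
    unfolding r_def p_def by simp
qed

text \<open>Writing 1/(A^2 + x^2) as the integral of exp (-(A^2 + x^2) t) over t > 0 and exchanging
  the order separates the variables: the integral over x gives the first Gamma factor, the one over
  t the second.\<close>

lemma nn_integral_powr_over_square:
  assumes s: "-1 < s" "s < (1::real)" and A: "A > 0"
  shows "(\<integral>\<^sup>+x. ennreal (indicator {0<..} x * (2 * x powr s / (A\<^sup>2 + x\<^sup>2))) \<partial>lborel)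
    = ennreal (Gamma ((s + 1) / 2) * Gamma ((1 - s) / 2) * A powr (s - 1))"
proof -
  define K where "K = (\<lambda>x t::real. ennreal (indicator {0<..} x * indicator {0<..} t * (2 * x powr s * exp (- ((A\<^sup>2 + x\<^sup>2) * t)))))"
  have "(\<integral>\<^sup>+x. ennreal (indicator {0<..} x * (2 * x powr s / (A\<^sup>2 + x\<^sup>2))) \<partial>lborel)
      = (\<integral>\<^sup>+x. (\<integral>\<^sup>+t. K x t \<partial>lborel) \<partial>lborel)"
  proof (rule nn_integral_cong)
    fix x :: real
    have pos: "A\<^sup>2 + x\<^sup>2 > 0" using A by (simp add: add_pos_nonneg)
    have "(\<integral>\<^sup>+t. K x t \<partial>lborel) = (\<integral>\<^sup>+t. ennreal (indicator {0<..} x * (2 * x powr s)) *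
        ennreal (indicator {0<..} t * (t powr (1 - 1) * exp (- ((A\<^sup>2 + x\<^sup>2) * t)))) \<partial>lborel)"
      unfolding K_def by (intro nn_integral_cong) (auto simp: indicator_def ennreal_mult[symmetric])
    also have "\<dots> = ennreal (indicator {0<..} x * (2 * x powr s)) * ennreal (Gamma 1 * (A\<^sup>2 + x\<^sup>2) powr (-1))"
      by (subst nn_integral_cmult, simp, subst nn_integral_Gamma_scaled) (use pos in auto)
    also have "\<dots> = ennreal (indicator {0<..} x * (2 * x powr s / (A\<^sup>2 + x\<^sup>2)))"
      using pos by (simp add: ennreal_mult[symmetric] powr_minus divide_inverse)
    finally show "ennreal (indicator {0<..} x * (2 * x powr s / (A\<^sup>2 + x\<^sup>2))) = (\<integral>\<^sup>+t. K x t \<partial>lborel)" by simp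
  qed
  also have "\<dots> = (\<integral>\<^sup>+t. (\<integral>\<^sup>+x. K x t \<partial>lborel) \<partial>lborel)"
    unfolding K_def by (rule lborel_pair.Fubini'[symmetric]) measurable
  also have "\<dots> = (\<integral>\<^sup>+t. ennreal (Gamma ((s + 1) / 2)) *
      ennreal (indicator {0<..} t * (t powr ((1 - s) / 2 - 1) * exp (- (A\<^sup>2 * t)))) \<partial>lborel)"
  proof (rule nn_integral_cong)
    fix t :: real
    show "(\<integral>\<^sup>+x. K x t \<partial>lborel) = ennreal (Gamma ((s + 1) / 2)) *
      ennreal (indicator {0<..} t * (t powr ((1 - s) / 2 - 1) * exp (- (A\<^sup>2 * t))))"
    proof (cases "t > 0")
      case True
      have "(\<integral>\<^sup>+x. K x t \<partial>lborel) = (\<integral>\<^sup>+x. ennreal (exp (- (A\<^sup>2 * t))) *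
          ennreal (indicator {0<..} x * (2 * x powr s * exp (- (t * x\<^sup>2)))) \<partial>lborel)"
        unfolding K_def using True
        by (intro nn_integral_cong) (auto simp: indicator_def ennreal_mult[symmetric] exp_add[symmetric] algebra_simps)
      also have "\<dots> = ennreal (exp (- (A\<^sup>2 * t))) * ennreal (Gamma ((s + 1) / 2) * t powr (- ((s + 1) / 2)))"
        by (subst nn_integral_cmult, simp, subst nn_integral_Gauss_moment) (use s True in auto)
      also have "- ((s + 1) / 2) = (1 - s) / 2 - 1" by (simp add: field_simps)
      finally show ?thesis using True s
        by (simp add: ennreal_mult[symmetric] Gamma_real_pos less_imp_le mult_ac)
    qed (simp add: K_def)
  qed
  also have "\<dots> = ennreal (Gamma ((s + 1) / 2)) * ennreal (Gamma ((1 - s) / 2) * (A\<^sup>2) powr (- ((1 - s) / 2)))"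
    by (subst nn_integral_cmult, simp, subst nn_integral_Gamma_scaled) (use s A in auto)
  also have "(A\<^sup>2) powr (- ((1 - s) / 2)) = A powr (2 * (- ((1 - s) / 2)))"
    using A by (simp only: powr_powr flip: powr_numeral)
  also have "2 * (- ((1 - s) / 2)) = s - 1" by (simp add: field_simps)
  finally show ?thesis using s
    by (simp add: ennreal_mult[symmetric] Gamma_real_pos less_imp_le mult.assoc)
qed

text \<open>The Peano kernel form of the trapezoidal error. Both integrands needed later, powers and
  exponentials, have a nonnegative second derivative.\<close>

lemma nn_integral_trapezoid:
  fixes \<Phi> \<phi> \<phi>1 \<phi>2 :: "real \<Rightarrow> real"
  assumes d: "\<And>y. y \<in> {c..c+1} \<Longrightarrow> (\<Phi> has_real_derivative \<phi> y) (at y)"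
    "\<And>y. y \<in> {c..c+1} \<Longrightarrow> (\<phi> has_real_derivative \<phi>1 y) (at y)"
    "\<And>y. y \<in> {c..c+1} \<Longrightarrow> (\<phi>1 has_real_derivative \<phi>2 y) (at y)"
    and nonneg: "\<And>y. y \<in> {c..c+1} \<Longrightarrow> \<phi>2 y \<ge> 0" and [measurable]: "\<phi>2 \<in> borel_measurable borel"
  shows "(\<integral>\<^sup>+y. ennreal ((y - c) * (c + 1 - y) / 2 * \<phi>2 y) * indicator {c..c+1} y \<partial>lborel)
    = ennreal ((\<phi> c + \<phi> (c + 1)) / 2 - (\<Phi> (c + 1) - \<Phi> c))"
    and "0 \<le> (\<phi> c + \<phi> (c + 1)) / 2 - (\<Phi> (c + 1) - \<Phi> c)"
proof -
  \<comment> \<open>Antiderivative from two integrations by parts; the kernel (y - c)(c + 1 - y)/2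
    vanishes at both ends and has second derivative -1.\<close>
  define F where "F = (\<lambda>y. (y - c) * (c + 1 - y) / 2 * \<phi>1 y - (2 * c + 1 - 2 * y) / 2 * \<phi> y - \<Phi> y)"
  have dF: "(F has_real_derivative (y - c) * (c + 1 - y) / 2 * \<phi>2 y) (at y)" if y: "y \<in> {c..c+1}" for y
    unfolding F_def by (auto intro!: derivative_eq_intros d[OF y] simp: field_simps)
  have nn: "0 \<le> (y - c) * (c + 1 - y) / 2 * \<phi>2 y" if y: "y \<in> {c..c+1}" for y
    using y nonneg[OF y] by simp
  have eq: "F (c + 1) - F c = (\<phi> c + \<phi> (c + 1)) / 2 - (\<Phi> (c + 1) - \<Phi> c)"
    unfolding F_def by (simp add: field_simps)
  show "(\<integral>\<^sup>+y. ennreal ((y - c) * (c + 1 - y) / 2 * \<phi>2 y) * indicator {c..c+1} y \<partial>lborel)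
      = ennreal ((\<phi> c + \<phi> (c + 1)) / 2 - (\<Phi> (c + 1) - \<Phi> c))"
    unfolding eq[symmetric] by (rule nn_integral_FTC_Icc[OF _ dF nn]) auto
  have "F c \<le> F (c + 1)"
  proof (rule DERIV_nonneg_imp_nondecreasing[where f = F and a = c and b = "c + 1"])
    show "\<exists>z. (F has_real_derivative z) (at y) \<and> 0 \<le> z" if "c \<le> y" "y \<le> c + 1" for y
      using that by (intro exI[of _ "(y - c) * (c + 1 - y) / 2 * \<phi>2 y"] conjI dF nn) auto
  qed simp
  then show "0 \<le> (\<phi> c + \<phi> (c + 1)) / 2 - (\<Phi> (c + 1) - \<Phi> c)" unfolding eq[symmetric] by simp
qed

text \<open>\<open>T\<close> is the sum of the trapezoidal errors of y powr (-s) / (s (s + 1)) on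
  all intervals from 0 onwards, and \<open>R\<close> is zeta(1 - s). The last equation equates two
  evaluations of the integral of x powr (s - 1) against the kernel \<open>D\<close> defined in the
  proof.\<close>

lemma functional_equation_real:
  fixes s :: real
  assumes s: "-1 < s" "s < 0"
  shows "\<exists>T R. zeta_half (of_real s) = of_real ((s - 1) * s * (s + 1) * T) \<and>
      zeta_half (of_real (1 - s)) = of_real (- s * R) \<and>
      Gamma (s + 2) * T = Gamma ((s + 1) / 2) * Gamma ((1 - s) / 2) * (2 * pi) powr (s - 1) * R"
proof -
  \<comment> \<open>The trapezoidal error of y \<mapsto> exp (-(x y)) on the interval from n to n +
    1, starting with n = 0.\<close>
  define trap where "trap = (\<lambda>n x. (exp (- (real n * x)) + exp (- ((real n + 1) * x))) / 2
      - (exp (- (real n * x)) - exp (- ((real n + 1) * x))) / x)"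
  define w where "w = (\<lambda>n y. (y - real n) * (real n + 1 - y) / 2)"
  define T where "T = (\<lambda>n. \<integral>\<^sup>+y. ennreal (w n y * y powr (- s - 2)) * indicator {real n..real n + 1} y \<partial>lborel)"
  \<comment> \<open>Closed form of \<open>T n\<close>. The interval from 0 to 1 is handled apart
    because y powr (-s - 2) is singular at 0, so the trapezoidal lemma does not apply there.\<close>
  define t where "t = (\<lambda>n. if n = 0 then 1 / (2 * s * (s - 1)) else
      ((real n powr (- s) + real (Suc n) powr (- s)) / 2 - (real (Suc n) powr (1 - s) - real n powr (1 - s)) / (1 - s)) / (s * (s + 1)))"
  define c where "c = Gamma ((s + 1) / 2) * Gamma ((1 - s) / 2)"
  have c: "c \<ge> 0" unfolding c_def using s by (simp add: Gamma_real_pos less_imp_le)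
  have G: "Gamma (s + 2) > 0" using s by (simp add: Gamma_real_pos)
  have w0: "w n y \<ge> 0" if "y \<in> {real n..real n + 1}" for n y using that unfolding w_def by simp
  have Tt0: "T 0 = ennreal (t 0) \<and> t 0 \<ge> 0"
  proof -
    have "((\<lambda>y. (y powr (- s - 1) - y powr (- s)) / 2) has_integral
        ((1 powr (- s - 1 + 1) / (- s - 1 + 1) - 1 powr (- s + 1) / (- s + 1)) / 2)) {0..1}"
      using s by (intro has_integral_divide has_integral_diff has_integral_powr_from_0) auto
    then have "((\<lambda>y. w 0 y * y powr (- s - 2)) has_integral
        ((1 powr (- s - 1 + 1) / (- s - 1 + 1) - 1 powr (- s + 1) / (- s + 1)) / 2)) {0..1}"
    proof (rule has_integral_eq[rotated])
      fix y :: real assume "y \<in> {0..1}"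
      then show "(y powr (- s - 1) - y powr (- s)) / 2 = w 0 y * y powr (- s - 2)"
      proof (cases "y = 0")
        case False
        with \<open>y \<in> {0..1}\<close> have y: "y > 0" by simp
        have "y powr (- s - 1) = y * y powr (- s - 2)" "y powr (- s) = y * y * y powr (- s - 2)"
          using y by (simp_all add: powr_diff powr_numeral power2_eq_square)
        then show ?thesis unfolding w_def by (simp add: field_simps)
      qed (simp add: w_def)
    qed
    also have "(1 powr (- s - 1 + 1) / (- s - 1 + 1) - 1 powr (- s + 1) / (- s + 1)) / 2 = t 0"
      unfolding t_def using s by (simp add: field_simps)
    finally have hi: "((\<lambda>y. w 0 y * y powr (- s - 2)) has_integral t 0) {0..1}" .
    have "t 0 \<ge> 0" unfolding t_def using s by (simp add: mult_neg_neg less_imp_le)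
    moreover have "T 0 = ennreal (t 0)"
      unfolding T_def using nn_integral_has_integral_lebesgue'[OF _ hi] w0[of _ 0] by simp
    ultimately show ?thesis by simp
  qed
  have TtS: "T n = ennreal (t n) \<and> t n \<ge> 0 \<and> of_real ((s - 1) * s * (s + 1) * t n) = trapezoid_term n (of_real s)"
    if n: "n > 0" for n
  proof -
    have rn: "real n \<ge> 1" using n by simp
    have y0: "y > 0" if "y \<in> {real n..real n + 1}" for y using rn that by auto
    \<comment> \<open>Dividing by \<open>k\<close>, which is negative here, makes the second
      derivative exactly y powr (-s - 2) and thus nonnegative.\<close>
    define k where "k = s * (s + 1)"
    have k: "k \<noteq> 0" unfolding k_def using s by simp
    have d: "((\<lambda>y. y powr (1 - s) / (1 - s) / k) has_real_derivative y powr (- s) / k) (at y)"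
      "((\<lambda>y. y powr (- s) / k) has_real_derivative - s * y powr (- s - 1) / k) (at y)"
      "((\<lambda>y. - s * y powr (- s - 1) / k) has_real_derivative y powr (- s - 2)) (at y)"
      if "y \<in> {real n..real n + 1}" for y
    proof -
      show "((\<lambda>y. y powr (1 - s) / (1 - s) / k) has_real_derivative y powr (- s) / k) (at y)"
        using y0[OF that] s k by (auto intro!: derivative_eq_intros)
      show "((\<lambda>y. y powr (- s) / k) has_real_derivative - s * y powr (- s - 1) / k) (at y)"
        using y0[OF that] s k by (auto intro!: derivative_eq_intros)
      have "((\<lambda>y. - s * y powr (- s - 1) / k) has_real_derivative - s * ((- s - 1) * y powr (- s - 1 - 1)) / k) (at y)"
        using y0[OF that] s k by (auto intro!: derivative_eq_intros)
      also have "- s * ((- s - 1) * y powr (- s - 1 - 1)) / k = y powr (- s - 2)"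
      proof -
        have "- s * ((- s - 1) * y powr (- s - 1 - 1)) = k * y powr (- s - 2)"
          unfolding k_def by (simp add: algebra_simps)
        then show ?thesis using k by simp
      qed
      finally show "((\<lambda>y. - s * y powr (- s - 1) / k) has_real_derivative y powr (- s - 2)) (at y)" .
    qed
    note tz = nn_integral_trapezoid[OF d]
    have eq: "(real n powr (- s) / k + (real n + 1) powr (- s) / k) / 2
       - ((real n + 1) powr (1 - s) / (1 - s) / k - real n powr (1 - s) / (1 - s) / k) = t n"
      unfolding t_def k_def[symmetric] using n by (simp add: add_divide_distrib diff_divide_distrib add.commute)
    have Tn: "T n = ennreal (t n)"
      unfolding T_def w_def eq[symmetric] by (rule tz(1)) auto
    have tn0: "t n \<ge> 0" unfolding eq[symmetric] by (rule tz(2)) auto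
    have "(s - 1) * s * (s + 1) * t n = (s - 1) * (k * t n)" unfolding k_def by simp
    also have "k * t n = (real n powr (- s) + real (Suc n) powr (- s)) / 2 - (real (Suc n) powr (1 - s) - real n powr (1 - s)) / (1 - s)"
      unfolding t_def k_def[symmetric] using n k by simp
    also have "(s - 1) * \<dots> = (s - 1) * (real n powr (- s) + real (Suc n) powr (- s)) / 2 + (real (Suc n) powr (1 - s) - real n powr (1 - s))"
      using s by (simp add: field_simps)
    finally have e: "(s - 1) * s * (s + 1) * t n = (s - 1) * (real n powr (- s) + real (Suc n) powr (- s)) / 2 + (real (Suc n) powr (1 - s) - real n powr (1 - s))" .
    have pw: "(of_nat m :: complex) powr of_real x = of_real (real m powr x)" for m x
      using powr_of_real[of "real m" x] by simp
    have pw1: "(of_nat m :: complex) powr (1 - of_real s) = of_real (real m powr (1 - s))" for m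
      using pw[of m "1 - s"] by simp
    have pw2: "(of_nat m :: complex) powr (- of_real s) = of_real (real m powr (- s))" for m
      using pw[of m "- s"] by simp
    have "of_real ((s - 1) * s * (s + 1) * t n) = trapezoid_term n (of_real s)"
      unfolding e trapezoid_term_def pw1 pw2 by simp
    then show ?thesis using Tn tn0 by simp
  qed
  have tsums: "(\<lambda>n. of_real ((s - 1) * s * (s + 1) * t n)) sums zeta_half (of_real s)"
  proof -
    have "(\<lambda>n. of_real ((s - 1) * s * (s + 1) * t (Suc n))) sums (zeta_half (of_real s) - (of_real s + 1) / 2)"
      using zeta_half_sums[of "of_real s"] s TtS by simp
    \<comment> \<open>The interval from 0 to 1 supplies precisely the summand (s + 1)/2 in
      \<open>zeta_half\<close>.\<close>
    moreover have "of_real ((s - 1) * s * (s + 1) * t 0) = (of_real s + 1) / (2 :: complex)"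
    proof -
      have "(s - 1) * s * (s + 1) * t 0 = (s + 1) / 2" unfolding t_def using s by simp
      then have "of_real ((s - 1) * s * (s + 1) * t 0) = (of_real ((s + 1) / 2) :: complex)" by (rule arg_cong)
      also have "\<dots> = (of_real s + 1) / 2" by simp
      finally show ?thesis .
    qed
    moreover define f where "f = (\<lambda>n. complex_of_real ((s - 1) * s * (s + 1) * t n))"
    ultimately have fS: "(\<lambda>n. f (Suc n)) sums (zeta_half (of_real s) - (of_real s + 1) / 2)" and f0: "f 0 = (of_real s + 1) / 2"
      by simp_all
    have "f sums (zeta_half (of_real s) - (of_real s + 1) / 2 + f 0)" by (rule iffD1[OF sums_Suc_iff fS])
    then have "f sums zeta_half (of_real s)" unfolding f0 diff_add_cancel .
    then show ?thesis unfolding f_def .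
  qed
  define k where "k = (s - 1) * s * (s + 1)"
  have k: "k \<noteq> 0" unfolding k_def using s by auto
  have "summable (\<lambda>n. complex_of_real (k * t n))" using tsums unfolding k_def by (rule sums_summable)
  then have "summable (\<lambda>n. k * t n)" by (simp only: summable_of_real_iff)
  then have "summable t" using k by (simp add: summable_cmult_iff)
  then obtain S where S: "t sums S" by (auto simp: summable_def)
  then have "(\<lambda>n. complex_of_real (k * t n)) sums of_real (k * S)"
    by (intro sums_of_real sums_mult)
  then have zs: "zeta_half (of_real s) = of_real (k * S)"
    using tsums sums_unique2 unfolding k_def by blast
  have t0: "t n \<ge> 0" for n using Tt0 TtS by (cases n) auto
  have Tt: "T n = ennreal (t n)" for n using Tt0 TtS by (cases n) auto
  have "summable (\<lambda>n. real (Suc n) powr (s - 1))" using s by (intro summable_Suc_powr) auto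
  then obtain R where R: "(\<lambda>n. real (Suc n) powr (s - 1)) sums R" by (auto simp: summable_def)
  have "(\<lambda>n. complex_of_real (real (Suc n) powr (s - 1))) sums of_real R" using R by (rule sums_of_real)
  moreover have "complex_of_real (real (Suc n) powr (s - 1)) = of_nat (Suc n) powr (- of_real (1 - s))" for n
    using powr_of_real[of "real (Suc n)" "s - 1"] by simp
  ultimately have "of_real R = zeta_half (of_real (1 - s)) / (of_real (1 - s) - 1)"
    using dirichlet_sums_zeta_half[of "of_real (1 - s)"] s sums_unique2 by simp
  then have zR: "zeta_half (of_real (1 - s)) = of_real (- s * R)"
    using s by (simp add: field_simps)
  have trap: "(\<integral>\<^sup>+y. ennreal (w n y * (x\<^sup>2 * exp (- (x * y)))) * indicator {real n..real n + 1} y \<partial>lborel) = ennreal (trap n x)"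
    "0 \<le> trap n x" if x: "x > 0" for n x
  proof -
    have d: "((\<lambda>y. - exp (- (x * y)) / x) has_real_derivative exp (- (x * y))) (at y)"
      "((\<lambda>y. exp (- (x * y))) has_real_derivative - x * exp (- (x * y))) (at y)"
      "((\<lambda>y. - x * exp (- (x * y))) has_real_derivative x\<^sup>2 * exp (- (x * y))) (at y)" for y
      using x by (auto intro!: derivative_eq_intros simp: power2_eq_square)
    note tz = nn_integral_trapezoid[OF d, of "real n"]
    have eq: "(exp (- (x * real n)) + exp (- (x * (real n + 1)))) / 2 - (- exp (- (x * (real n + 1))) / x - - exp (- (x * real n)) / x) = trap n x"
      unfolding trap_def by (simp add: mult.commute diff_divide_distrib)
    show "(\<integral>\<^sup>+y. ennreal (w n y * (x\<^sup>2 * exp (- (x * y)))) * indicator {real n..real n + 1} y \<partial>lborel) = ennreal (trap n x)"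
      unfolding w_def eq[symmetric] by (rule tz(1)) auto
    show "0 \<le> trap n x" unfolding eq[symmetric] by (rule tz(2)) auto
  qed
  have s2: "s + 2 - 1 = s + 1" by simp
  have Lx: "(\<integral>\<^sup>+x. ennreal (indicator {0<..} x * (x powr (s - 1) * trap n x)) \<partial>lborel) = ennreal (Gamma (s + 2) * t n)" for n
  proof -
    \<comment> \<open>Integrating \<open>K\<close> over y first gives x powr (s - 1) times
      \<open>trap\<close>; integrating over x first gives Gamma (s + 2) times y powr (-s -
      2).\<close>
    define K where "K = (\<lambda>x y::real. ennreal (indicator {0<..} x * indicator {real n..real n + 1} y * (w n y * (x powr (s + 1) * exp (- (x * y))))))"
    have "(\<integral>\<^sup>+x. ennreal (indicator {0<..} x * (x powr (s - 1) * trap n x)) \<partial>lborel) = (\<integral>\<^sup>+x. (\<integral>\<^sup>+y. K x y \<partial>lborel) \<partial>lborel)"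
    proof (rule nn_integral_cong)
      fix x :: real
      show "ennreal (indicator {0<..} x * (x powr (s - 1) * trap n x)) = (\<integral>\<^sup>+y. K x y \<partial>lborel)"
      proof (cases "x > 0")
        case True
        have "x powr (s + 1) = x powr (s - 1) * x\<^sup>2"
        proof -
          have "x powr ((s - 1) + 2) = x powr (s - 1) * x powr 2" by (rule powr_add)
          then show ?thesis using True by (simp add: powr_numeral add.commute)
        qed
        then have "K x y = ennreal (x powr (s - 1)) * (ennreal (w n y * (x\<^sup>2 * exp (- (x * y)))) * indicator {real n..real n + 1} y)" for y
          unfolding K_def using True w0[of y n] by (auto simp: indicator_def ennreal_mult[symmetric] mult_ac)
        then have "(\<integral>\<^sup>+y. K x y \<partial>lborel) = ennreal (x powr (s - 1)) * ennreal (trap n x)"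
          unfolding trap(1)[OF True, symmetric] by (simp only:) (intro nn_integral_cmult, auto simp: w_def)
        then show ?thesis using True trap(2)[OF True] by (simp add: ennreal_mult[symmetric])
      qed (simp add: K_def)
    qed
    also have "\<dots> = (\<integral>\<^sup>+y. (\<integral>\<^sup>+x. K x y \<partial>lborel) \<partial>lborel)"
      unfolding K_def w_def by (rule lborel_pair.Fubini'[symmetric]) measurable
    also have "\<dots> = (\<integral>\<^sup>+y. ennreal (Gamma (s + 2)) * (ennreal (w n y * y powr (- s - 2)) * indicator {real n..real n + 1} y) \<partial>lborel)"
    proof (rule nn_integral_cong)
      fix y :: real
      show "(\<integral>\<^sup>+x. K x y \<partial>lborel) = ennreal (Gamma (s + 2)) * (ennreal (w n y * y powr (- s - 2)) * indicator {real n..real n + 1} y)"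
      \<comment> \<open>The Gamma integral diverges at y = 0, which occurs only for n = 0; there the
        kernel \<open>w\<close> vanishes.\<close>
      proof (cases "y \<in> {real n..real n + 1} \<and> y > 0")
        case True
        have "(\<integral>\<^sup>+x. K x y \<partial>lborel) = (\<integral>\<^sup>+x. ennreal (w n y) * ennreal (indicator {0<..} x * (x powr ((s + 2) - 1) * exp (- (y * x)))) \<partial>lborel)"
          unfolding K_def s2 using True w0[of y n]
          by (intro nn_integral_cong) (auto simp: indicator_def ennreal_mult[symmetric] mult_ac)
        also have "\<dots> = ennreal (w n y) * ennreal (Gamma (s + 2) * y powr (- (s + 2)))"
          by (subst nn_integral_cmult, simp, subst nn_integral_Gamma_scaled) (use s True in auto)
        finally show ?thesis using True w0[of y n] G
          by (simp add: ennreal_mult[symmetric] less_imp_le mult_ac)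
      next
        case False
        then have "w n y = 0 \<or> y \<notin> {real n..real n + 1}" unfolding w_def by auto
        then show ?thesis unfolding K_def by auto
      qed
    qed
    also have "\<dots> = ennreal (Gamma (s + 2)) * T n"
      unfolding T_def by (intro nn_integral_cmult) (auto simp: w_def)
    finally show ?thesis unfolding Tt using G t0[of n] by (simp add: ennreal_mult less_imp_le)
  qed
  define D where "D = (\<lambda>x::real. (1 + exp (-x)) / (1 - exp (-x)) / 2 - 1 / x)"
  have trapD: "(\<lambda>n. trap n x) sums D x" if x: "x > 0" for x
  proof -
    define q where "q = exp (-x)"
    have q: "0 < q" "q < 1" unfolding q_def using x by auto
    have qn: "exp (- (real n * x)) = q ^ n" for n
      unfolding q_def by (simp flip: exp_of_nat_mult)
    have "(\<lambda>n. ((1 + q) / 2 - (1 - q) / x) * q ^ n) sums (((1 + q) / 2 - (1 - q) / x) * (1 / (1 - q)))"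
      using q by (intro sums_mult geometric_sums) auto
    moreover have "((1 + q) / 2 - (1 - q) / x) * q ^ n = trap n x" for n
      unfolding trap_def qn using qn[of "Suc n"] by (simp add: algebra_simps diff_divide_distrib add_divide_distrib)
    moreover have "((1 + q) / 2 - (1 - q) / x) * (1 / (1 - q)) = D x"
      unfolding D_def q_def[symmetric] using q x by (simp add: field_simps)
    ultimately show ?thesis by simp
  qed
  \<comment> \<open>First evaluation: \<open>D\<close> is a geometric series of trapezoidal
    errors.\<close>
  have "ennreal (Gamma (s + 2) * S) = (\<Sum>n. ennreal (Gamma (s + 2) * t n))"
    using t0 G by (intro suminf_ennreal_eq[symmetric] sums_mult S) auto
  also have "\<dots> = (\<Sum>n. \<integral>\<^sup>+x. ennreal (indicator {0<..} x * (x powr (s - 1) * trap n x)) \<partial>lborel)"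
    unfolding Lx ..
  also have "\<dots> = (\<integral>\<^sup>+x. (\<Sum>n. ennreal (indicator {0<..} x * (x powr (s - 1) * trap n x))) \<partial>lborel)"
    by (rule nn_integral_suminf[symmetric]) (simp add: trap_def)
  also have "\<dots> = (\<integral>\<^sup>+x. ennreal (indicator {0<..} x * (x powr (s - 1) * D x)) \<partial>lborel)"
  proof (rule nn_integral_cong)
    fix x :: real
    show "(\<Sum>n. ennreal (indicator {0<..} x * (x powr (s - 1) * trap n x))) = ennreal (indicator {0<..} x * (x powr (s - 1) * D x))"
    proof (cases "x > 0")
      case True
      then show ?thesis using trap(2)[OF True] trapD[OF True]
        by (intro suminf_ennreal_eq sums_mult) auto
    qed simp
  qed
  \<comment> \<open>Second evaluation: \<open>D\<close> as the partial fraction series with poles at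
    multiples of 2 pi i.\<close>
  also have "\<dots> = (\<integral>\<^sup>+x. (\<Sum>k. ennreal (indicator {0<..} x * (2 * x powr s / ((2 * pi * real (Suc k))\<^sup>2 + x\<^sup>2)))) \<partial>lborel)"
  proof (rule nn_integral_cong)
    fix x :: real
    show "ennreal (indicator {0<..} x * (x powr (s - 1) * D x)) = (\<Sum>k. ennreal (indicator {0<..} x * (2 * x powr s / ((2 * pi * real (Suc k))\<^sup>2 + x\<^sup>2))))"
    proof (cases "x > 0")
      case True
      have xs: "x powr s = x powr (s - 1) * x" using True by (simp add: powr_diff)
      have "(\<lambda>k. x powr (s - 1) * (2 * x / (4 * pi\<^sup>2 * (real (Suc k))\<^sup>2 + x\<^sup>2))) sums (x powr (s - 1) * D x)"
        unfolding D_def by (intro sums_mult coth_partial_fractions True)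
      moreover have "x powr (s - 1) * (2 * x / (4 * pi\<^sup>2 * (real (Suc k))\<^sup>2 + x\<^sup>2)) = 2 * x powr s / ((2 * pi * real (Suc k))\<^sup>2 + x\<^sup>2)" for k
        unfolding xs by (simp add: power_mult_distrib)
      ultimately have "(\<lambda>k. 2 * x powr s / ((2 * pi * real (Suc k))\<^sup>2 + x\<^sup>2)) sums (x powr (s - 1) * D x)" by simp
      then have "(\<Sum>k. ennreal (2 * x powr s / ((2 * pi * real (Suc k))\<^sup>2 + x\<^sup>2))) = ennreal (x powr (s - 1) * D x)"
        by (intro suminf_ennreal_eq) (auto intro!: divide_nonneg_nonneg)
      then show ?thesis using True by simp
    qed simp
  qed
  also have "\<dots> = (\<Sum>k. \<integral>\<^sup>+x. ennreal (indicator {0<..} x * (2 * x powr s / ((2 * pi * real (Suc k))\<^sup>2 + x\<^sup>2))) \<partial>lborel)"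
    by (rule nn_integral_suminf) measurable
  also have "\<dots> = (\<Sum>k. ennreal (c * (2 * pi) powr (s - 1) * real (Suc k) powr (s - 1)))"
  proof (intro suminf_cong)
    fix k
    have "(2 * pi * real (Suc k)) powr (s - 1) = (2 * pi) powr (s - 1) * real (Suc k) powr (s - 1)"
      by (rule powr_mult)
    then show "(\<integral>\<^sup>+x. ennreal (indicator {0<..} x * (2 * x powr s / ((2 * pi * real (Suc k))\<^sup>2 + x\<^sup>2))) \<partial>lborel)
        = ennreal (c * (2 * pi) powr (s - 1) * real (Suc k) powr (s - 1))"
      using nn_integral_powr_over_square[of s "2 * pi * real (Suc k)"] s unfolding c_def by (simp add: mult_ac)
  qed
  also have "\<dots> = ennreal (c * (2 * pi) powr (s - 1) * R)"
    using c by (intro suminf_ennreal_eq sums_mult R) auto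
  finally have e: "ennreal (Gamma (s + 2) * S) = ennreal (c * (2 * pi) powr (s - 1) * R)" .
  have "S \<ge> 0" using S t0 by (metis sums_unique suminf_nonneg sums_summable)
  moreover have "R \<ge> 0" using R by (metis (no_types, lifting) powr_ge_zero sums_unique suminf_nonneg sums_summable)
  ultimately have "Gamma (s + 2) * S = c * (2 * pi) powr (s - 1) * R"
    using e c G by (subst (asm) ennreal_inj) auto
  then show ?thesis using zs zR unfolding k_def c_def by (intro exI[of _ S] exI[of _ R]) simp
qed

section \<open>Zeta as a global function\<close>

lemma Gamma_reflection_real:
  fixes s :: real
  shows "Gamma s * Gamma (1 - s) = pi / sin (pi * s)"
proof -
  have "complex_of_real (Gamma s * Gamma (1 - s)) = of_real (pi / sin (pi * s))"
    using Gamma_reflection_complex[of "of_real s"]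
    by (simp flip: Gamma_complex_of_real sin_of_real)
  then show ?thesis by (simp only: of_real_eq_iff)
qed

text \<open>The right-hand side of the functional equation times s - 1; the last factor
  \<open>zeta_half (1 - s) / (- s)\<close> stands for zeta(1 - s).\<close>

definition zeta_reflected :: "complex \<Rightarrow> complex" where
  "zeta_reflected s = (s - 1) * (2 * of_real (2 * pi) powr (s - 1) * sin (of_real pi * s / 2) * Gamma (1 - s)
     * (zeta_half (1 - s) / (- s)))"

text \<open>Reflection at (s + 1)/2 and at s expresses the product of the two half-argument Gamma
  values through Gamma s and sin (pi s / 2). Since Gamma (s + 2) = (s + 1) s Gamma s, the factor
  Gamma s cancels and the classical form appears.\<close>

lemma zeta_half_eq_reflected_real:
  assumes s: "-1 < s" "s < (0::real)"
  shows "zeta_half (of_real s) = zeta_reflected (of_real s)"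
proof -
  obtain T R where T: "zeta_half (of_real s) = of_real ((s - 1) * s * (s + 1) * T)"
    and R: "zeta_half (of_real (1 - s)) = of_real (- s * R)"
    and e: "Gamma (s + 2) * T = Gamma ((s + 1) / 2) * Gamma ((1 - s) / 2) * (2 * pi) powr (s - 1) * R"
    using functional_equation_real[OF s] by blast
  define P where "P = (2 * pi) powr (s - 1)"
  have ni: "s \<notin> \<int>\<^sub>\<le>\<^sub>0" "s + 1 \<notin> \<int>\<^sub>\<le>\<^sub>0"
    using s by (auto elim!: nonpos_Ints_cases)
  have G2: "Gamma (s + 2) = (s + 1) * (s * Gamma s)"
    using Gamma_plus1[OF ni(1)] Gamma_plus1[OF ni(2)] by (simp add: add.assoc)
  have G0: "Gamma s \<noteq> 0" using ni by (simp add: Gamma_eq_zero_iff)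
  have sn: "sin (pi * s / 2) \<noteq> 0"
  proof -
    have "pi * (- s / 2) < pi * 1" using s by (intro mult_strict_left_mono) auto
    then have "sin (- (pi * s / 2)) > 0" using s by (intro sin_gt_zero) (auto simp: mult_pos_neg)
    then show ?thesis by simp
  qed
  have c: "Gamma ((s + 1) / 2) * Gamma ((1 - s) / 2) = Gamma s * (2 * sin (pi * s / 2) * Gamma (1 - s))"
  proof -
    have h: "1 - (s + 1) / 2 = (1 - s) / 2" by (simp add: field_simps)
    have "Gamma ((s + 1) / 2) * Gamma ((1 - s) / 2) = pi / sin (pi * ((s + 1) / 2))"
      using Gamma_reflection_real[of "(s + 1) / 2"] unfolding h .
    also have "pi * ((s + 1) / 2) = pi * s / 2 + pi / 2" by (simp add: field_simps)
    also have "sin (pi * s / 2 + pi / 2) = cos (pi * s / 2)" by (simp add: sin_add)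
    finally have 1: "Gamma ((s + 1) / 2) * Gamma ((1 - s) / 2) = pi / cos (pi * s / 2)" .
    have "sin (pi * s) = 2 * sin (pi * s / 2) * cos (pi * s / 2)"
      using sin_double[of "pi * s / 2"] by simp
    then have "Gamma s * Gamma (1 - s) * (2 * sin (pi * s / 2)) = pi / cos (pi * s / 2)"
      unfolding Gamma_reflection_real using sn by simp
    then show ?thesis unfolding 1 by (simp add: mult_ac)
  qed
  have "Gamma s * (s * (s + 1) * T) = Gamma s * (2 * sin (pi * s / 2) * Gamma (1 - s) * P * R)"
    using e unfolding G2 c P_def[symmetric] by (simp add: mult_ac)
  then have st: "s * (s + 1) * T = 2 * P * sin (pi * s / 2) * Gamma (1 - s) * R" using G0 by simp
  have "zeta_half (of_real s) = of_real ((s - 1) * (s * (s + 1) * T))" unfolding T by (simp add: mult.assoc)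
  also have "\<dots> = of_real ((s - 1) * (2 * P * sin (pi * s / 2) * Gamma (1 - s) * R))" unfolding st ..
  also have "\<dots> = zeta_reflected (of_real s)"
  proof -
    have "of_real (2 * pi) powr (of_real s - 1 :: complex) = of_real P"
      unfolding P_def using powr_of_real[of "2 * pi" "s - 1"] by simp
    moreover have "sin (of_real pi * of_real s / 2 :: complex) = of_real (sin (pi * s / 2))"
      by (simp flip: sin_of_real)
    moreover have "Gamma (1 - of_real s :: complex) = of_real (Gamma (1 - s))"
      by (simp flip: Gamma_complex_of_real)
    moreover have "zeta_half (1 - of_real s) / - of_real s = of_real R"
      using R s by simp
    ultimately show ?thesis unfolding zeta_reflected_def by simp
  qed
  finally show ?thesis .
qed

lemma holomorphic_zeta_reflected: "zeta_reflected holomorphic_on {s. Re s < 0}"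
proof -
  have "(\<lambda>s. zeta_half (1 - s)) holomorphic_on {s. Re s < 0}"
    by (rule holomorphic_on_compose_gen[OF _ holomorphic_zeta_half, unfolded o_def])
       (auto intro!: holomorphic_intros)
  then show ?thesis unfolding zeta_reflected_def
    by (intro holomorphic_intros) (auto elim!: nonpos_Ints_cases simp: complex_eq_iff)
qed

lemma zeta_half_eq_reflected:
  assumes "-1 < Re s" "Re s < 0"
  shows "zeta_half s = zeta_reflected s"
proof -
  define S where "S = {s. Re s > -1} \<inter> {s. Re s < 0}"
  define U where "U = complex_of_real ` {-1<..<0}"
  have "zeta_half s - zeta_reflected s = 0"
  proof (rule analytic_continuation[of "\<lambda>s. zeta_half s - zeta_reflected s" S U "of_real (-1/2)"])
    show "(\<lambda>s. zeta_half s - zeta_reflected s) holomorphic_on S"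
      using holomorphic_on_subset[OF holomorphic_zeta_half, of S] holomorphic_on_subset[OF holomorphic_zeta_reflected, of S]
      unfolding S_def by (intro holomorphic_intros) auto
    show "open S" unfolding S_def by (intro open_Int open_halfspace_Re_gt open_halfspace_Re_lt)
    show "connected S" unfolding S_def
      by (intro convex_connected convex_Int convex_halfspace_Re_gt convex_halfspace_Re_lt)
    \<comment> \<open>Any point of the real segment would do for the identity theorem.\<close>
    show "complex_of_real (-1/2) islimpt U"
      unfolding islimpt_approachable
    proof (intro allI impI)
      fix e :: real assume e: "e > 0"
      define x where "x = -1/2 + min (e / 2) (1 / 4)"
      have "x \<in> {-1<..<0}" "x \<noteq> -1/2" "dist x (-1/2) < e"
        unfolding x_def dist_real_def using e by auto
      then show "\<exists>x'\<in>U. x' \<noteq> complex_of_real (-1/2) \<and> dist x' (complex_of_real (-1/2)) < e"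
        unfolding U_def by (intro bexI[of _ "of_real x"]) (auto simp only: dist_of_real of_real_eq_iff imageI)
    qed
    show "zeta_half z - zeta_reflected z = 0" if "z \<in> U" for z
      using that zeta_half_eq_reflected_real unfolding U_def by auto
  qed (use assms in \<open>auto simp: U_def S_def\<close>)
  then show ?thesis by simp
qed

text \<open>\<open>(s - 1) \<zeta>(s)\<close>, entire because the two branches agree for \<open>-1 < Re s < 0\<close>.\<close>
definition zeta_num :: "complex \<Rightarrow> complex" where
  "zeta_num s = (if Re s > -1 then zeta_half s else zeta_reflected s)"

lemma zeta_num_reflected: "Re s < 0 \<Longrightarrow> zeta_num s = zeta_reflected s"
  unfolding zeta_num_def using zeta_half_eq_reflected by auto

lemma holomorphic_zeta_num: "zeta_num holomorphic_on A"
proof -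
  have "zeta_num holomorphic_on {s. Re s > -1}"
    by (rule holomorphic_transform[OF holomorphic_zeta_half]) (simp add: zeta_num_def)
  moreover have "zeta_num holomorphic_on {s. Re s < 0}"
    by (rule holomorphic_transform[OF holomorphic_zeta_reflected]) (simp add: zeta_num_reflected)
  ultimately have "zeta_num holomorphic_on ({s. Re s > -1} \<union> {s. Re s < 0})"
    by (rule holomorphic_on_Un) (auto intro: open_halfspace_Re_gt open_halfspace_Re_lt)
  also have "{s. Re s > -1} \<union> {s. Re s < 0} = UNIV" by auto
  finally show ?thesis by (rule holomorphic_on_subset) auto
qed

lemma zeta_num_1: "zeta_num 1 = 1"
  by (simp add: zeta_num_def zeta_half_1)

text \<open>\<open>zeta_num\<close> witnesses that the continuation exists; uniqueness holds because
  the plane without 1 is connected and contains the half plane of the Dirichlet series.\<close>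

lemma zeta_eq: "zeta s = (if s = 1 then 0 else zeta_num s / (s - 1))"
proof -
  define f0 where "f0 = (\<lambda>s. if s = 1 then 0 else zeta_num s / (s - 1))"
  have eqs: "1 / of_nat (Suc n) powr s = of_nat (Suc n) powr (- s)" for n and s :: complex
    by (simp add: powr_minus_divide)
  have "zeta = f0"
    unfolding zeta_def
  proof (rule the_equality)
    have "(\<lambda>s. zeta_num s / (s - 1)) holomorphic_on (- {1})"
      by (intro holomorphic_intros holomorphic_zeta_num) auto
    then have "f0 holomorphic_on (- {1})"
      by (rule holomorphic_transform) (auto simp: f0_def)
    moreover have "(\<lambda>n. 1 / of_nat (Suc n) powr s) sums f0 s" if "Re s > 1" for s
      using that dirichlet_sums_zeta_half[OF that] unfolding eqs f0_def zeta_num_def by auto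
    ultimately show "f0 holomorphic_on - {1} \<and> f0 1 = 0 \<and> (\<forall>s. 1 < Re s \<longrightarrow> (\<lambda>n. 1 / of_nat (Suc n) powr s) sums f0 s)"
      by (simp add: f0_def del: of_nat_Suc)
    fix g assume g: "g holomorphic_on - {1} \<and> g 1 = 0 \<and> (\<forall>s. 1 < Re s \<longrightarrow> (\<lambda>n. 1 / of_nat (Suc n) powr s) sums g s)"
    show "g = f0"
    proof
      fix s
      show "g s = f0 s"
      proof (cases "s = 1")
        case False
        show ?thesis
        proof (rule analytic_continuation_open[of "{s. Re s > 1}" "- {1}" g f0])
          show "{s. Re s > 1} \<noteq> {}" by (auto intro!: exI[of _ 2])
          show "connected (- {1 :: complex})" by (rule connected_punctured_universe) simp
          show "g z = f0 z" if "z \<in> {s. Re s > 1}" for z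
            using that g \<open>\<And>s. Re s > 1 \<Longrightarrow> (\<lambda>n. 1 / of_nat (Suc n) powr s) sums f0 s\<close> sums_unique2
            by (metis mem_Collect_eq)
        qed (use g \<open>f0 holomorphic_on (- {1})\<close> False in \<open>auto intro: open_halfspace_Re_gt\<close>)
      qed (use g f0_def in auto)
    qed
  qed
  then show ?thesis unfolding f0_def by (rule fun_cong)
qed

lemma zeta_sums: "Re s > 1 \<Longrightarrow> (\<lambda>n. of_nat (Suc n) powr (- s)) sums zeta s"
  using dirichlet_sums_zeta_half[of s] unfolding zeta_eq zeta_num_def by auto

lemma zeta_functional_equation:
  assumes "Re s > 1"
  shows "zeta (1 - s) = 2 * of_real (2 * pi) powr (- s) * cos (of_real pi * s / 2) * Gamma s * zeta s"
proof -
  have s: "s \<noteq> 0" "s \<noteq> 1" using assms by auto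
  have "zeta (1 - s) = zeta_reflected (1 - s) / (1 - s - 1)"
    using assms s zeta_num_reflected[of "1 - s"] unfolding zeta_eq by simp
  also have "\<dots> = 2 * of_real (2 * pi) powr (- s) * sin (of_real pi * (1 - s) / 2) * Gamma s * (zeta_half s / (s - 1))"
    unfolding zeta_reflected_def using s by simp
  also have "sin (of_real pi * (1 - s) / 2) = cos (of_real pi * s / 2)"
    unfolding cos_sin_eq by (simp add: field_simps)
  also have "zeta_half s / (s - 1) = zeta s" using assms s unfolding zeta_eq zeta_num_def by simp
  finally show ?thesis .
qed

section \<open>Growth of zeta and its derivatives\<close>

text \<open>Holds factor by factor in Euler's limit formula, because norm (z + i) is at least Re z +
  i and the numerator depends on Re z only in norm.\<close>

lemma norm_Gamma_le:
  assumes z: "Re z > 0"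
  shows "norm (Gamma z) \<le> Gamma (Re z)"
proof (rule LIMSEQ_le)
  show "(\<lambda>n. norm (Gamma_series z n)) \<longlonglongrightarrow> norm (Gamma z)" by (intro tendsto_norm Gamma_series_LIMSEQ)
  show "Gamma_series (Re z) \<longlonglongrightarrow> Gamma (Re z)" by (rule Gamma_series_LIMSEQ)
  have "norm (Gamma_series z n) \<le> Gamma_series (Re z) n" for n
  proof -
    have pos: "0 < pochhammer (Re z) (n + 1)" using z by (intro pochhammer_pos)
    have "pochhammer (Re z) (n + 1) \<le> norm (pochhammer z (n + 1))"
      unfolding pochhammer_prod prod_norm[symmetric]
    proof (intro prod_mono conjI)
      fix i
      show "Re z + real i \<le> norm (z + of_nat i)" using complex_Re_le_cmod[of "z + of_nat i"] by simp
    qed (use z in auto)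
    then show ?thesis unfolding Gamma_series_def norm_divide norm_mult
      using pos by (intro frac_le) (auto simp: norm_mult)
  qed
  then show "\<exists>N. \<forall>n\<ge>N. norm (Gamma_series z n) \<le> Gamma_series (Re z) n" by blast
qed

text \<open>From 3/2 on Gamma increases, so it is at most m!, hence at most m^m, for the integer m
  chosen above x. Then ln m \<le> 2 sqrt m produces the exponent 3/2.\<close>

lemma Gamma_le_exp:
  assumes x: "x \<ge> (3/2::real)"
  shows "Gamma x \<le> exp (2 * (x + 2) powr (3/2))"
proof -
  define m where "m = nat \<lceil>x\<rceil> + 1"
  have m: "x < real m" "real m \<le> x + 2" "m \<ge> 1" unfolding m_def using x by linarith+
  have m0: "real m > 0" using m by simp
  have "Gamma x \<le> Gamma (1 + real m)" using Gamma_real_strict_mono[of x "1 + real m"] x m by simp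
  also have "\<dots> = fact m" by (rule Gamma_fact)
  also have "\<dots> \<le> real m ^ m" using fact_le_power[of m, where 'a = real] by simp
  also have "\<dots> = exp (real m * ln (real m))"
    using m0 by (simp add: exp_of_nat_mult)
  also have "\<dots> \<le> exp (2 * real m powr (3/2))"
  proof -
    have "ln (sqrt (real m)) \<le> sqrt (real m)" using ln_le_minus_one[of "sqrt (real m)"] m0 by simp
    then have "ln (real m) \<le> 2 * sqrt (real m)" using m0 by (simp add: ln_sqrt)
    then have "real m * ln (real m) \<le> real m * (2 * sqrt (real m))" by (intro mult_left_mono) auto
    also have "\<dots> = 2 * real m powr (3/2)"
    proof -
      have "real m powr (1 + 1/2) = real m powr 1 * real m powr (1/2)" by (rule powr_add)
      then show ?thesis using m0 by (simp add: powr_half_sqrt)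
    qed
    finally show ?thesis by simp
  qed
  also have "\<dots> \<le> exp (2 * (x + 2) powr (3/2))"
    using m m0 by (simp add: powr_mono2)
  finally show ?thesis .
qed

lemma order_three_halvesI:
  assumes "\<And>z. norm (f z) \<le> exp (A * (1 + norm z) powr (3/2))"
  shows "order_three_halves f"
  using assms unfolding order_three_halves_def by blast

lemma le_powr_three_halves: "x \<ge> 1 \<Longrightarrow> x \<le> x powr (3/2)" for x :: real
  using powr_mono[of 1 "3/2" x] by simp

lemma order_three_halves_mult:
  assumes "order_three_halves f" "order_three_halves g"
  shows "order_three_halves (\<lambda>z. f z * g z)"
proof -
  obtain A B where A: "\<And>z. norm (f z) \<le> exp (A * (1 + norm z) powr (3/2))"
    and B: "\<And>z. norm (g z) \<le> exp (B * (1 + norm z) powr (3/2))"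
    using assms unfolding order_three_halves_def by blast
  have "norm (f z * g z) \<le> exp ((A + B) * (1 + norm z) powr (3/2))" for z
    unfolding norm_mult distrib_right exp_add using A B by (intro mult_mono) auto
  then show ?thesis by (rule order_three_halvesI)
qed

lemma order_three_halves_add:
  assumes "order_three_halves f" "order_three_halves g"
  shows "order_three_halves (\<lambda>z. f z + g z)"
proof -
  obtain A B where A: "\<And>z. norm (f z) \<le> exp (A * (1 + norm z) powr (3/2))"
    and B: "\<And>z. norm (g z) \<le> exp (B * (1 + norm z) powr (3/2))"
    using assms unfolding order_three_halves_def by blast
  have "norm (f z + g z) \<le> exp ((1 + \<bar>A\<bar> + \<bar>B\<bar>) * (1 + norm z) powr (3/2))" for z
  proof -
    define Q where "Q = (1 + norm z) powr (3/2)"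
    have Q: "Q \<ge> 1" unfolding Q_def by (intro ge_one_powr_ge_zero) auto
    have "exp (A * Q) \<le> exp ((\<bar>A\<bar> + \<bar>B\<bar>) * Q)" "exp (B * Q) \<le> exp ((\<bar>A\<bar> + \<bar>B\<bar>) * Q)"
      using Q by (simp_all add: mult_right_mono)
    then have "norm (f z + g z) \<le> 2 * exp ((\<bar>A\<bar> + \<bar>B\<bar>) * Q)"
      using norm_triangle_ineq[of "f z" "g z"] A[of z] B[of z] unfolding Q_def[symmetric] by linarith
    also have "2 \<le> exp Q" using exp_ge_add_one_self[of Q] Q by linarith
    then have "2 * exp ((\<bar>A\<bar> + \<bar>B\<bar>) * Q) \<le> exp (1 * Q) * exp ((\<bar>A\<bar> + \<bar>B\<bar>) * Q)"
      by (intro mult_right_mono) auto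
    also have "\<dots> = exp ((1 + \<bar>A\<bar> + \<bar>B\<bar>) * Q)" unfolding exp_add[symmetric] by (simp add: algebra_simps)
    finally show ?thesis unfolding Q_def .
  qed
  then show ?thesis by (rule order_three_halvesI)
qed

lemma order_three_halves_linear: "order_three_halves (\<lambda>z. a * z + b)"
proof (rule order_three_halvesI)
  fix z
  have "norm (a * z + b) \<le> norm a * norm z + norm b" using norm_triangle_ineq[of "a * z" b] by (simp add: norm_mult)
  also have "\<dots> \<le> (norm a + norm b) * (1 + norm z)" by (simp add: algebra_simps)
  also have "\<dots> \<le> (norm a + norm b) * (1 + norm z) powr (3/2)"
    by (intro mult_left_mono le_powr_three_halves) auto
  also have "\<dots> \<le> exp ((norm a + norm b) * (1 + norm z) powr (3/2))"
    using exp_ge_add_one_self[of "(norm a + norm b) * (1 + norm z) powr (3/2)"] by linarith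
  finally show "norm (a * z + b) \<le> exp ((norm a + norm b) * (1 + norm z) powr (3/2))" .
qed

text \<open>Cauchy's inequality on the unit circle: moving by one at most doubles 1 + norm z, which
  only enlarges the constant.\<close>

lemma order_three_halves_deriv:
  assumes hol: "f holomorphic_on UNIV" and ord: "order_three_halves f"
  shows "order_three_halves (deriv f)"
proof -
  obtain A where A: "\<And>z. norm (f z) \<le> exp (A * (1 + norm z) powr (3/2))"
    using ord unfolding order_three_halves_def by blast
  show ?thesis
  proof (rule order_three_halvesI)
    fix z
    have "norm ((deriv ^^ 1) f z) \<le> fact 1 * exp (\<bar>A\<bar> * 2 powr (3/2) * (1 + norm z) powr (3/2)) / 1 ^ 1"
    proof (rule Cauchy_inequality)
      show "f holomorphic_on ball z 1" using hol holomorphic_on_subset by blast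
      show "continuous_on (cball z 1) f"
        using hol holomorphic_on_imp_continuous_on continuous_on_subset by blast
      fix x assume x: "norm (z - x) = 1"
      have "norm x \<le> norm z + 1" using norm_triangle_ineq4[of z "z - x"] x by simp
      then have "1 + norm x \<le> 2 * (1 + norm z)" using norm_ge_zero[of z] unfolding distrib_left by linarith
      then have "(1 + norm x) powr (3/2) \<le> (2 * (1 + norm z)) powr (3/2)" by (intro powr_mono2) auto
      also have "\<dots> = 2 powr (3/2) * (1 + norm z) powr (3/2)" by (rule powr_mult)
      finally have "A * (1 + norm x) powr (3/2) \<le> \<bar>A\<bar> * (2 powr (3/2) * (1 + norm z) powr (3/2))"
        by (intro mult_mono) auto
      then show "norm (f x) \<le> exp (\<bar>A\<bar> * 2 powr (3/2) * (1 + norm z) powr (3/2))"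
        using A[of x] by (smt (verit) exp_le_cancel_iff mult.assoc)
    qed simp
    then show "norm (deriv f z) \<le> exp (\<bar>A\<bar> * 2 powr (3/2) * (1 + norm z) powr (3/2))" by simp
  qed
qed

text \<open>The plane is cut at Re s = -1/2. To the right the trapezoidal series gives cubic growth.
  To the left zeta(1 - s) is bounded and the Gamma and sine factors determine the growth.\<close>

lemma order_three_halves_zeta_num: "order_three_halves zeta_num"
proof -
  \<comment> \<open>The cut is placed so that this one series dominates both the trapezoidal terms
    on the right and the Dirichlet series at 1 - s on the left.\<close>
  define C where "C = (\<Sum>n. real (Suc n) powr (-3/2))"
  have smC: "summable (\<lambda>n. real (Suc n) powr (-3/2))" by (intro summable_Suc_powr) auto
  have C0: "C \<ge> 0" unfolding C_def by (intro suminf_nonneg smC) auto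
  have right: "norm (zeta_half s) \<le> (1 + C) * (1 + norm s) ^ 3" if s: "Re s \<ge> -1/2" for s
  proof -
    define N where "N = 1 + norm s"
    have N: "N \<ge> 1" unfolding N_def by simp
    have b: "norm (trapezoid_term (Suc n) s) \<le> N ^ 3 * real (Suc n) powr (-3/2)" for n
    proof -
      have "norm (trapezoid_term (Suc n) s) \<le> norm (s - 1) * norm s * norm (s + 1) / 2 * real (Suc n) powr (- Re s - 2)"
        using s by (intro norm_trapezoid_term_le) auto
      also have "\<dots> \<le> (N * N * N / 1) * real (Suc n) powr (-3/2)"
      proof (intro mult_mono frac_le powr_mono)
        show "- Re s - 2 \<le> -3/2" using s by (simp add: field_simps)
      qed (use norm_triangle_ineq4[of s 1] norm_triangle_ineq[of s 1] N in \<open>auto simp: N_def\<close>)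
      finally show ?thesis by (simp add: power3_eq_cube)
    qed
    have "norm (\<Sum>n. trapezoid_term (Suc n) s) \<le> (\<Sum>n. N ^ 3 * real (Suc n) powr (-3/2))"
      by (rule norm_suminf_le[OF b]) (intro summable_mult smC)
    also have "\<dots> = N ^ 3 * C" unfolding C_def by (rule suminf_mult[OF smC])
    finally have 1: "norm (\<Sum>n. trapezoid_term (Suc n) s) \<le> N ^ 3 * C" .
    have "norm ((s + 1) / 2) \<le> N / 2" using norm_triangle_ineq[of s 1] by (simp add: norm_divide N_def)
    also have "N / 2 \<le> N ^ 3" using N power_increasing[of 1 3 N] by simp
    finally have "norm (zeta_half s) \<le> N ^ 3 + N ^ 3 * C"
      unfolding zeta_half_def using 1 by (intro norm_triangle_le) auto
    then show ?thesis unfolding N_def by (simp add: algebra_simps)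
  qed
  have left: "norm (zeta_reflected s) \<le> (1 + norm s) * (2 * exp (2 * norm s) * exp (16 * (1 + norm s) powr (3/2)) * C)"
    if s: "Re s \<le> -1/2" for s
  proof -
    have "norm (zeta_half (1 - s) / (- s)) \<le> C"
    proof -
      have "(\<lambda>n. of_nat (Suc n) powr (- (1 - s))) sums (zeta_half (1 - s) / (1 - s - 1))"
        using s by (intro dirichlet_sums_zeta_half) auto
      then have e: "zeta_half (1 - s) / (- s) = (\<Sum>n. of_nat (Suc n) powr (- (1 - s)))"
        by (simp add: sums_iff)
      show ?thesis unfolding e C_def
      proof (rule norm_suminf_le[OF _ smC])
        fix n
        have "norm (of_nat (Suc n) powr (- (1 - s))) = real (Suc n) powr (Re s - 1)"
          using norm_powr_real_powr[of "of_nat (Suc n)" "- (1 - s)"] by simp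
        also have "\<dots> \<le> real (Suc n) powr (-3/2)" using s by (intro powr_mono) auto
        finally show "norm (of_nat (Suc n) powr (- (1 - s))) \<le> real (Suc n) powr (-3/2)" .
      qed
    qed
    moreover have "norm (Gamma (1 - s)) \<le> exp (16 * (1 + norm s) powr (3/2))"
    proof -
      have "norm (Gamma (1 - s)) \<le> Gamma (1 - Re s)" using norm_Gamma_le[of "1 - s"] s by simp
      also have "\<dots> \<le> exp (2 * (1 - Re s + 2) powr (3/2))" using s by (intro Gamma_le_exp) auto
      \<comment> \<open>Crude bound 3 - Re s \<le> 4 (1 + norm s); with 4 powr (3/2) = 8 it gives
        the constant 16.\<close>
      also have "\<dots> \<le> exp (2 * (4 * (1 + norm s)) powr (3/2))"
        using abs_Re_le_cmod[of s] s by (simp add: powr_mono2)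
      also have "(4 * (1 + norm s)) powr (3/2) = 4 powr (3/2) * (1 + norm s) powr (3/2)" by (rule powr_mult)
      also have "(4::real) powr (3/2) = 8"
      proof -
        have "(4::real) powr (3/2) = (2 powr 2) powr (3/2)" by simp
        also have "\<dots> = 2 powr 3" unfolding powr_powr by simp
        finally show ?thesis by simp
      qed
      finally show ?thesis by simp
    qed
    moreover have "norm (sin (of_real pi * s / 2)) \<le> exp (2 * norm s)"
    proof -
      have "norm (sin (of_real pi * s / 2)) \<le> exp \<bar>Im (of_real pi * s / 2)\<bar>"
        using cmod_sin_le_exp[of 1 "of_real pi * s / 2"] by simp
      also have "\<bar>Im (of_real pi * s / 2)\<bar> = pi / 2 * \<bar>Im s\<bar>" by (simp add: abs_mult)
      also have "\<dots> \<le> 2 * norm s" using pi_less_4 abs_Im_le_cmod[of s] by (intro mult_mono) auto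
      finally show ?thesis by simp
    qed
    moreover have "norm (of_real (2 * pi) powr (s - 1) :: complex) \<le> 1"
    proof -
      have "norm (of_real (2 * pi) powr (s - 1) :: complex) = (2 * pi) powr (Re s - 1)"
        by (subst norm_powr_real_powr) auto
      also have "\<dots> \<le> (2 * pi) powr 0" using s pi_gt3 by (intro powr_mono) auto
      finally show ?thesis by simp
    qed
    moreover have "norm (s - 1) \<le> 1 + norm s" using norm_triangle_ineq4[of s 1] by simp
    ultimately have "norm (zeta_reflected s) \<le> (1 + norm s) * (2 * 1 * exp (2 * norm s) * exp (16 * (1 + norm s) powr (3/2)) * C)"
      unfolding zeta_reflected_def norm_mult
      by (intro mult_mono) (auto intro!: mult_nonneg_nonneg)
    then show ?thesis by simp
  qed
  show ?thesis
  proof (rule order_three_halvesI)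
    fix s :: complex
    define Q where "Q = (1 + norm s) powr (3/2)"
    have Q: "1 + norm s \<le> Q" unfolding Q_def by (rule le_powr_three_halves) simp
    then have Q1: "1 \<le> Q" using norm_ge_zero[of s] by linarith
    have eN: "1 + norm s \<le> exp Q" using Q exp_ge_add_one_self[of Q] by linarith
    have eC: "1 + C \<le> exp (C * Q)"
    proof -
      have "1 + C \<le> exp C" by (rule exp_ge_add_one_self)
      also have "C \<le> C * Q" using Q1 C0 by (simp add: mult_le_cancel_left1)
      finally show ?thesis by simp
    qed
    \<comment> \<open>The right part needs C + 3. The left part needs C + 20, from 1 + 1 + 2 + 16 +
      C.\<close>
    have "norm (zeta_num s) \<le> exp ((C + 21) * Q)"
    proof (cases "Re s \<ge> -1/2")
      case True
      then have "norm (zeta_num s) \<le> (1 + C) * (1 + norm s) ^ 3" using right unfolding zeta_num_def by auto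
      also have "\<dots> \<le> exp (C * Q) * exp Q ^ 3" using eC eN C0 by (intro mult_mono power_mono) auto
      also have "\<dots> = exp ((C + 3) * Q)" unfolding exp_of_nat_mult[symmetric] exp_add[symmetric] by (simp add: algebra_simps)
      also have "\<dots> \<le> exp ((C + 21) * Q)" using Q1 by simp
      finally show ?thesis .
    next
      case False
      then have "norm (zeta_num s) \<le> (1 + norm s) * (2 * exp (2 * norm s) * exp (16 * Q) * C)"
        using left[of s] unfolding Q_def by (simp add: zeta_num_reflected)
      also have "\<dots> \<le> exp Q * (exp Q * exp (2 * Q) * exp (16 * Q) * exp (C * Q))"
      proof -
        have "2 \<le> exp Q" using exp_ge_add_one_self[of Q] Q1 by linarith
        moreover have "exp (2 * norm s) \<le> exp (2 * Q)" using Q by simp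
        moreover have "C \<le> exp (C * Q)" using eC by linarith
        ultimately show ?thesis using C0 by (intro mult_mono eN order_refl) (auto intro!: mult_nonneg_nonneg)
      qed
      also have "\<dots> = exp ((C + 20) * Q)" unfolding exp_add[symmetric] by (simp add: algebra_simps)
      also have "\<dots> \<le> exp ((C + 21) * Q)" using Q1 by simp
      finally show ?thesis .
    qed
    then show "norm (zeta_num s) \<le> exp ((C + 21) * (1 + norm s) powr (3/2))" unfolding Q_def .
  qed
qed

text \<open>\<open>(s - 1)\<^sup>2 \<zeta>'(s)\<close>, without the singularity at \<open>s = 1\<close>.\<close>
definition dzeta_num :: "complex \<Rightarrow> complex" where
  "dzeta_num s = (s - 1) * deriv zeta_num s - zeta_num s"

lemma holomorphic_dzeta_num: "dzeta_num holomorphic_on A"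
  unfolding dzeta_num_def
  by (intro holomorphic_intros holomorphic_zeta_num
      holomorphic_on_subset[OF holomorphic_deriv[OF holomorphic_zeta_num open_UNIV] subset_UNIV])

lemma order_three_halves_dzeta_num: "order_three_halves dzeta_num"
proof -
  have "order_three_halves (\<lambda>s. (1 * s + - 1) * deriv zeta_num s + (0 * s + - 1) * zeta_num s)"
    by (intro order_three_halves_add order_three_halves_mult order_three_halves_linear
        order_three_halves_deriv holomorphic_zeta_num order_three_halves_zeta_num)
  moreover have "(\<lambda>s. (1 * s + - 1) * deriv zeta_num s + (0 * s + - 1) * zeta_num s) = dzeta_num"
    by (simp add: fun_eq_iff dzeta_num_def)
  ultimately show ?thesis by simp
qed

lemma dzeta_num_1: "dzeta_num 1 = -1"
  by (simp add: dzeta_num_def zeta_num_1)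

lemma holomorphic_zeta: "zeta holomorphic_on (- {1})"
proof -
  have "(\<lambda>s. zeta_num s / (s - 1)) holomorphic_on (- {1})"
    by (intro holomorphic_intros holomorphic_zeta_num) auto
  then show ?thesis by (rule holomorphic_transform) (auto simp: zeta_eq)
qed

lemma deriv_zeta:
  assumes "s \<noteq> 1"
  shows "deriv zeta s = dzeta_num s / (s - 1)\<^sup>2"
proof -
  have "(zeta_num has_field_derivative deriv zeta_num s) (at s)"
    by (rule holomorphic_derivI[OF holomorphic_zeta_num open_UNIV]) simp
  then have "((\<lambda>s. zeta_num s / (s - 1)) has_field_derivative dzeta_num s / (s - 1)\<^sup>2) (at s)"
    using assms by (auto intro!: derivative_eq_intros simp: dzeta_num_def power2_eq_square field_simps)
  then have "(zeta has_field_derivative dzeta_num s / (s - 1)\<^sup>2) (at s)"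
    by (rule has_field_derivative_transform_within_open[where S = "- {1}"]) (use assms in \<open>auto simp: zeta_eq\<close>)
  then show ?thesis by (rule DERIV_imp_deriv)
qed

lemma deriv_deriv_zeta:
  assumes "s \<noteq> 1"
  shows "deriv (deriv zeta) s =
    (deriv dzeta_num s * (s - 1)\<^sup>2 - dzeta_num s * (2 * (s - 1))) / ((s - 1)\<^sup>2 * (s - 1)\<^sup>2)"
proof -
  have d: "(dzeta_num has_field_derivative deriv dzeta_num s) (at s)"
    by (rule holomorphic_derivI[OF holomorphic_dzeta_num open_UNIV]) simp
  have "((\<lambda>s. dzeta_num s / (s - 1)\<^sup>2) has_field_derivative
      (deriv dzeta_num s * (s - 1)\<^sup>2 - dzeta_num s * (2 * (s - 1))) / ((s - 1)\<^sup>2 * (s - 1)\<^sup>2)) (at s)"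
    using assms by (auto intro!: derivative_eq_intros d)
  then have "(deriv zeta has_field_derivative
      (deriv dzeta_num s * (s - 1)\<^sup>2 - dzeta_num s * (2 * (s - 1))) / ((s - 1)\<^sup>2 * (s - 1)\<^sup>2)) (at s)"
    by (rule has_field_derivative_transform_within_open[where S = "- {1}"]) (use assms in \<open>auto simp: deriv_zeta\<close>)
  then show ?thesis by (rule DERIV_imp_deriv)
qed

lemma log_deriv_deriv_zeta:
  assumes "s \<noteq> 1" "deriv zeta s \<noteq> 0"
  shows "deriv (deriv zeta) s / deriv zeta s = deriv dzeta_num s / dzeta_num s - 2 / (s - 1)"
proof -
  have "dzeta_num s \<noteq> 0" "s - 1 \<noteq> 0" using assms deriv_zeta by auto
  then show ?thesis unfolding deriv_deriv_zeta[OF assms(1)] deriv_zeta[OF assms(1)]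
    by (simp add: divide_simps power2_eq_square) (simp add: algebra_simps)
qed

section \<open>Zeros of the derivative on the real axis\<close>

text \<open>Splitting k powr (-Re s) into k powr (-2) and k powr (2 - Re s) leaves a fixed
  convergent series. Taken with m = 2 to compare zeta with 1, and with m = 3 to isolate 2 powr
  (-s).\<close>

lemma zeta_tail_bound:
  assumes m: "m \<ge> 1"
  obtains K where "K > 0"
    "\<And>s. Re s \<ge> 2 \<Longrightarrow> norm (zeta s - (\<Sum>n<m - 1. of_nat (Suc n) powr (- s))) \<le> K * real m powr (- Re s)"
proof -
  define K where "K = (\<Sum>n. real (Suc n) powr (-2)) * (real m)\<^sup>2"
  have sm: "summable (\<lambda>n. real (Suc n) powr (-2))" by (intro summable_Suc_powr) auto
  have "(\<Sum>n. real (Suc n) powr (-2)) > 0" by (intro suminf_pos sm) auto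
  then have K: "K > 0" unfolding K_def using m by simp
  have "norm (zeta s - (\<Sum>n<m - 1. of_nat (Suc n) powr (- s))) \<le> K * real m powr (- Re s)" if s: "Re s \<ge> 2" for s
  proof -
    have "(\<lambda>n. of_nat (Suc n) powr (- s)) sums zeta s" using s by (intro zeta_sums) auto
    then have "(\<lambda>n. of_nat (Suc (n + (m - 1))) powr (- s)) sums (zeta s - (\<Sum>n<m - 1. of_nat (Suc n) powr (- s)))"
      by (rule sums_split_initial_segment)
    then have e: "zeta s - (\<Sum>n<m - 1. of_nat (Suc n) powr (- s)) = (\<Sum>n. of_nat (Suc (n + (m - 1))) powr (- s))"
      by (simp add: sums_iff)
    have "norm (\<Sum>n. of_nat (Suc (n + (m - 1))) powr (- s)) \<le> (\<Sum>n. real (Suc n) powr (-2) * real m powr (2 - Re s))"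
    proof (rule norm_suminf_le)
      fix n
      define k where "k = Suc (n + (m - 1))"
      have k: "k \<ge> m" "k \<ge> Suc n" unfolding k_def using m by auto
      have "norm (of_nat k powr (- s)) = real k powr (- Re s)"
        using norm_powr_real_powr[of "of_nat k" "- s"] by simp
      also have "\<dots> = real k powr (-2) * real k powr (2 - Re s)" by (simp flip: powr_add)
      also have "\<dots> \<le> real (Suc n) powr (-2) * real m powr (2 - Re s)"
        using k m s by (intro mult_mono powr_mono2') auto
      finally show "norm (of_nat (Suc (n + (m - 1))) powr (- s)) \<le> real (Suc n) powr (-2) * real m powr (2 - Re s)"
        unfolding k_def .
    qed (intro summable_mult2 sm)
    also have "\<dots> = (\<Sum>n. real (Suc n) powr (-2)) * real m powr (2 - Re s)" by (rule suminf_mult2[OF sm, symmetric])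
    also have "real m powr (2 - Re s) = (real m)\<^sup>2 * real m powr (- Re s)"
      using powr_add[of "real m" 2 "- Re s"] m by simp
    finally show ?thesis unfolding e K_def by (simp add: mult_ac)
  qed
  with K show ?thesis by (rule that)
qed

text \<open>The unit circle around \<open>s\<close> changes real parts by at most one, so
  derivatives keep the exponential rate and lose only the factor \<open>a\<close> and a
  factorial.\<close>

lemma higher_deriv_bound_right:
  assumes hol: "f holomorphic_on {s. Re s > 1}" and a: "a > 0"
    and b: "\<And>s. Re s \<ge> 2 \<Longrightarrow> norm (f s) \<le> K * a powr (- Re s)" and K: "K > 0"
    and a1: "a \<ge> 1" and s: "Re s \<ge> 3"
  shows "norm ((deriv ^^ k) f s) \<le> fact k * (K * a) * a powr (- Re s)"
proof -
  have sub: "cball s 1 \<subseteq> {s. Re s > 1}"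
  proof
    fix x assume "x \<in> cball s 1"
    then have "norm (s - x) \<le> 1" by (simp add: dist_norm)
    then show "x \<in> {s. Re s > 1}" using complex_Re_le_cmod[of "s - x"] s by simp
  qed
  have "norm ((deriv ^^ k) f s) \<le> fact k * (K * a powr (1 - Re s)) / 1 ^ k"
  proof (rule Cauchy_inequality)
    show "f holomorphic_on ball s 1" using hol sub ball_subset_cball by (meson holomorphic_on_subset)
    show "continuous_on (cball s 1) f" using holomorphic_on_imp_continuous_on[OF hol] sub continuous_on_subset by blast
    fix x assume x: "norm (s - x) = 1"
    have "Re s - 1 \<le> Re x" using complex_Re_le_cmod[of "s - x"] x by simp
    then have "norm (f x) \<le> K * a powr (- Re x)" "a powr (- Re x) \<le> a powr (1 - Re s)"
      using b[of x] s a1 by (auto intro!: powr_mono)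
    then show "norm (f x) \<le> K * a powr (1 - Re s)" using K by (meson less_imp_le mult_left_mono order_trans)
  qed simp
  also have "a powr (1 - Re s) = a * a powr (- Re s)" using powr_add[of a 1 "- Re s"] a by simp
  finally show ?thesis by (simp add: mult_ac)
qed

lemma holomorphic_zeta_right: "zeta holomorphic_on {s. Re s > 1}"
  by (rule holomorphic_on_subset[OF holomorphic_zeta]) auto

lemma zeta_right_close_to_1:
  assumes "e > 0"
  obtains X where "X \<ge> 3"
    "\<And>s. Re s \<ge> X \<Longrightarrow> norm (zeta s - 1) \<le> e \<and> norm (deriv zeta s) \<le> e \<and> norm (deriv (deriv zeta) s) \<le> e"
proof -
  obtain K where K: "K > 0" "\<And>s. Re s \<ge> 2 \<Longrightarrow> norm (zeta s - (\<Sum>n<2 - 1. of_nat (Suc n) powr (- s))) \<le> K * real 2 powr (- Re s)"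
    using zeta_tail_bound[of 2] by auto
  define f where "f = (\<lambda>s. zeta s - 1)"
  have fb: "norm (f s) \<le> K * 2 powr (- Re s)" if "Re s \<ge> 2" for s using K(2)[OF that] unfolding f_def by simp
  have fh: "f holomorphic_on {s. Re s > 1}" unfolding f_def by (intro holomorphic_intros holomorphic_zeta_right)
  have D: "deriv zeta s = (deriv ^^ 1) f s" "deriv (deriv zeta) s = (deriv ^^ 2) f s" if "Re s > 1" for s
  proof -
    have d1: "deriv f z = deriv zeta z" if "Re z > 1" for z
    proof -
      have "(zeta has_field_derivative deriv zeta z) (at z)"
        by (rule holomorphic_derivI[OF holomorphic_zeta_right open_halfspace_Re_gt]) (use that in simp)
      then show ?thesis unfolding f_def by (intro DERIV_imp_deriv) (auto intro!: derivative_eq_intros)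
    qed
    show "deriv zeta s = (deriv ^^ 1) f s" using d1[OF that] by simp
    have "eventually (\<lambda>z. Re z > 1) (nhds s)"
      using eventually_nhds_in_open[OF open_halfspace_Re_gt[of 1], of s] that by simp
    then have "deriv (deriv f) s = deriv (deriv zeta) s"
      by (intro deriv_cong_ev refl) (auto elim!: eventually_mono simp: d1)
    then show "deriv (deriv zeta) s = (deriv ^^ 2) f s" by (simp add: numeral_2_eq_2)
  qed
  have B: "norm ((deriv ^^ k) f s) \<le> fact k * (K * 2) * 2 powr (- Re s)" if "Re s \<ge> 3" for k s
    by (rule higher_deriv_bound_right[OF fh _ fb K(1) _ that]) auto
  have "((\<lambda>x::real. 2 * (K * 2) * 2 powr (- x)) \<longlongrightarrow> 0) at_top" by real_asymp
  then have "eventually (\<lambda>x. 2 * (K * 2) * 2 powr (- x) < e) at_top"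
    using assms by (rule order_tendstoD)
  then obtain X0 where X0: "\<And>x. x \<ge> X0 \<Longrightarrow> 2 * (K * 2) * 2 powr (- x) < e"
    unfolding eventually_at_top_linorder by blast
  show ?thesis
  proof (rule that[of "max X0 3"])
    fix s assume s: "Re s \<ge> max X0 3"
    define y where "y = (K * 2) * 2 powr (- Re s)"
    have y: "2 * y < e" "y \<ge> 0" using X0[of "Re s"] s K unfolding y_def by (auto simp: mult.assoc)
    have "norm (f s) \<le> y" "norm (deriv zeta s) \<le> y" "norm (deriv (deriv zeta) s) \<le> 2 * y"
      using B[of s 0] B[of s 1] B[of s 2] D[of s] s unfolding y_def by (auto simp: mult.assoc)
    then show "norm (zeta s - 1) \<le> e \<and> norm (deriv zeta s) \<le> e \<and> norm (deriv (deriv zeta) s) \<le> e"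
      using y unfolding f_def by linarith
  qed simp
qed

text \<open>The derivatives of 2 powr (-s) outweigh those of the remaining series, which are O(3
  powr (-Re s)). This bounds the real parts of the zeros of zeta' and zeta'' from above.\<close>

lemma zeta_derivs_nonzero_right:
  obtains B where "\<And>s. Re s \<ge> B \<Longrightarrow> deriv zeta s \<noteq> 0 \<and> deriv (deriv zeta) s \<noteq> 0"
proof -
  obtain K where K: "K > 0" "\<And>s. Re s \<ge> 2 \<Longrightarrow> norm (zeta s - (\<Sum>n<3 - 1. of_nat (Suc n) powr (- s))) \<le> K * real 3 powr (- Re s)"
    using zeta_tail_bound[of 3] by auto
  define g where "g = (\<lambda>s::complex. 1 + exp (- of_real (ln 2) * s))"
  define f where "f = (\<lambda>s. zeta s - g s)"
  have two: "(2::complex) powr (- s) = exp (- of_real (ln 2) * s)" for s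
  proof -
    have "Ln 2 = of_real (ln 2)" using Ln_of_real[of 2] by simp
    then show ?thesis by (simp add: powr_def mult.commute)
  qed
  have "{..<3 - 1} = {0, Suc 0}" by auto
  then have "(\<Sum>n<3 - 1. of_nat (Suc n) powr (- s)) = g s" for s :: complex
    unfolding g_def two[symmetric] by simp
  then have fb: "norm (f s) \<le> K * 3 powr (- Re s)" if "Re s \<ge> 2" for s using K(2)[OF that] unfolding f_def by simp
  have gd: "(g has_field_derivative - of_real (ln 2) * exp (- of_real (ln 2) * s)) (at s)" for s
    unfolding g_def by (auto intro!: derivative_eq_intros)
  have fh: "f holomorphic_on {s. Re s > 1}"
    unfolding f_def g_def by (intro holomorphic_intros holomorphic_zeta_right)
  have D1: "deriv zeta s = deriv f s - of_real (ln 2) * exp (- of_real (ln 2) * s)" if "Re s > 1" for s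
  proof -
    have "(zeta has_field_derivative deriv zeta s) (at s)"
      by (rule holomorphic_derivI[OF holomorphic_zeta_right open_halfspace_Re_gt]) (use that in simp)
    from DERIV_diff[OF this gd] have "deriv f s = deriv zeta s - - of_real (ln 2) * exp (- of_real (ln 2) * s)"
      unfolding f_def by (rule DERIV_imp_deriv)
    then show ?thesis by simp
  qed
  have D2: "deriv (deriv zeta) s = (deriv ^^ 2) f s + (of_real (ln 2))\<^sup>2 * exp (- of_real (ln 2) * s)" if s: "Re s > 1" for s
  proof -
    have "(deriv f has_field_derivative deriv (deriv f) s) (at s)"
      by (rule holomorphic_derivI[OF holomorphic_deriv[OF fh open_halfspace_Re_gt] open_halfspace_Re_gt]) (use s in simp)
    then have "((\<lambda>s. deriv f s - of_real (ln 2) * exp (- of_real (ln 2) * s)) has_field_derivative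
        (deriv (deriv f) s + (of_real (ln 2))\<^sup>2 * exp (- of_real (ln 2) * s))) (at s)"
      by (auto intro!: derivative_eq_intros simp: power2_eq_square)
    then have "(deriv zeta has_field_derivative
        (deriv (deriv f) s + (of_real (ln 2))\<^sup>2 * exp (- of_real (ln 2) * s))) (at s)"
      by (rule has_field_derivative_transform_within_open[OF _ open_halfspace_Re_gt[of 1]]) (use s in \<open>auto simp: D1\<close>)
    then show ?thesis by (simp add: DERIV_imp_deriv numeral_2_eq_2)
  qed
  have B: "norm ((deriv ^^ k) f s) \<le> fact k * (K * 3) * 3 powr (- Re s)" if "Re s \<ge> 3" for k s
    by (rule higher_deriv_bound_right[OF fh _ fb K(1) _ that]) auto
  \<comment> \<open>The smaller of the coefficients of 2 powr (-s) in the first and second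
    derivative, so that one threshold serves both.\<close>
  define c where "c = min (ln 2) ((ln 2)\<^sup>2 :: real)"
  have c: "c > 0" unfolding c_def by simp
  have "((\<lambda>x::real. 2 * (K * 3) * 3 powr (- x) / 2 powr (- x)) \<longlongrightarrow> 0) at_top" by real_asymp
  then have "eventually (\<lambda>x. 2 * (K * 3) * 3 powr (- x) / 2 powr (- x) < c) at_top"
    using c by (rule order_tendstoD)
  then obtain X0 where X0: "\<And>x. x \<ge> X0 \<Longrightarrow> 2 * (K * 3) * 3 powr (- x) / 2 powr (- x) < c"
    unfolding eventually_at_top_linorder by blast
  show ?thesis
  proof (rule that[of "max X0 3"])
    fix s assume s: "Re s \<ge> max X0 3"
    define y where "y = (K * 3) * 3 powr (- Re s)"
    define E where "E = exp (- of_real (ln 2) * s)"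
    have nE: "norm E = 2 powr (- Re s)" unfolding E_def by (simp add: powr_def mult.commute)
    have E0: "norm E > 0" unfolding E_def by simp
    have y: "2 * y < c * norm E" "y \<ge> 0"
      using X0[of "Re s"] s K E0 unfolding y_def nE by (auto simp: field_simps)
    have n1: "norm (of_real (ln 2) * E) \<ge> c * norm E" "norm ((of_real (ln 2))\<^sup>2 * E) \<ge> c * norm E"
      unfolding norm_mult norm_power c_def by (auto intro!: mult_right_mono)
    have b1: "norm (deriv f s) \<le> y" "norm ((deriv ^^ 2) f s) \<le> 2 * y"
      using B[of s 1] B[of s 2] s unfolding y_def by (auto simp: mult.assoc)
    have "deriv zeta s \<noteq> 0"
    proof
      assume "deriv zeta s = 0"
      then have "of_real (ln 2) * E = deriv f s" using D1[of s] s unfolding E_def by simp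
      then show False using n1(1) b1(1) y by simp
    qed
    moreover have "deriv (deriv zeta) s \<noteq> 0"
    proof
      assume "deriv (deriv zeta) s = 0"
      then have "(of_real (ln 2))\<^sup>2 * E + (deriv ^^ 2) f s = 0" using D2[of s] s unfolding E_def by (simp add: add.commute)
      then have "(of_real (ln 2))\<^sup>2 * E = - (deriv ^^ 2) f s" by (simp only: eq_neg_iff_add_eq_0)
      then show False using n1(2) b1(2) y by simp
    qed
    ultimately show "deriv zeta s \<noteq> 0 \<and> deriv (deriv zeta) s \<noteq> 0" by simp
  qed
qed

text \<open>Real difference quotients have their limit in the closed set of reals; approaching from
  the right keeps the arguments above \<open>X\<close>.\<close>

lemma deriv_in_Reals:
  assumes "(f has_field_derivative D) (at (of_real x))" and "\<And>y. y > X \<Longrightarrow> f (of_real y) \<in> \<real>" and "x > X"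
  shows "D \<in> (\<real> :: complex set)"
proof -
  have lim: "((\<lambda>h. (f (of_real x + h) - f (of_real x)) / h) \<longlongrightarrow> D) (at 0)"
    using assms(1) unfolding DERIV_def .
  have "filterlim (\<lambda>n. complex_of_real (inverse (real (Suc n)))) (at 0) sequentially"
    unfolding filterlim_at
  proof
    show "(\<lambda>n. complex_of_real (inverse (real (Suc n)))) \<longlonglongrightarrow> 0"
      using tendsto_of_real[OF LIMSEQ_inverse_real_of_nat, where 'a = complex] by simp
  qed (simp del: of_nat_Suc)
  from filterlim_compose[OF lim this]
  have "(\<lambda>n. (f (of_real x + of_real (inverse (real (Suc n)))) - f (of_real x)) / of_real (inverse (real (Suc n)))) \<longlonglongrightarrow> D" .
  moreover have "(f (of_real x + of_real (inverse (real (Suc n)))) - f (of_real x)) / of_real (inverse (real (Suc n))) \<in> \<real>" for n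
  proof -
    have "inverse (real (Suc n)) > 0" by simp
    then have "x + inverse (real (Suc n)) > X" using assms(3) by linarith
    then have "f (of_real x + of_real (inverse (real (Suc n)))) \<in> \<real>" using assms(2) by (metis of_real_add)
    then show ?thesis using assms(2)[OF assms(3)] by (intro Reals_divide Reals_diff) auto
  qed
  ultimately show ?thesis
    by (intro Lim_in_closed_set[OF closed_complex_Reals _ sequentially_bot]) auto
qed

text \<open>The trigamma function is positive and decreasing for positive arguments, and its value
  at 1 is the sum of the inverse squares.\<close>

lemma Polygamma_1_real_bound: "x \<ge> 1 \<Longrightarrow> \<bar>Polygamma 1 (x::real)\<bar> \<le> pi\<^sup>2 / 6"
proof -
  assume x: "x \<ge> 1"
  have "Polygamma 1 (1::real) = pi\<^sup>2 / 6"
  proof -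
    have "(\<lambda>n. inverse ((1 + real n)\<^sup>2)) sums (pi\<^sup>2 / 6)"
      using inverse_squares_sums by (simp add: add.commute inverse_eq_divide)
    then show ?thesis by (simp add: Polygamma_def sums_iff numeral_2_eq_2)
  qed
  moreover have "Polygamma 1 x \<le> Polygamma 1 1"
  proof (cases "x = 1")
    case False
    then show ?thesis using Polygamma_real_strict_antimono[of 1 x 1] x by simp
  qed simp
  moreover have "Polygamma 1 x > 0" using Polygamma_real_odd_pos[of x 1] nonpos_Ints_nonpos[of x] x by force
  ultimately show ?thesis by simp
qed

lemma zeta_of_real_in_Reals:
  assumes "x > 1"
  shows "zeta (of_real x) \<in> \<real>"
proof -
  obtain R where "(\<lambda>n. real (Suc n) powr (- x)) sums R"
    using summable_Suc_powr[of "- x"] assms by (auto simp: summable_def)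
  then have "(\<lambda>n. complex_of_real (real (Suc n) powr (- x))) sums of_real R" by (rule sums_of_real)
  moreover have "complex_of_real (real (Suc n) powr (- x)) = of_nat (Suc n) powr (- of_real x)" for n
    using powr_of_real[of "real (Suc n)" "- x"] by simp
  ultimately have "zeta (of_real x) = of_real R"
    using zeta_sums[of "of_real x"] assms sums_unique2 by simp
  then show ?thesis by simp
qed

text \<open>
  By the functional equation, \<open>\<zeta>'(1 - s) = - U q\<close> with \<open>U(s) = 2 (2\<pi>)\<^bsup>-s\<^esup> \<Gamma>(s) \<zeta>(s)\<close>,
  \<open>W = U'/U\<close> and \<open>q = W cos(\<pi>s/2) - (\<pi>/2) sin(\<pi>s/2)\<close>. Between consecutive odd integers,
  \<open>q / cos(\<pi>s/2)\<close> is strictly decreasing, since \<open>W'\<close> is close to \<open>\<psi>' \<le> \<pi>\<^sup>2/6 < \<pi>\<^sup>2/4\<close>.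
\<close>
lemma real_zeros_deriv_zeta:
  obtains N :: nat and \<alpha> :: "nat \<Rightarrow> real" where "N \<ge> 1"
    "\<And>n. n \<ge> N \<Longrightarrow> 2 * real n < \<alpha> n \<and> \<alpha> n < 2 * real n + 2"
    "\<And>n. n \<ge> N \<Longrightarrow> deriv zeta (of_real (- \<alpha> n)) = 0 \<and> deriv (deriv zeta) (of_real (- \<alpha> n)) \<noteq> 0"
    "\<And>l. l \<le> - 2 * real N \<Longrightarrow> deriv zeta (of_real l) = 0 \<Longrightarrow> \<exists>n\<ge>N. l = - \<alpha> n"
proof -
  \<comment> \<open>With 1/10, the part of \<open>W'\<close> other than the trigamma function is at
    most 0.12 / 0.81 < 3/4, while the available gap pi^2/4 - pi^2/6 = pi^2/12 exceeds 3/4.\<close>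
  obtain X where X3: "X \<ge> 3" and X: "\<And>s. Re s \<ge> X \<Longrightarrow> norm (zeta s - 1) \<le> 1/10 \<and>
      norm (deriv zeta s) \<le> 1/10 \<and> norm (deriv (deriv zeta) s) \<le> 1/10"
    using zeta_right_close_to_1[of "1/10"] by auto
  define S where "S = {s. Re s > X}"
  have oS: "open S" unfolding S_def by (rule open_halfspace_Re_gt)
  have S1: "Re s > 1" if "s \<in> S" for s using that X3 unfolding S_def by simp
  have z_bounds: "9/10 \<le> norm (zeta s)" "norm (zeta s) \<le> 11/10" "zeta s \<noteq> 0"
    "norm (deriv zeta s) \<le> 1/10" "norm (deriv (deriv zeta) s) \<le> 1/10" if "s \<in> S" for s
  proof -
    have "Re s \<ge> X" using that unfolding S_def by simp
    note x = X[OF this]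
    have t: "\<bar>norm (zeta s) - 1\<bar> \<le> norm (zeta s - 1)" using norm_triangle_ineq3[of "zeta s" 1] by simp
    show "9/10 \<le> norm (zeta s)" using x t by linarith
    then show "zeta s \<noteq> 0" by auto
    show "norm (zeta s) \<le> 11/10" using x t by linarith
  qed (use that X[of s] in \<open>auto simp: S_def\<close>)
  have dz: "(zeta has_field_derivative deriv zeta s) (at s)" if "s \<noteq> 1" for s
    by (rule holomorphic_derivI[OF holomorphic_zeta]) (use that in auto)
  have ddz: "(deriv zeta has_field_derivative deriv (deriv zeta) s) (at s)" if "s \<noteq> 1" for s
    by (rule holomorphic_derivI[OF holomorphic_deriv[OF holomorphic_zeta]]) (use that in auto)
  have ni: "s \<notin> \<int>\<^sub>\<le>\<^sub>0" "s \<noteq> 1" "1 - s \<noteq> 1" if "s \<in> S" for s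
    using S1[OF that] by (auto elim!: nonpos_Ints_cases)
  define U where "U = (\<lambda>s::complex. 2 * exp (- of_real (ln (2 * pi)) * s) * Gamma s * zeta s)"
  define W where "W = (\<lambda>s::complex. - of_real (ln (2 * pi)) + Digamma s + deriv zeta s / zeta s)"
  define W' where "W' = (\<lambda>s::complex. Polygamma 1 s + (deriv (deriv zeta) s * zeta s - deriv zeta s * deriv zeta s) / (zeta s * zeta s))"
  define q where "q = (\<lambda>s::complex. W s * cos (of_real pi * s / 2) - of_real pi / 2 * sin (of_real pi * s / 2))"
  define q' where "q' = (\<lambda>s::complex. W' s * cos (of_real pi * s / 2) - W s * (of_real pi / 2) * sin (of_real pi * s / 2)
    - (of_real pi / 2)\<^sup>2 * cos (of_real pi * s / 2))"
  have U0: "U s \<noteq> 0" if "s \<in> S" for s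
    unfolding U_def using z_bounds(3)[OF that] ni[OF that] by (simp add: Gamma_eq_zero_iff)
  have dU: "(U has_field_derivative U s * W s) (at s)" if "s \<in> S" for s
  proof -
    have "(U has_field_derivative 2 * (exp (- of_real (ln (2 * pi)) * s) * (- of_real (ln (2 * pi)))) * Gamma s * zeta s
        + 2 * exp (- of_real (ln (2 * pi)) * s) * (Gamma s * Digamma s) * zeta s
        + 2 * exp (- of_real (ln (2 * pi)) * s) * Gamma s * deriv zeta s) (at s)"
      unfolding U_def using ni[OF that]
      by (auto intro!: derivative_eq_intros dz simp: algebra_simps)
    also have "2 * (exp (- of_real (ln (2 * pi)) * s) * (- of_real (ln (2 * pi)))) * Gamma s * zeta s
        + 2 * exp (- of_real (ln (2 * pi)) * s) * (Gamma s * Digamma s) * zeta s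
        + 2 * exp (- of_real (ln (2 * pi)) * s) * Gamma s * deriv zeta s = U s * W s"
      unfolding U_def W_def using z_bounds(3)[OF that] by (simp add: field_simps)
    finally show ?thesis .
  qed
  have dW: "(W has_field_derivative W' s) (at s)" if "s \<in> S" for s
    unfolding W_def W'_def using ni[OF that] z_bounds(3)[OF that]
    by (auto intro!: derivative_eq_intros dz ddz)
  have dq: "(q has_field_derivative q' s) (at s)" if "s \<in> S" for s
    unfolding q_def q'_def
    by (auto intro!: derivative_eq_intros dW[OF that] simp: power2_eq_square algebra_simps)
  have FE: "zeta (1 - s) = cos (of_real pi * s / 2) * U s" if "s \<in> S" for s
  proof -
    have "Ln (of_real (2 * pi)) = of_real (ln (2 * pi))" by (rule Ln_of_real) simp
    then have "of_real (2 * pi) powr (- s) = exp (- of_real (ln (2 * pi)) * s)"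
      by (simp add: powr_def mult.commute)
    then show ?thesis using zeta_functional_equation[OF S1[OF that]] unfolding U_def by (simp add: mult_ac)
  qed
  have D1: "deriv zeta (1 - s) = - (U s * q s)" if s: "s \<in> S" for s
  proof -
    have "((\<lambda>s. zeta (1 - s)) has_field_derivative deriv zeta (1 - s) * (- 1)) (at s)"
      by (rule DERIV_chain2[where f = zeta and g = "\<lambda>s. 1 - s" and x = s, OF dz[OF ni(3)[OF s]]]) (auto intro!: derivative_eq_intros)
    moreover have "((\<lambda>s. cos (of_real pi * s / 2) * U s) has_field_derivative
        (- sin (of_real pi * s / 2) * (of_real pi / 2) * U s + U s * W s * cos (of_real pi * s / 2))) (at s)"
      by (auto intro!: derivative_eq_intros dU[OF s])
    then have "((\<lambda>s. zeta (1 - s)) has_field_derivative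
        (- sin (of_real pi * s / 2) * (of_real pi / 2) * U s + U s * W s * cos (of_real pi * s / 2))) (at s)"
      by (rule has_field_derivative_transform_within_open[OF _ oS s]) (simp add: FE)
    ultimately have "deriv zeta (1 - s) * (- 1) = - sin (of_real pi * s / 2) * (of_real pi / 2) * U s + U s * W s * cos (of_real pi * s / 2)"
      by (rule DERIV_unique)
    then show ?thesis unfolding q_def by (simp add: algebra_simps)
  qed
  have D2: "deriv (deriv zeta) (1 - s) = U s * W s * q s + U s * q' s" if s: "s \<in> S" for s
  proof -
    have "((\<lambda>s. deriv zeta (1 - s)) has_field_derivative deriv (deriv zeta) (1 - s) * (- 1)) (at s)"
      by (rule DERIV_chain2[where f = "deriv zeta" and g = "\<lambda>s. 1 - s" and x = s, OF ddz[OF ni(3)[OF s]]]) (auto intro!: derivative_eq_intros)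
    moreover have "((\<lambda>s. - (U s * q s)) has_field_derivative - (U s * W s * q s + U s * q' s)) (at s)"
      by (auto intro!: derivative_eq_intros dU[OF s] dq[OF s])
    then have "((\<lambda>s. deriv zeta (1 - s)) has_field_derivative - (U s * W s * q s + U s * q' s)) (at s)"
      by (rule has_field_derivative_transform_within_open[OF _ oS s]) (simp add: D1)
    ultimately have "deriv (deriv zeta) (1 - s) * (- 1) = - (U s * W s * q s + U s * q' s)"
      by (rule DERIV_unique)
    then show ?thesis by (simp only: mult_minus1_right neg_equal_iff_equal)
  qed
  have xS: "of_real x \<in> S" if "x > X" for x using that unfolding S_def by simp
  define w where "w = (\<lambda>x. Re (W (of_real x)))"
  have Wr: "W (of_real x) = of_real (w x)" if "x > X" for x
  proof -
    have "zeta (of_real y) \<in> \<real>" if "y > X" for y using that X3 by (intro zeta_of_real_in_Reals) auto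
    then have "deriv zeta (of_real x) \<in> \<real>"
      using deriv_in_Reals[OF dz[OF ni(2)[OF xS[OF that]]], of X] that by blast
    moreover have "zeta (of_real x) \<in> \<real>" using that X3 by (intro zeta_of_real_in_Reals) auto
    moreover have "Digamma (of_real x) \<in> (\<real>::complex set)" using that X3 by (intro Polygamma_Real) auto
    ultimately have "W (of_real x) \<in> \<real>" unfolding W_def
      by (intro Reals_add Reals_divide Reals_minus Reals_of_real) auto
    then show ?thesis unfolding w_def by (simp add: of_real_Re)
  qed
  have W'b: "norm (W' (of_real x)) < pi\<^sup>2 / 4" if x: "x > X" for x
  proof -
    note b = z_bounds[OF xS[OF x]]
    define A where "A = deriv (deriv zeta) (of_real x) * zeta (of_real x) - deriv zeta (of_real x) * deriv zeta (of_real x)"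
    have "norm A \<le> norm (deriv (deriv zeta) (of_real x)) * norm (zeta (of_real x)) + norm (deriv zeta (of_real x)) * norm (deriv zeta (of_real x))"
      unfolding A_def norm_mult[symmetric] by (rule norm_triangle_ineq4)
    also have "\<dots> \<le> 1/10 * (11/10) + 1/10 * (1/10)" using b by (intro add_mono mult_mono) auto
    finally have "norm A \<le> 12/100" by simp
    moreover have "(9/10) * (9/10) \<le> norm (zeta (of_real x) * zeta (of_real x))"
      unfolding norm_mult using b by (intro mult_mono) auto
    ultimately have "norm (A / (zeta (of_real x) * zeta (of_real x))) \<le> (12/100) / ((9/10) * (9/10))"
      unfolding norm_divide by (intro frac_le) auto
    moreover have "norm (Polygamma 1 (complex_of_real x)) \<le> pi\<^sup>2 / 6"
    proof -
      have "Polygamma 1 (complex_of_real x) = of_real (Polygamma 1 x)" using x X3 by (intro Polygamma_of_real) auto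
      then show ?thesis using Polygamma_1_real_bound[of x] x X3 by simp
    qed
    ultimately have "norm (W' (of_real x)) \<le> pi\<^sup>2 / 6 + (12/100) / ((9/10) * (9/10))"
      unfolding W'_def A_def by (intro norm_triangle_le add_mono) auto
    also have "\<dots> < pi\<^sup>2 / 4"
    proof -
      have "3 * 3 < pi * pi" using pi_gt3 by (intro mult_strict_mono) auto
      then show ?thesis by (simp add: power2_eq_square)
    qed
    finally show ?thesis .
  qed
  define Q where "Q = (\<lambda>x. w x * cos (pi * x / 2) - pi / 2 * sin (pi * x / 2))"
  have sc: "sin (of_real pi * of_real x / 2 :: complex) = of_real (sin (pi * x / 2))"
    "cos (of_real pi * of_real x / 2 :: complex) = of_real (cos (pi * x / 2))" for x
    by (simp_all flip: sin_of_real cos_of_real)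
  have qQ: "q (of_real x) = of_real (Q x)" if "x > X" for x
    unfolding q_def Q_def sc Wr[OF that] by simp
  have zero_iff: "deriv zeta (of_real (1 - x)) = 0 \<longleftrightarrow> Q x = 0" if "x > X" for x
    using D1[OF xS[OF that]] U0[OF xS[OF that]] qQ[OF that] by simp
  have simple: "deriv (deriv zeta) (of_real (1 - x)) \<noteq> 0" if x: "x > X" and Q0: "Q x = 0" for x
  proof
    assume "deriv (deriv zeta) (of_real (1 - x)) = 0"
    then have "q' (of_real x) = 0"
      using D2[OF xS[OF x]] U0[OF xS[OF x]] qQ[OF x] Q0 by simp
    \<comment> \<open>At a zero of \<open>Q\<close> one may replace w c by (pi/2) d; multiplied by
      c, the derivative becomes W' c^2 - (pi/2)^2 (c^2 + d^2). So a double zero would force W' c^2 =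
      pi^2/4, too large for \<open>W'b\<close>.\<close>
    then have "q' (of_real x) * of_real (cos (pi * x / 2)) = 0" by simp
    define c where "c = cos (pi * x / 2)"
    define d where "d = sin (pi * x / 2)"
    have cd: "c\<^sup>2 + d\<^sup>2 = 1" unfolding c_def d_def by simp
    have wc: "w x * c = pi / 2 * d" using Q0 unfolding Q_def c_def d_def by simp
    have "0 = q' (of_real x) * of_real c" using \<open>q' (of_real x) * of_real (cos (pi * x / 2)) = 0\<close> unfolding c_def by simp
    also have "\<dots> = W' (of_real x) * of_real (c\<^sup>2) - of_real (pi / 2 * d * (w x * c) + (pi / 2)\<^sup>2 * c\<^sup>2)"
      unfolding q'_def sc Wr[OF x] c_def[symmetric] d_def[symmetric] by (simp add: algebra_simps power2_eq_square)
    also have "pi / 2 * d * (w x * c) + (pi / 2)\<^sup>2 * c\<^sup>2 = (pi / 2)\<^sup>2 * (c\<^sup>2 + d\<^sup>2)"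
      unfolding wc by (simp add: algebra_simps power2_eq_square)
    also have "\<dots> = pi\<^sup>2 / 4" unfolding cd by (simp add: power_divide)
    finally have "W' (of_real x) * of_real (c\<^sup>2) = of_real (pi\<^sup>2 / 4)" by simp
    then have "norm (W' (of_real x)) * c\<^sup>2 = pi\<^sup>2 / 4"
      by (metis abs_of_nonneg norm_mult norm_of_real zero_le_power2 divide_nonneg_nonneg zero_le_numeral)
    moreover have "norm (W' (of_real x)) * c\<^sup>2 \<le> norm (W' (of_real x)) * 1"
    proof (rule mult_left_mono)
      show "c\<^sup>2 \<le> 1" using cd zero_le_power2[of d] by linarith
    qed simp
    ultimately show False using W'b[OF x] by simp
  qed
  have wd: "(w has_real_derivative Re (W' (of_real x))) (at x)" if "x > X" for x
    unfolding w_def by (intro has_field_derivative_Re has_vector_derivative_real_field dW xS that)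
  have cosn: "cos (pi * x / 2) \<noteq> 0" if x: "2 * real m + 1 < x" "x < 2 * real m + 3" for x m
  proof -
    define y where "y = pi * x / 2 - pi * real m - pi"
    have "pi * (2 * real m + 1) < pi * x" "pi * x < pi * (2 * real m + 3)"
      using x by simp_all
    then have "- (pi / 2) < y" "y < pi / 2" unfolding y_def by (simp_all add: algebra_simps)
    then have "cos y > 0" by (rule cos_gt_zero_pi)
    have e: "pi * x / 2 = y + real (Suc m) * pi" unfolding y_def by (simp add: algebra_simps)
    have "cos (pi * x / 2) = cos y * cos (real (Suc m) * pi)"
      unfolding e cos_add by (simp only: sin_npi)
    then show ?thesis using \<open>cos y > 0\<close> by (simp add: cos_npi del: of_nat_Suc)
  qed
  have uniq: "x = y" if x: "2 * real m + 1 < x" "x < 2 * real m + 3" "Q x = 0"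
    and y: "2 * real m + 1 < y" "y < 2 * real m + 3" "Q y = 0" and X: "X \<le> 2 * real m + 1" for x y m
  proof (rule ccontr)
    assume "x \<noteq> y"
    define r where "r = (\<lambda>x. w x - pi / 2 * tan (pi * x / 2))"
    have rQ: "r z = 0" if "2 * real m + 1 < z" "z < 2 * real m + 3" "Q z = 0" for z
      using cosn[OF that(1,2)] that(3) unfolding r_def Q_def tan_def by (simp add: field_simps)
    have dr: "(r has_real_derivative (Re (W' (of_real z)) - pi / 2 * (inverse ((cos (pi * z / 2))\<^sup>2) * (pi / 2)))) (at z)"
      if "2 * real m + 1 < z" "z < 2 * real m + 3" for z
      unfolding r_def using cosn[OF that] that X
      by (auto intro!: derivative_eq_intros wd)
    have neg: "Re (W' (of_real z)) - pi / 2 * (inverse ((cos (pi * z / 2))\<^sup>2) * (pi / 2)) < 0"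
      if z: "2 * real m + 1 < z" "z < 2 * real m + 3" for z
    proof -
      have "(cos (pi * z / 2))\<^sup>2 \<le> 1" by (simp add: abs_square_le_1)
      then have "1 \<le> inverse ((cos (pi * z / 2))\<^sup>2)" using cosn[OF z] by (intro one_le_inverse) auto
      then have "pi\<^sup>2 / 4 * 1 \<le> pi\<^sup>2 / 4 * inverse ((cos (pi * z / 2))\<^sup>2)" by (intro mult_left_mono) auto
      moreover have "Re (W' (of_real z)) < pi\<^sup>2 / 4"
        using W'b[of z] complex_Re_le_cmod[of "W' (of_real z)"] z X by linarith
      moreover have "pi / 2 * (inverse ((cos (pi * z / 2))\<^sup>2) * (pi / 2)) = pi\<^sup>2 / 4 * inverse ((cos (pi * z / 2))\<^sup>2)"
        by (simp add: power2_eq_square)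
      ultimately show ?thesis by linarith
    qed
    have False if ab: "a < b" "2 * real m + 1 < a" "b < 2 * real m + 3" "Q a = 0" "Q b = 0" for a b
    proof -
      have "r b < r a"
        by (rule DERIV_neg_imp_decreasing[OF ab(1)]) (use ab dr neg in \<open>fastforce\<close>)
      then show False using rQ[of a] rQ[of b] ab by simp
    qed
    then show False using x y \<open>x \<noteq> y\<close> by (metis linorder_less_linear)
  qed
  \<comment> \<open>At odd integers the cosine vanishes and \<open>Q\<close> has alternating signs.
    This gives existence by the intermediate value theorem and keeps the zeros off the
    endpoints.\<close>
  have Qodd: "Q (2 * real m + 1) = - (pi / 2) * (-1) ^ m" for m
  proof -
    have e: "pi * (2 * real m + 1) / 2 = real m * pi + pi / 2" by (simp add: field_simps)
    have "cos (real m * pi + pi / 2) = 0" "sin (real m * pi + pi / 2) = (-1) ^ m"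
      by (simp_all add: cos_add sin_add sin_npi cos_npi)
    then show ?thesis unfolding Q_def e by simp
  qed
  have ex: "\<exists>x. 2 * real m + 1 < x \<and> x < 2 * real m + 3 \<and> Q x = 0" if "X < 2 * real m + 1" for m
  proof -
    have cont: "continuous_on {2 * real m + 1..2 * real m + 3} Q"
    proof (rule DERIV_continuous_on)
      fix x assume x: "x \<in> {2 * real m + 1..2 * real m + 3}"
      then have "x > X" using that by simp
      show "(Q has_real_derivative Re (W' (of_real x)) * cos (pi * x / 2) - w x * (pi / 2) * sin (pi * x / 2)
          - pi / 2 * (cos (pi * x / 2) * (pi / 2))) (at x within {2 * real m + 1..2 * real m + 3})"
        unfolding Q_def
        by (auto intro!: derivative_eq_intros DERIV_subset[OF wd[OF \<open>x > X\<close>]] simp: algebra_simps)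
    qed
    have Qb: "Q (2 * real m + 3) = pi / 2 * (-1) ^ m" using Qodd[of "Suc m"] by (simp add: algebra_simps)
    have "\<exists>x. 2 * real m + 1 \<le> x \<and> x \<le> 2 * real m + 3 \<and> Q x = 0"
    proof (cases "even m")
      case True
      then show ?thesis by (intro IVT') (auto simp: Qodd Qb cont)
    next
      case False
      then show ?thesis by (intro IVT2') (auto simp: Qodd Qb cont)
    qed
    then obtain x where x: "2 * real m + 1 \<le> x" "x \<le> 2 * real m + 3" "Q x = 0" by blast
    moreover have "x \<noteq> 2 * real m + 1" "x \<noteq> 2 * real m + 3" using x(3) Qodd[of m] Qb by auto
    ultimately show ?thesis by (intro exI[of _ x]) auto
  qed
  define N where "N = nat \<lceil>X\<rceil>"
  have NX: "X < 2 * real n + 1" if "n \<ge> N" for n using that X3 unfolding N_def by linarith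
  \<comment> \<open>The subtracted 1 comes from the reflection: a zero x of \<open>Q\<close> belongs
    to the zero 1 - x = -\<alpha> n of zeta'.\<close>
  define \<alpha> where "\<alpha> = (\<lambda>n. (SOME x. 2 * real n + 1 < x \<and> x < 2 * real n + 3 \<and> Q x = 0) - 1)"
  have \<alpha>: "2 * real n + 1 < \<alpha> n + 1 \<and> \<alpha> n + 1 < 2 * real n + 3 \<and> Q (\<alpha> n + 1) = 0" if "n \<ge> N" for n
    using someI_ex[OF ex[OF NX[OF that]]] unfolding \<alpha>_def by simp
  show ?thesis
  proof (rule that[of N \<alpha>])
    show "N \<ge> 1" using X3 unfolding N_def by linarith
    show "2 * real n < \<alpha> n \<and> \<alpha> n < 2 * real n + 2" if "n \<ge> N" for n using \<alpha>[OF that] by simp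
    show "deriv zeta (of_real (- \<alpha> n)) = 0 \<and> deriv (deriv zeta) (of_real (- \<alpha> n)) \<noteq> 0" if "n \<ge> N" for n
    proof -
      have "\<alpha> n + 1 > X" using \<alpha>[OF that] NX[OF that] by simp
      then show ?thesis using zero_iff[of "\<alpha> n + 1"] simple[of "\<alpha> n + 1"] \<alpha>[OF that] by simp
    qed
    fix l assume l: "l \<le> - 2 * real N" "deriv zeta (of_real l) = 0"
    define x where "x = 1 - l"
    \<comment> \<open>The floor places x in the half-open interval from 2m + 1 to 2m + 3; the left
      endpoint is then excluded by \<open>Qodd\<close>.\<close>
    define m where "m = nat \<lfloor>(x - 1) / 2\<rfloor>"
    have x1: "x \<ge> 2 * real N + 1" using l unfolding x_def by simp
    then have "\<lfloor>(x - 1) / 2\<rfloor> \<ge> int N" by (simp add: le_floor_iff)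
    then have mN: "m \<ge> N" and "real m = of_int \<lfloor>(x - 1) / 2\<rfloor>" unfolding m_def by linarith+
    then have "real m \<le> (x - 1) / 2" "(x - 1) / 2 < real m + 1" using floor_correct[of "(x - 1) / 2"] by auto
    then have m: "2 * real m + 1 \<le> x" "x < 2 * real m + 3" by (simp_all add: field_simps)
    have "x > X" using NX[OF mN] m by simp
    then have Q0: "Q x = 0" using zero_iff[of x] l unfolding x_def by simp
    then have "x \<noteq> 2 * real m + 1" using Qodd[of m] by auto
    then have "x = \<alpha> m + 1" using uniq[of m x "\<alpha> m + 1"] m Q0 \<alpha>[OF mN] NX[OF mN] by auto
    then show "\<exists>n\<ge>N. l = - \<alpha> n" using mN unfolding x_def by (intro exI[of _ m]) auto
  qed
qed

section \<open>The partial fraction expansion\<close>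

text \<open>The factorisation lemma wants a centre at which the function is known not to vanish. The
  point 1 qualifies, so the ball is enclosed in one around 1.\<close>

lemma finite_zeros_dzeta_num: "finite {l \<in> ball c r. dzeta_num l = 0}"
proof (rule holomorphic_factor_zeros_ball[OF holomorphic_dzeta_num, of 1 "norm (c - 1) + r"])
  show "dzeta_num 1 \<noteq> 0" by (simp add: dzeta_num_1)
  assume "finite {l \<in> ball 1 (norm (c - 1) + r). dzeta_num l = 0}"
  then show ?thesis
  proof (rule rev_finite_subset)
    show "{l \<in> ball c r. dzeta_num l = 0} \<subseteq> {l \<in> ball 1 (norm (c - 1) + r). dzeta_num l = 0}"
    proof
      fix l assume "l \<in> {l \<in> ball c r. dzeta_num l = 0}"
      then show "l \<in> {l \<in> ball 1 (norm (c - 1) + r). dzeta_num l = 0}"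
        using dist_triangle[of 1 l c] by (auto simp: dist_norm norm_minus_commute)
    qed
  qed
qed

lemma zeta'_zeros_eq: "zeta'_zeros = {l. dzeta_num l = 0 \<and> Im l \<noteq> 0}"
proof -
  have "deriv zeta l = 0 \<longleftrightarrow> dzeta_num l = 0" if "Im l \<noteq> 0" for l
  proof -
    have "l \<noteq> 1" using that by auto
    then show ?thesis using deriv_zeta[of l] by auto
  qed
  then show ?thesis unfolding zeta'_zeros_def by blast
qed

text \<open>The condition Im l \<noteq> 0 is open, so continuity alone does not suffice; local
  finiteness of the zeros rules out limit points on the real axis.\<close>

lemma closed_zeta'_zeros: "closed zeta'_zeros"
  unfolding closed_limpt
proof (intro allI impI)
  fix x assume "x islimpt zeta'_zeros"
  then have "infinite (zeta'_zeros \<inter> ball x 1)" unfolding islimpt_eq_infinite_ball by simp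
  moreover have "zeta'_zeros \<inter> ball x 1 \<subseteq> {l \<in> ball x 1. dzeta_num l = 0}"
    unfolding zeta'_zeros_eq by auto
  ultimately show "x \<in> zeta'_zeros" using finite_zeros_dzeta_num finite_subset by blast
qed

text \<open>Away from 1 the factor (s - 1)^2 has order zero. This transfers multiplicities from
  zeta' to the entire function.\<close>

lemma zorder_deriv_zeta:
  assumes "l \<noteq> 1"
  shows "zorder (deriv zeta) l = zorder dzeta_num l"
proof -
  have ev1: "eventually (\<lambda>s. s \<noteq> 1) (at l)"
    using eventually_at_in_open'[of "- {1}" l] assms by (simp add: open_Compl)
  have "dzeta_num s = (s - 1) ^ 2 * deriv zeta s" if "s \<noteq> 1" for s
    using deriv_zeta[OF that] that by simp
  with ev1 have ev2: "eventually (\<lambda>s. dzeta_num s = (s - 1) ^ 2 * deriv zeta s) (at l)"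
    by (auto elim: eventually_mono)
  have ev3: "eventually (\<lambda>s. dzeta_num s \<noteq> 0) (at l)"
    using non_zero_neighbour_alt[OF holomorphic_dzeta_num[of UNIV], of l 1]
    by (auto simp: dzeta_num_1 elim: eventually_mono)
  have "zorder dzeta_num l = zorder (\<lambda>s. (s - 1) ^ 2 * deriv zeta s) l"
    by (rule zorder_cong[OF ev2 refl])
  also have "\<dots> = zorder (\<lambda>s. (s - 1) ^ 2) l + zorder (deriv zeta) l"
  proof (rule zorder_times_analytic)
    have "deriv zeta holomorphic_on - {1}" by (intro holomorphic_deriv holomorphic_zeta) auto
    then show "deriv zeta analytic_on {l}" using assms by (metis ComplI analytic_at open_Compl finite_imp_closed finite.emptyI finite.insertI singletonD)
    show "eventually (\<lambda>s. (s - 1) ^ 2 * deriv zeta s \<noteq> 0) (at l)"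
      using ev2 ev3 by eventually_elim simp
  qed (auto intro!: analytic_intros)
  also have "zorder (\<lambda>s. (s - 1) ^ 2) l = 0" using zorder_linear_power[of 1 2 l] assms by simp
  finally show ?thesis by simp
qed

lemma zero_term_eq:
  assumes "l \<in> zeta'_zeros"
  shows "zero_term \<rho> s l = of_int (zorder dzeta_num l) * ((\<rho> - s) / ((s - l) * (\<rho> - l)))"
proof -
  have "l \<noteq> 1" using assms unfolding zeta'_zeros_def by auto
  then show ?thesis unfolding zero_term_def by (simp add: zorder_deriv_zeta)
qed

lemma dzeta_num_zorder_of_nat: "of_int (zorder dzeta_num l) = of_nat (nat (zorder dzeta_num l))"
  using entire_zorder_nonneg[OF holomorphic_dzeta_num, of 1 l] by (simp add: dzeta_num_1)

lemma zero_term_series_uniform: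
  assumes \<rho>: "deriv zeta \<rho> \<noteq> 0" and K: "compact K" "K \<inter> zeta'_zeros = {}"
  shows "uniform_limit K (\<lambda>F s. \<Sum>l\<in>F. zero_term \<rho> s l)
          (\<lambda>s. \<Sum>\<^sub>\<infinity>l\<in>zeta'_zeros. zero_term \<rho> s l) (finite_subsets_at_top zeta'_zeros)"
proof -
  \<comment> \<open>Adding \<rho> to the compact set gives one constant for both denominators s - l
    and \<rho> - l.\<close>
  have dis: "insert \<rho> K \<inter> zeta'_zeros = {}" using K \<rho> unfolding zeta'_zeros_def by auto
  obtain C where C: "C > 0" "\<And>s l. s \<in> insert \<rho> K \<Longrightarrow> l \<in> zeta'_zeros \<Longrightarrow> 1 + norm (l - 1) \<le> C * norm (s - l)"
    by (rule compact_closed_separation[OF compact_insert[OF K(1)] closed_zeta'_zeros dis, where c = 1], rule that)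
  obtain b where b: "\<And>s. s \<in> K \<Longrightarrow> norm s \<le> b"
    using compact_imp_bounded[OF K(1)] unfolding bounded_iff by blast
  define m where "m = (\<lambda>l. real (nat (zorder dzeta_num l)))"
  show ?thesis
  proof (rule Weierstrass_m_test_general)
    have "(\<lambda>l. m l / (1 + norm (l - 1))\<^sup>2) summable_on {l. dzeta_num l = 0}"
      unfolding m_def
      by (rule zeros_inverse_square_summable[OF holomorphic_dzeta_num order_three_halves_dzeta_num])
         (simp add: dzeta_num_1)
    then have "(\<lambda>l. m l / (1 + norm (l - 1))\<^sup>2) summable_on zeta'_zeros"
      by (rule summable_on_subset_banach) (auto simp: zeta'_zeros_eq)
    then show "(\<lambda>l. (norm \<rho> + b) * C\<^sup>2 * (m l / (1 + norm (l - 1))\<^sup>2)) summable_on zeta'_zeros"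
      by (rule summable_on_cmult_right)
    fix l s assume l: "l \<in> zeta'_zeros" and s: "s \<in> K"
    have "norm (zero_term \<rho> s l) = m l * norm ((\<rho> - s) / ((s - l) * (\<rho> - l)))"
      unfolding zero_term_eq[OF l] dzeta_num_zorder_of_nat m_def norm_mult[of "of_nat _"] norm_of_nat ..
    also have "\<dots> \<le> m l * (norm (\<rho> - s) * C\<^sup>2 / (1 + norm (l - 1))\<^sup>2)"
      using C(2)[of s l] C(2)[of \<rho> l] l s by (intro mult_left_mono norm_partial_fraction_le) (auto simp: m_def)
    also have "\<dots> = norm (\<rho> - s) * (C\<^sup>2 * (m l / (1 + norm (l - 1))\<^sup>2))" by simp
    also have "\<dots> \<le> (norm \<rho> + b) * (C\<^sup>2 * (m l / (1 + norm (l - 1))\<^sup>2))"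
      using b[OF s] norm_triangle_ineq4[of \<rho> s] by (intro mult_right_mono) (auto simp: m_def)
    finally show "norm (zero_term \<rho> s l) \<le> (norm \<rho> + b) * C\<^sup>2 * (m l / (1 + norm (l - 1))\<^sup>2)"
      by (simp add: mult.assoc)
  qed
qed

text \<open>The zeros of \<open>dzeta_num\<close> fall into three families.
  \<open>zeta'_zeros\<close> gives the sum; the finitely many real zeros in \<open>A\<close> cost at
  most 1/Im s + 1/Im \<rho> each, with multiplicity, because a real point is at distance at least Im
  u from u; the simple real zeros in \<open>T\<close> give the logarithm.\<close>

lemma log_deriv_estimate:
  fixes a b :: real
  obtains C where "\<And>\<rho> s. deriv (deriv zeta) \<rho> = 0 \<Longrightarrow> Re \<rho> > 1/2 \<Longrightarrow> Im \<rho> > 0 \<Longrightarrow> deriv zeta \<rho> \<noteq> 0 \<Longrightarrow>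
      a \<le> Re s \<Longrightarrow> Re s \<le> b \<Longrightarrow> Im s > 0 \<Longrightarrow> deriv zeta s \<noteq> 0 \<Longrightarrow>
      norm (deriv (deriv zeta) s / deriv zeta s
        - (of_real (ln (Im \<rho> / Im s) / 2) + (\<Sum>\<^sub>\<infinity>l\<in>zeta'_zeros. zero_term \<rho> s l)))
      \<le> C * (1 / Im s + 1 / Im \<rho>)"
proof -
  obtain N0 \<alpha> where N0: "N0 \<ge> 1"
    "\<And>n. n \<ge> N0 \<Longrightarrow> 2 * real n < \<alpha> n \<and> \<alpha> n < 2 * real n + 2"
    "\<And>n. n \<ge> N0 \<Longrightarrow> deriv zeta (of_real (- \<alpha> n)) = 0 \<and> deriv (deriv zeta) (of_real (- \<alpha> n)) \<noteq> 0"
    "\<And>l. l \<le> - 2 * real N0 \<Longrightarrow> deriv zeta (of_real l) = 0 \<Longrightarrow> \<exists>n\<ge>N0. l = - \<alpha> n"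
    by (rule real_zeros_deriv_zeta, rule that)
  obtain B where B: "\<And>s. Re s \<ge> B \<Longrightarrow> deriv zeta s \<noteq> 0 \<and> deriv (deriv zeta) s \<noteq> 0"
    by (rule zeta_derivs_nonzero_right, rule that)
  \<comment> \<open>Large enough that the real zeros beyond -2N are under control and that both Re s
    \<ge> a and Re \<rho> > 1/2 are at least -N.\<close>
  define N where "N = max N0 (nat \<lceil>\<bar>a\<bar>\<rceil>)"
  have N: "N \<ge> N0" "N \<ge> 1" "- real N \<le> a" "- real N \<le> 1/2" unfolding N_def using N0(1) by linarith+
  define Z where "Z = {l. dzeta_num l = 0}"
  define A where "A = {l \<in> Z. Im l = 0 \<and> Re l > - 2 * real N}"
  define T where "T = (\<lambda>n. complex_of_real (- \<alpha> n)) ` {N..}"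
  have dz0: "deriv zeta l = 0 \<longleftrightarrow> dzeta_num l = 0" if "l \<noteq> 1" for l
    using deriv_zeta[OF that] that by auto
  have \<alpha>1: "complex_of_real (- \<alpha> n) \<noteq> 1" if "n \<ge> N0" for n
  proof
    assume "complex_of_real (- \<alpha> n) = 1"
    then have "- \<alpha> n = 1" by (metis of_real_1 of_real_eq_iff)
    then show False using N0(2)[OF that] by linarith
  qed
  have TZ: "T \<subseteq> Z" unfolding T_def Z_def using N0(3) dz0[OF \<alpha>1] N(1) by auto
  have Zun: "Z = zeta'_zeros \<union> (A \<union> T)"
  proof
    show "Z \<subseteq> zeta'_zeros \<union> (A \<union> T)"
    proof
      fix l assume l: "l \<in> Z"
      show "l \<in> zeta'_zeros \<union> (A \<union> T)"
      proof (cases "Im l \<noteq> 0 \<or> Re l > - 2 * real N")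
        case True
        then show ?thesis using l unfolding A_def Z_def zeta'_zeros_eq by auto
      next
        case False
        define x where "x = Re l"
        have lx: "l = of_real x" using False unfolding x_def by (simp add: complex_eq_iff)
        have x: "x \<le> - 2 * real N" using False unfolding x_def by simp
        have "of_real x \<noteq> (1::complex)"
        proof
          assume "of_real x = (1::complex)"
          then have "x = 1" by (metis of_real_1 of_real_eq_iff)
          then show False using x by linarith
        qed
        then have "deriv zeta (of_real x) = 0" using l dz0 unfolding Z_def lx by simp
        moreover have "x \<le> - 2 * real N0" using x N(1) by linarith
        ultimately obtain n where n: "n \<ge> N0" "x = - \<alpha> n" using N0(4) by blast
        \<comment> \<open>From -2n - 2 < x \<le> -2N, so the zero carries an index in the tail even
          though only n \<ge> N0 was known.\<close>
        have "real N < real n + 1" using N0(2)[OF n(1)] n(2) x by linarith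
        then have "n \<ge> N" by linarith
        then show ?thesis unfolding T_def lx n(2) by blast
      qed
    qed
    show "zeta'_zeros \<union> (A \<union> T) \<subseteq> Z" using TZ unfolding A_def Z_def zeta'_zeros_eq by auto
  qed
  have dis1: "zeta'_zeros \<inter> (A \<union> T) = {}" unfolding zeta'_zeros_eq A_def T_def by auto
  have dis2: "A \<inter> T = {}"
  proof -
    have "\<not> Re l > - 2 * real N" if lT: "l \<in> T" for l
    proof -
      obtain n where n: "n \<ge> N" "l = of_real (- \<alpha> n)" using lT unfolding T_def by auto
      then have "2 * real n < \<alpha> n" using N0(2)[of n] N(1) by linarith
      then have "- \<alpha> n \<le> - 2 * real N" using n(1) by linarith
      then show ?thesis using n(2) by simp
    qed
    then show ?thesis unfolding A_def by auto
  qed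
  have finA: "finite A"
  proof (rule finite_subset[OF _ finite_zeros_dzeta_num[of 0 "2 * real N + \<bar>B\<bar> + 2"]])
    show "A \<subseteq> {l \<in> ball 0 (2 * real N + \<bar>B\<bar> + 2). dzeta_num l = 0}"
    proof
      fix l assume l: "l \<in> A"
      \<comment> \<open>Right of \<open>B\<close> zeta' does not vanish; the 2 keeps l away from 1,
        where the two functions cannot be compared.\<close>
      have "Re l < \<bar>B\<bar> + 2"
      proof (rule ccontr)
        assume c: "\<not> Re l < \<bar>B\<bar> + 2"
        then have "l \<noteq> 1" "Re l \<ge> B" by auto
        then show False using B[of l] dz0[of l] l unfolding A_def Z_def by auto
      qed
      moreover have "norm l \<le> \<bar>Re l\<bar> + \<bar>Im l\<bar>" by (rule cmod_le)
      ultimately have "norm l < 2 * real N + \<bar>B\<bar> + 2" using l unfolding A_def by auto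
      then show "l \<in> {l \<in> ball 0 (2 * real N + \<bar>B\<bar> + 2). dzeta_num l = 0}" using l unfolding A_def Z_def by simp
    qed
  qed
  define M where "M = (\<Sum>l\<in>A. real (nat (zorder dzeta_num l)))"
  \<comment> \<open>A common upper bound for Re s and for Re \<rho>, the latter because zeta'' has
    no zeros right of \<open>B\<close>.\<close>
  define b' where "b' = max b B"
  \<comment> \<open>The summands stem from the finitely many real zeros, the comparison with the
    logarithm, and the pole at 1.\<close>
  define C where "C = M + (8 + (b' + 2 * real N) / 2) + 2"
  show ?thesis
  proof (rule that[of C])
    fix \<rho> s
    assume \<rho>: "deriv (deriv zeta) \<rho> = 0" "Re \<rho> > 1/2" "Im \<rho> > 0" "deriv zeta \<rho> \<noteq> 0"
      and s: "a \<le> Re s" "Re s \<le> b" "Im s > 0" "deriv zeta s \<noteq> 0"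
    have ne1: "s \<noteq> 1" "\<rho> \<noteq> 1" using s(3) \<rho>(3) by auto
    have Fs: "dzeta_num s \<noteq> 0" "dzeta_num \<rho> \<noteq> 0" using dz0 ne1 s \<rho> by auto
    define t where "t = (\<lambda>l. of_int (zorder dzeta_num l) * ((\<rho> - s) / ((s - l) * (\<rho> - l))))"
    have "(t has_sum (deriv dzeta_num s / dzeta_num s - deriv dzeta_num \<rho> / dzeta_num \<rho>)) Z"
      unfolding t_def Z_def
      by (rule log_deriv_partial_fractions[OF holomorphic_dzeta_num order_three_halves_dzeta_num Fs])
    moreover have "deriv dzeta_num s / dzeta_num s = deriv (deriv zeta) s / deriv zeta s + 2 / (s - 1)"
      using log_deriv_deriv_zeta[OF ne1(1) s(4)] by simp
    moreover have "deriv dzeta_num \<rho> / dzeta_num \<rho> = 2 / (\<rho> - 1)"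
      using log_deriv_deriv_zeta[OF ne1(2) \<rho>(4)] \<rho>(1) by simp
    ultimately have ts: "(t has_sum (deriv (deriv zeta) s / deriv zeta s + 2 / (s - 1) - 2 / (\<rho> - 1))) Z" by simp
    have sub: "t summable_on Y" if "Y \<subseteq> Z" for Y
      using summable_on_subset_banach[OF has_sum_imp_summable[OF ts] that] .
    have sums: "infsum t Z = infsum t zeta'_zeros + (sum t A + infsum t T)"
    proof -
      have "infsum t (zeta'_zeros \<union> (A \<union> T)) = infsum t zeta'_zeros + infsum t (A \<union> T)"
        using Zun dis1 by (intro infsum_Un_disjoint sub) auto
      also have "infsum t (A \<union> T) = infsum t A + infsum t T"
        using Zun dis2 by (intro infsum_Un_disjoint sub) auto
      finally show ?thesis unfolding Zun[symmetric] using finA by simp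
    qed
    have zt: "(\<Sum>\<^sub>\<infinity>l\<in>zeta'_zeros. zero_term \<rho> s l) = infsum t zeta'_zeros"
      by (intro infsum_cong) (simp add: zero_term_eq t_def)
    have split: "t l = of_nat (nat (zorder dzeta_num l)) * (1 / (s - l) - 1 / (\<rho> - l))" if "l \<in> Z" for l
    proof -
      have "s \<noteq> l" "\<rho> \<noteq> l" using that Fs unfolding Z_def by auto
      then show ?thesis unfolding t_def dzeta_num_zorder_of_nat by (simp add: field_simps)
    qed
    have inv: "norm (c / (u - of_real x)) \<le> norm c / Im u" if "Im u > 0" for u c :: complex and x
    proof -
      have "Im u \<le> norm (u - of_real x)" using abs_Im_le_cmod[of "u - of_real x"] by simp
      then show ?thesis unfolding norm_divide using that by (intro divide_left_mono mult_pos_pos) auto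
    qed
    have bA: "norm (sum t A) \<le> M * (1 / Im s + 1 / Im \<rho>)"
      unfolding M_def sum_distrib_right
    proof (rule sum_norm_le)
      fix l assume l: "l \<in> A"
      have lr: "l = of_real (Re l)" using l unfolding A_def by (simp add: complex_eq_iff)
      have "norm (1 / (s - l) - 1 / (\<rho> - l)) \<le> 1 / Im s + 1 / Im \<rho>"
        using inv[OF s(3), of 1 "Re l"] inv[OF \<rho>(3), of 1 "Re l"] norm_triangle_ineq4[of "1 / (s - l)" "1 / (\<rho> - l)"]
        unfolding lr[symmetric] norm_one by linarith
      moreover have "l \<in> Z" using l unfolding A_def by simp
      ultimately show "norm (t l) \<le> real (nat (zorder dzeta_num l)) * (1 / Im s + 1 / Im \<rho>)"
        unfolding split[OF \<open>l \<in> Z\<close>] norm_mult by (simp add: mult_left_mono)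
    qed
    have bT: "norm (infsum t T - of_real (ln (Im \<rho> / Im s) / 2)) \<le> (8 + (b' + 2 * real N) / 2) * (1 / Im s + 1 / Im \<rho>)"
    proof (rule inverse_shift_sum_log)
      show "2 * real n \<le> \<alpha> n \<and> \<alpha> n \<le> 2 * real n + 2" if "n \<ge> N" for n
        using N0(2)[of n] N(1) that by force
      show "Re \<rho> \<le> b'" using B[of \<rho>] \<rho>(1) unfolding b'_def by (meson linear max.coboundedI2)
      have inj: "inj_on (\<lambda>n. complex_of_real (- \<alpha> n)) {N..}"
      proof (rule inj_onI)
        fix m n assume mn: "m \<in> {N..}" "n \<in> {N..}" "complex_of_real (- \<alpha> m) = of_real (- \<alpha> n)"
        then have "\<alpha> m = \<alpha> n" by simp
        moreover have "2 * real m < \<alpha> m" "\<alpha> m < 2 * real m + 2" "2 * real n < \<alpha> n" "\<alpha> n < 2 * real n + 2"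
          using N0(2)[of m] N0(2)[of n] mn N(1) by auto
        ultimately have "real m < real n + 1" "real n < real m + 1" by linarith+
        then show "m = n" by linarith
      qed
      have "(t has_sum infsum t T) T" using sub[OF TZ] by simp
      then have "((t \<circ> (\<lambda>n. complex_of_real (- \<alpha> n))) has_sum infsum t T) {N..}"
        unfolding T_def using has_sum_reindex[OF inj] by blast
      moreover have "(t \<circ> (\<lambda>n. complex_of_real (- \<alpha> n))) n = 1 / (s + of_real (\<alpha> n)) - 1 / (\<rho> + of_real (\<alpha> n))" if n: "n \<in> {N..}" for n
      proof -
        define l where "l = complex_of_real (- \<alpha> n)"
        have n0: "n \<ge> N0" using n N(1) by simp
        have lZ: "l \<in> Z" using TZ n unfolding T_def l_def by auto
        have l1: "l \<noteq> 1" unfolding l_def using \<alpha>1[OF n0] .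
        \<comment> \<open>At a zero of zeta' other than 1, zeta'' is a nonzero multiple of the
          derivative of \<open>dzeta_num\<close>, so the known nonvanishing of zeta'' gives a simple
          zero.\<close>
        have "deriv dzeta_num l \<noteq> 0"
          using deriv_deriv_zeta[OF l1] N0(3)[OF n0] lZ unfolding l_def Z_def by auto
        then have "zorder dzeta_num l = 1"
          using lZ unfolding Z_def
          by (intro zorder_zero_eqI'[of _ _ 1]) (auto simp: analytic_on_open[OF open_UNIV] holomorphic_dzeta_num intro: analytic_on_subset[of _ UNIV])
        then show ?thesis using split[OF lZ] unfolding l_def by simp
      qed
      ultimately show "((\<lambda>n. 1 / (s + of_real (\<alpha> n)) - 1 / (\<rho> + of_real (\<alpha> n))) has_sum infsum t T) {N..}"
        using has_sum_cong by (smt (verit, best))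
    qed (use N s \<rho> in \<open>auto simp: b'_def\<close>)
    have b2: "norm (2 / (\<rho> - 1) - 2 / (s - 1)) \<le> 2 * (1 / Im s + 1 / Im \<rho>)"
      using inv[OF s(3), of 2 1] inv[OF \<rho>(3), of 2 1] norm_triangle_ineq4[of "2 / (\<rho> - 1)" "2 / (s - 1)"] by simp
    have "deriv (deriv zeta) s / deriv zeta s + 2 / (s - 1) - 2 / (\<rho> - 1) = infsum t Z"
      using ts by (simp add: has_sum_iff)
    then have "deriv (deriv zeta) s / deriv zeta s
        - (of_real (ln (Im \<rho> / Im s) / 2) + (\<Sum>\<^sub>\<infinity>l\<in>zeta'_zeros. zero_term \<rho> s l))
      = sum t A + (infsum t T - of_real (ln (Im \<rho> / Im s) / 2)) + (2 / (\<rho> - 1) - 2 / (s - 1))"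
      unfolding sums zt by (simp add: algebra_simps)
    also have "norm \<dots> \<le> M * (1 / Im s + 1 / Im \<rho>) + (8 + (b' + 2 * real N) / 2) * (1 / Im s + 1 / Im \<rho>) + 2 * (1 / Im s + 1 / Im \<rho>)"
      by (intro norm_triangle_le add_mono bA bT b2)
    also have "\<dots> = C * (1 / Im s + 1 / Im \<rho>)" unfolding C_def by (simp only: distrib_right)
    finally show "norm (deriv (deriv zeta) s / deriv zeta s
        - (of_real (ln (Im \<rho> / Im s) / 2) + (\<Sum>\<^sub>\<infinity>l\<in>zeta'_zeros. zero_term \<rho> s l)))
      \<le> C * (1 / Im s + 1 / Im \<rho>)" .
  qed
qed

theorem proposition1:
  fixes a b :: real
  assumes RH: "Riemann_Hypothesis"
  shows
    "(\<exists>C::real. \<forall>\<rho> s :: complex.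
        deriv (deriv zeta) \<rho> = 0 \<and> Re \<rho> > 1/2 \<and> Im \<rho> > 0 \<and> deriv zeta \<rho> \<noteq> 0 \<and>
        a \<le> Re s \<and> Re s \<le> b \<and> Im s > 0 \<and> deriv zeta s \<noteq> 0 \<longrightarrow>
        norm (deriv (deriv zeta) s / deriv zeta s
              - (complex_of_real (ln (Im \<rho> / Im s) / 2)
                 + (\<Sum>\<^sub>\<infinity>l\<in>zeta'_zeros. zero_term \<rho> s l)))
          \<le> C * (1 / Im s + 1 / Im \<rho>))
     \<and>
     (\<forall>(\<rho>::complex) K.
        deriv (deriv zeta) \<rho> = 0 \<and> Re \<rho> > 1/2 \<and> Im \<rho> > 0 \<and> deriv zeta \<rho> \<noteq> 0 \<and>
        compact K \<and> K \<inter> zeta'_zeros = {} \<longrightarrow>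
        uniform_limit K (\<lambda>F s. \<Sum>l\<in>F. zero_term \<rho> s l)
          (\<lambda>s. \<Sum>\<^sub>\<infinity>l\<in>zeta'_zeros. zero_term \<rho> s l)
          (finite_subsets_at_top zeta'_zeros))"
proof (rule conjI, goal_cases)
  case 1
  show ?case by (rule log_deriv_estimate[of a b]) blast
qed (use zero_term_series_uniform in auto)

end
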